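(* Let $X$ be a nonsingular real algebraic variety and let $Y$ be a slice subvariety of $X$. Then the transverse bundle $N^{\mathbb{R}X}\mathbb{R}Y$ of $\mathbb{R}Y$ in $\mathbb{R}X$ admits a complex structure. Such a complex structure is defined by a choice of a complex subvariety $V$ of $\mathbb{C}X$, transverse to $\mathbb{R}X$, which carves $\mathbb{R}Y$ on $\mathbb{R}X$ (that is, $\mathbb{R}Y=V\cap\mathbb{R}X$).
   Context: A real algebraic variety $X$ consists of a complex algebraic variety $\mathbb{C}X$ (its complex points) with an anti-holomorphic involution $\mathrm{conj}:\mathbb{C}X\to\mathbb{C}X$; $\mathbb{R}X=\mathrm{Fix}(\mathrm{conj})$ is its set of real points. If $X$ is nonsingular, $\mathbb{C}X$ is a complex manifold and $\mathbb{R}X$ is a smooth submanifold of it. A real algebraic subvariety $Y\subset X$ is given by a $\mathrm{conj}$-invariant complex algebraic subvariety $\mathbb{C}Y\subset\mathbb{C}X$, and $\mathbb{R}Y=\mathbb{C}Y\cap\mathbb{R}X$. A complex subvariety $V\subset\mathbb{C}X$ is transverse to $\mathbb{R}X$ if at every $p\in V\cap\mathbb{R}X$ the variety $V$ is nonsingular and $T_pV+T_p\mathbb{R}X=T_p\mathbb{C}X$. A real algebraic subvariety $Y$ of $X$ is a slice if $\mathbb{R}Y=V\cap\mathbb{R}X$ for some complex subvariety $V\subset\mathbb{C}X$ transverse to $\mathbb{R}X$; then $\mathbb{R}Y$ is a smooth submanifold of $\mathbb{R}X$. For a smooth submanifold $V$ of a smooth manifold $M$ and $p\in V$, the transverse space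 is $N_p^MV=T_pM/T_pV$; these form the transverse bundle $N^MV$. If $M$ and $V$ are complex manifolds, $N_p^MV$ is a complex vector space. The complex structure on $N^{\mathbb{R}X}\mathbb{R}Y$ defined by $V$ is the one for which, at every $p\in\mathbb{R}Y$, the real linear map $N_p^{\mathbb{R}X}\mathbb{R}Y=T_p\mathbb{R}X/T_p\mathbb{R}Y\to T_p\mathbb{C}X/T_pV=N_p^{\mathbb{C}X}V$ induced by the inclusion $T_p\mathbb{R}X\subset T_p\mathbb{C}X$ is an isomorphism of complex vector spaces. *)

theory Defs
  imports "HOL-Analysis.Analysis" "HOL-Library.Set_Algebras"
begin

section \<open>Smooth and holomorphic maps\<close>

text \<open>Meant for open \<open>S\<close> in a finite-dimensional space.\<close>

primrec Ck_on :: "nat \<Rightarrow> ('a::real_normed_vector \<Rightarrow> 'b::real_normed_vector) \<Rightarrow> 'a set \<Rightarrow> bool" where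
  "Ck_on 0 f S = continuous_on S f"
| "Ck_on (Suc k) f S =
    (\<exists>f'. (\<forall>x\<in>S. (f has_derivative f' x) (at x)) \<and> (\<forall>v. Ck_on k (\<lambda>x. f' x v) S))"

definition smooth_on :: "('a::real_normed_vector \<Rightarrow> 'b::real_normed_vector) \<Rightarrow> 'a set \<Rightarrow> bool" where
  "smooth_on f S \<longleftrightarrow> (\<forall>k. Ck_on k f S)"

definition holomorphic_map_on :: "(complex ^ 'n \<Rightarrow> complex ^ 'm) \<Rightarrow> (complex ^ 'n) set \<Rightarrow> bool" where
  "holomorphic_map_on F S \<longleftrightarrow>
    (\<forall>z\<in>S. \<exists>F'. (F has_derivative F') (at z) \<and> (\<forall>c v. F' (c *s v) = c *s F' v))"

definition cnj_vec :: "complex ^ 'n \<Rightarrow> complex ^ 'n" where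
  "cnj_vec z = (\<chi> k. cnj (z $ k))"


section \<open>Affine algebraic sets\<close>

inductive complex_polynomial_fun :: "(complex ^ 'n \<Rightarrow> complex) \<Rightarrow> bool" where
  "complex_polynomial_fun (\<lambda>z. c)"
| "complex_polynomial_fun (\<lambda>z. z $ k)"
| "complex_polynomial_fun f \<Longrightarrow> complex_polynomial_fun g \<Longrightarrow> complex_polynomial_fun (\<lambda>z. f z + g z)"
| "complex_polynomial_fun f \<Longrightarrow> complex_polynomial_fun g \<Longrightarrow> complex_polynomial_fun (\<lambda>z. f z * g z)"

definition zariski_closed :: "(complex ^ 'n) set \<Rightarrow> bool" where
  "zariski_closed Z \<longleftrightarrow>
    (\<exists>P. (\<forall>f\<in>P. complex_polynomial_fun f) \<and> Z = {z. \<forall>f\<in>P. f z = 0})"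

definition regular_map_on :: "(complex ^ 'n) set \<Rightarrow> (complex ^ 'n \<Rightarrow> complex ^ 'm) \<Rightarrow> bool" where
  "regular_map_on D f \<longleftrightarrow>
    (\<forall>z\<in>D. \<forall>k. \<exists>P Q. complex_polynomial_fun P \<and> complex_polynomial_fun Q \<and> Q z \<noteq> 0 \<and>
       (\<forall>w\<in>D. Q w \<noteq> 0 \<longrightarrow> f w $ k = P w / Q w))"

text \<open>\<open>z\<close> is a nonsingular point of the algebraic set \<open>Z\<close>: in a Zariski neighbourhood \<open>W\<close> of \<open>z\<close>,
  \<open>Z\<close> is the zero set of finitely many polynomials whose differentials at \<open>z\<close> are linearly
  independent over the complex numbers.\<close>

definition nonsingular_point :: "(complex ^ 'n) set \<Rightarrow> complex ^ 'n \<Rightarrow> bool" where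
  "nonsingular_point Z z \<longleftrightarrow> z \<in> Z \<and>
    (\<exists>W G. zariski_closed (- W) \<and> z \<in> W \<and> finite G \<and> (\<forall>f\<in>G. complex_polynomial_fun f) \<and>
       Z \<inter> W = {w \<in> W. \<forall>f\<in>G. f w = 0} \<and>
       (\<forall>c :: (complex ^ 'n \<Rightarrow> complex) \<Rightarrow> complex.
          (\<forall>v. (\<Sum>f\<in>G. c f * frechet_derivative f (at z) v) = 0) \<longrightarrow> (\<forall>f\<in>G. c f = 0)))"


section \<open>Complex algebraic varieties\<close>

text \<open>An abstract variety is given by a finite affine atlas (indexed by the finite type \<open>'i\<close>):
  \<open>coord X i\<close> identifies \<open>patch X i\<close> with an algebraic subset of \<open>complex ^ 'n\<close>. A single \<open>'n\<close>
  suffices for all patches, since an algebraic subset of a smaller affine space can be padded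
  with zero coordinates. Varieties are reduced and separated, not necessarily irreducible.\<close>

record ('a, 'i, 'n) atlas =
  patch :: "'i \<Rightarrow> 'a set"
  coord :: "'i \<Rightarrow> 'a \<Rightarrow> complex ^ 'n"

definition points :: "('a, 'i::finite, 'n::finite) atlas \<Rightarrow> 'a set" where
  "points X = (\<Union>i. patch X i)"

definition pair_vec :: "complex ^ 'n \<Rightarrow> complex ^ 'm \<Rightarrow> complex ^ ('n + 'm)" where
  "pair_vec z w = (\<chi> k. case k of Inl a \<Rightarrow> z $ a | Inr b \<Rightarrow> w $ b)"

text \<open>The last clause is separatedness: the diagonal is closed in every product of two patches.\<close>

definition complex_algebraic_variety :: "('a, 'i::finite, 'n::finite) atlas \<Rightarrow> bool" where
  "complex_algebraic_variety X \<longleftrightarrow>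
    (\<forall>i. inj_on (coord X i) (patch X i)) \<and>
    (\<forall>i. zariski_closed (coord X i ` patch X i)) \<and>
    (\<forall>i j. \<exists>Z. zariski_closed Z \<and>
       coord X i ` (patch X i \<inter> patch X j) = coord X i ` patch X i - Z) \<and>
    (\<forall>i j. regular_map_on (coord X i ` (patch X i \<inter> patch X j))
       (coord X j \<circ> inv_into (patch X i) (coord X i))) \<and>
    (\<forall>i j. zariski_closed ((\<lambda>x. pair_vec (coord X i x) (coord X j x)) ` (patch X i \<inter> patch X j)))"

definition complex_subvariety :: "('a, 'i::finite, 'n::finite) atlas \<Rightarrow> 'a set \<Rightarrow> bool" where
  "complex_subvariety X V \<longleftrightarrow>
    V \<subseteq> points X \<and> (\<forall>i. zariski_closed (coord X i ` (V \<inter> patch X i)))"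

definition nonsingular_at :: "('a, 'i::finite, 'n::finite) atlas \<Rightarrow> 'a set \<Rightarrow> 'a \<Rightarrow> bool" where
  "nonsingular_at X V p \<longleftrightarrow>
    (\<forall>i. p \<in> patch X i \<longrightarrow> nonsingular_point (coord X i ` (V \<inter> patch X i)) (coord X i p))"

definition nonsingular :: "('a, 'i::finite, 'n::finite) atlas \<Rightarrow> bool" where
  "nonsingular X \<longleftrightarrow> (\<forall>p\<in>points X. nonsingular_at X (points X) p)"

definition classical_topology :: "('a, 'i::finite, 'n::finite) atlas \<Rightarrow> 'a topology" where
  "classical_topology X =
    topology_generated_by {{x \<in> patch X i. coord X i x \<in> U} | i U. open U}"


section \<open>Real algebraic varieties\<close>

text \<open>In coordinates, an anti-holomorphic map is locally the conjugate of the restriction of a map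
  that is holomorphic on an open subset of the affine space. The clause \<open>\<sigma> x \<in> patch X j\<close> makes
  \<open>\<sigma>\<close> continuous for the classical topology.\<close>

definition antiholomorphic :: "('a, 'i::finite, 'n::finite) atlas \<Rightarrow> ('a \<Rightarrow> 'a) \<Rightarrow> bool" where
  "antiholomorphic X \<sigma> \<longleftrightarrow>
    (\<forall>i j. \<forall>p \<in> patch X i. \<sigma> p \<in> patch X j \<longrightarrow>
      (\<exists>U F. open U \<and> coord X i p \<in> U \<and> holomorphic_map_on F U \<and>
        (\<forall>x \<in> patch X i. coord X i x \<in> U \<longrightarrow>
           \<sigma> x \<in> patch X j \<and> coord X j (\<sigma> x) = cnj_vec (F (coord X i x)))))"

definition real_algebraic_variety ::
  "('a, 'i::finite, 'n::finite) atlas \<Rightarrow> ('a \<Rightarrow> 'a) \<Rightarrow> bool" where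
  "real_algebraic_variety X \<sigma> \<longleftrightarrow>
    complex_algebraic_variety X \<and>
    (\<forall>x\<in>points X. \<sigma> x \<in> points X \<and> \<sigma> (\<sigma> x) = x) \<and>
    antiholomorphic X \<sigma>"

definition real_points :: "('a, 'i::finite, 'n::finite) atlas \<Rightarrow> ('a \<Rightarrow> 'a) \<Rightarrow> 'a set" where
  "real_points X \<sigma> = {x \<in> points X. \<sigma> x = x}"

definition real_subvariety ::
  "('a, 'i::finite, 'n::finite) atlas \<Rightarrow> ('a \<Rightarrow> 'a) \<Rightarrow> 'a set \<Rightarrow> bool" where
  "real_subvariety X \<sigma> Y \<longleftrightarrow> complex_subvariety X Y \<and> \<sigma> ` Y = Y"


section \<open>Tangent spaces\<close>

text \<open>A tangent vector at \<open>p\<close> is stored through its coordinate vectors \<open>\<xi> $ i\<close> in all charts around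
  \<open>p\<close>, with \<open>\<xi> $ i = 0\<close> for the other charts. The tangent space of a subset \<open>S\<close> consists of the
  velocities of curves in \<open>S\<close>; where \<open>S\<close> is a smooth submanifold (the only case in which it is
  used) this is its usual tangent space. In particular \<open>tangent_space X (points X) p\<close> is the
  tangent space of the variety itself.\<close>

definition has_velocity ::
  "('a, 'i::finite, 'n::finite) atlas \<Rightarrow> (real \<Rightarrow> 'a) \<Rightarrow> complex ^ 'n ^ 'i \<Rightarrow> bool" where
  "has_velocity X \<gamma> \<xi> \<longleftrightarrow>
    (\<forall>i. if \<gamma> 0 \<in> patch X i
         then eventually (\<lambda>t. \<gamma> t \<in> patch X i) (at 0) \<and>
              ((\<lambda>t. coord X i (\<gamma> t)) has_vector_derivative \<xi> $ i) (at 0)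
         else \<xi> $ i = 0)"

definition tangent_space ::
  "('a, 'i::finite, 'n::finite) atlas \<Rightarrow> 'a set \<Rightarrow> 'a \<Rightarrow> (complex ^ 'n ^ 'i) set" where
  "tangent_space X S p = {\<xi>. \<exists>\<gamma>. \<gamma> 0 = p \<and> range \<gamma> \<subseteq> S \<and> has_velocity X \<gamma> \<xi>}"

definition cscale :: "complex \<Rightarrow> complex ^ 'n ^ 'i \<Rightarrow> complex ^ 'n ^ 'i" where
  "cscale c \<xi> = (\<chi> i. c *s (\<xi> $ i))"

definition transverse_to_real ::
  "('a, 'i::finite, 'n::finite) atlas \<Rightarrow> ('a \<Rightarrow> 'a) \<Rightarrow> 'a set \<Rightarrow> bool" where
  "transverse_to_real X \<sigma> V \<longleftrightarrow>
    (\<forall>p \<in> V \<inter> real_points X \<sigma>. nonsingular_at X V p \<and>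
       tangent_space X V p + tangent_space X (real_points X \<sigma>) p = tangent_space X (points X) p)"

definition slice ::
  "('a, 'i::finite, 'n::finite) atlas \<Rightarrow> ('a \<Rightarrow> 'a) \<Rightarrow> 'a set \<Rightarrow> bool" where
  "slice X \<sigma> Y \<longleftrightarrow> real_subvariety X \<sigma> Y \<and>
    (\<exists>V. complex_subvariety X V \<and> transverse_to_real X \<sigma> V \<and>
       Y \<inter> real_points X \<sigma> = V \<inter> real_points X \<sigma>)"


section \<open>Transverse bundles and their complex structures\<close>

text \<open>The quotient of \<open>U\<close> by its subspace \<open>W\<close> is the set of cosets. Addition of cosets is the
  elementwise sum \<open>C + D\<close> of sets; in scalar multiplication \<open>W\<close> is added back so that the
  scalar \<open>0\<close> also gives a coset.\<close>

definition quotient_space :: "'v::ab_group_add set \<Rightarrow> 'v set \<Rightarrow> 'v set set" where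
  "quotient_space U W = (\<lambda>x. x +o W) ` U"

definition quot_scaleR :: "'v::real_vector set \<Rightarrow> real \<Rightarrow> 'v set \<Rightarrow> 'v set" where
  "quot_scaleR W r C = (\<lambda>x. r *\<^sub>R x) ` C + W"

definition quot_scaleC ::
  "(complex ^ 'n ^ 'i) set \<Rightarrow> complex \<Rightarrow> (complex ^ 'n ^ 'i) set \<Rightarrow> (complex ^ 'n ^ 'i) set" where
  "quot_scaleC W c C = cscale c ` C + W"

definition transverse_space ::
  "('a, 'i::finite, 'n::finite) atlas \<Rightarrow> 'a set \<Rightarrow> 'a set \<Rightarrow> 'a \<Rightarrow> (complex ^ 'n ^ 'i) set set" where
  "transverse_space X M S p = quotient_space (tangent_space X M p) (tangent_space X S p)"

definition smooth_tangent_section ::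
  "('a, 'i::finite, 'n::finite) atlas \<Rightarrow> 'a set \<Rightarrow> 'a set \<Rightarrow> ('a \<Rightarrow> complex ^ 'n ^ 'i) \<Rightarrow> bool" where
  "smooth_tangent_section X M W s \<longleftrightarrow>
    (\<forall>x\<in>W. s x \<in> tangent_space X M x) \<and>
    (\<forall>i. \<forall>x \<in> W \<inter> patch X i. \<exists>U g. open U \<and> coord X i x \<in> U \<and> smooth_on g U \<and>
       (\<forall>y \<in> W \<inter> patch X i. coord X i y \<in> U \<longrightarrow> s y $ i = g (coord X i y)))"

text \<open>A complex structure on the transverse bundle of \<open>S\<close> in \<open>M\<close> is a smooth endomorphism \<open>J\<close> of
  this real vector bundle with square \<open>- id\<close>. Smooth sections of the quotient bundle are the ones
  that locally lift to smooth sections of \<open>TM\<close> along \<open>S\<close>, and \<open>J\<close> is smooth iff it maps smooth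
  sections over open subsets of \<open>S\<close> to smooth sections; this is the last clause.\<close>

definition bundle_complex_structure ::
  "('a, 'i::finite, 'n::finite) atlas \<Rightarrow> 'a set \<Rightarrow> 'a set \<Rightarrow>
   ('a \<Rightarrow> (complex ^ 'n ^ 'i) set \<Rightarrow> (complex ^ 'n ^ 'i) set) \<Rightarrow> bool" where
  "bundle_complex_structure X M S J \<longleftrightarrow>
    (\<forall>p\<in>S. \<forall>C \<in> transverse_space X M S p.
       J p C \<in> transverse_space X M S p \<and>
       (\<forall>D \<in> transverse_space X M S p. J p (C + D) = J p C + J p D) \<and>
       (\<forall>r. J p (quot_scaleR (tangent_space X S p) r C) =
            quot_scaleR (tangent_space X S p) r (J p C)) \<and>
       J p (J p C) = quot_scaleR (tangent_space X S p) (- 1) C) \<and>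
    (\<forall>W s. openin (subtopology (classical_topology X) S) W \<and> smooth_tangent_section X M W s \<longrightarrow>
       (\<forall>p\<in>W. \<exists>W' t. openin (subtopology (classical_topology X) S) W' \<and> p \<in> W' \<and> W' \<subseteq> W \<and>
          smooth_tangent_section X M W' t \<and>
          (\<forall>x\<in>W'. J x (s x +o tangent_space X S x) = t x +o tangent_space X S x)))"

text \<open>Multiplication by \<open>a + b \<i>\<close> on a transverse space with complex structure \<open>J\<close>.\<close>

definition J_scale ::
  "'v::real_vector set \<Rightarrow> ('v set \<Rightarrow> 'v set) \<Rightarrow> complex \<Rightarrow> 'v set \<Rightarrow> 'v set" where
  "J_scale W J c C = quot_scaleR W (Re c) C + quot_scaleR W (Im c) (J C)"

text \<open>\<open>C + tangent_space X V p\<close> is the image of the coset \<open>C\<close> under the map induced by the inclusion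
  of the tangent space of the real points into that of the variety.\<close>

definition complex_structure_defined_by ::
  "('a, 'i::finite, 'n::finite) atlas \<Rightarrow> ('a \<Rightarrow> 'a) \<Rightarrow> 'a set \<Rightarrow> 'a set \<Rightarrow>
   ('a \<Rightarrow> (complex ^ 'n ^ 'i) set \<Rightarrow> (complex ^ 'n ^ 'i) set) \<Rightarrow> bool" where
  "complex_structure_defined_by X \<sigma> S V J \<longleftrightarrow>
    bundle_complex_structure X (real_points X \<sigma>) S J \<and>
    (\<forall>p\<in>S.
       let N = transverse_space X (real_points X \<sigma>) S p;
           h = (\<lambda>C. C + tangent_space X V p)
       in bij_betw h N (transverse_space X (points X) V p) \<and>
          (\<forall>C\<in>N. \<forall>D\<in>N. h (C + D) = h C + h D) \<and>
          (\<forall>C\<in>N. \<forall>c. h (J_scale (tangent_space X S p) (J p) c C) =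
                       quot_scaleC (tangent_space X V p) c (h C)))"

end

theory Submission
  imports Defs "HOL-Complex_Analysis.Cauchy_Integral_Formula"
begin

text \<open>
  Near a point of \<open>V \<inter> RX\<close> and in an affine chart, the variety \<open>CX\<close>, its subvariety \<open>V\<close> and the set of
  real points \<open>RX\<close> are zero sets of smooth submersions (for \<open>RX\<close>, linearise the involution), so their
  tangent spaces are kernels of differentials. A transverse intersection has
  the intersection of tangent spaces as tangent space; hence the real linear map
  \<open>T RX / T RY \<rightarrow> T CX / T V\<close> is injective, and transversality makes it surjective. Transporting
  multiplication by \<open>\<i>\<close> gives the complex structure \<open>J\<close>, and forces it. For smoothness, lift \<open>J\<close> by
  decomposing \<open>\<i> s = t + v\<close> with \<open>t\<close> tangent to \<open>RX\<close> and \<open>v\<close> tangent to \<open>V\<close>: this is a linear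
  system with smooth coefficients, solvable at the base point, and a smooth right inverse at the base
  point extends to a neighbourhood.
\<close>

section \<open>Smooth maps\<close>

text \<open>Tangent vectors are velocities of curves that need be differentiable only at time 0, so
  that a kernel is a tangent space has to be shown by producing curves that lie in the zero set. Two
  obstacles shape the rest. Transversality holds inside CX and not in the ambient coordinate space,
  so equations of V and of RX cannot simply be juxtaposed: both contain those of CX. And an equation
  is normalised only at its base point, while smoothness of \<open>J\<close> compares tangent spaces
  at all nearby points; this calls for smooth families of invertible operators and for smoothness of
  their inverses, obtained by a bootstrap on the order of differentiability. Holomorphic maps are
  assumed to be complex differentiable only, so their smoothness comes from Cauchy's
  formula.\<close>

lemma Ck_on_subset: "Ck_on k f S \<Longrightarrow> T \<subseteq> S \<Longrightarrow> Ck_on k f T"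
proof (induction k arbitrary: f)
  case 0
  then show ?case by (auto intro: continuous_on_subset)
next
  case (Suc k)
  then obtain f' where "\<And>x. x \<in> S \<Longrightarrow> (f has_derivative f' x) (at x)"
      "\<And>v. Ck_on k (\<lambda>x. f' x v) S"
    by auto
  then show ?case
    using Suc.IH Suc.prems(2) by (auto intro!: exI[of _ f'])
qed

text \<open>The derivatives are taken in the whole space, so openness of \<open>S\<close> is what
  makes them depend on the values in \<open>S\<close> alone.\<close>

lemma Ck_on_cong:
  assumes "open S" "\<And>x. x \<in> S \<Longrightarrow> f x = g x" "Ck_on k f S"
  shows "Ck_on k g S"
proof (cases k)
  case 0
  then show ?thesis using assms by (simp cong: continuous_on_cong)
next
  case (Suc j)
  then obtain f' where f': "\<And>x. x \<in> S \<Longrightarrow> (f has_derivative f' x) (at x)"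
      "\<And>v. Ck_on j (\<lambda>x. f' x v) S"
    using assms(3) by auto
  have "(g has_derivative f' x) (at x)" if "x \<in> S" for x
    using has_derivative_transform_within_open[OF f'(1)[OF that] assms(1) that] assms(2) by auto
  with f'(2) Suc show ?thesis by auto
qed

lemma Ck_on_imp_continuous_on: "Ck_on k f S \<Longrightarrow> continuous_on S f"
  by (cases k)
     (auto intro!: continuous_at_imp_continuous_on dest: has_derivative_continuous)

lemma Ck_on_SucD: "Ck_on (Suc k) f S \<Longrightarrow> Ck_on k f S"
proof (induction k arbitrary: f)
  case 0
  show ?case using Ck_on_imp_continuous_on[OF 0] by simp
next
  case (Suc k)
  from Suc.prems obtain f' where "\<And>x. x \<in> S \<Longrightarrow> (f has_derivative f' x) (at x)"
      "\<And>v. Ck_on (Suc k) (\<lambda>x. f' x v) S"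
    unfolding Ck_on.simps(2)[of "Suc k"] by blast
  with Suc.IH show ?case by (auto intro!: exI[of _ f'])
qed

lemma Ck_on_const: "Ck_on k (\<lambda>x. c) S"
proof (induction k arbitrary: c)
  case (Suc k)
  then show ?case unfolding Ck_on.simps
    by (intro exI[of _ "\<lambda>x v. 0"]) auto
qed auto

lemma Ck_on_linear_compose:
  assumes "bounded_linear L"
  shows "Ck_on k f S \<Longrightarrow> Ck_on k (\<lambda>x. L (f x)) S"
proof (induction k arbitrary: f)
  case 0
  then show ?case using bounded_linear.continuous_on[OF assms] by auto
next
  case (Suc k)
  then obtain f' where f': "\<And>x. x \<in> S \<Longrightarrow> (f has_derivative f' x) (at x)"
      "\<And>v. Ck_on k (\<lambda>x. f' x v) S"
    by auto
  then show ?case unfolding Ck_on.simps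
    by (intro exI[of _ "\<lambda>x v. L (f' x v)"])
       (auto intro!: Suc.IH bounded_linear.has_derivative[OF assms])
qed

lemma Ck_on_linear: "bounded_linear L \<Longrightarrow> Ck_on k L S"
proof (cases k)
  case (Suc j)
  assume "bounded_linear L"
  then show ?thesis unfolding Suc Ck_on.simps
    by (intro exI[of _ "\<lambda>x. L"]) (auto intro: bounded_linear_imp_has_derivative Ck_on_const)
qed (auto intro: linear_continuous_on)

lemma Ck_on_add: "Ck_on k f S \<Longrightarrow> Ck_on k g S \<Longrightarrow> Ck_on k (\<lambda>x. f x + g x) S"
proof (induction k arbitrary: f g)
  case (Suc k)
  obtain f' where f': "\<And>x. x \<in> S \<Longrightarrow> (f has_derivative f' x) (at x)"
      "\<And>v. Ck_on k (\<lambda>x. f' x v) S"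
    using Suc.prems(1) by auto
  obtain g' where g': "\<And>x. x \<in> S \<Longrightarrow> (g has_derivative g' x) (at x)" "\<And>v. Ck_on k (\<lambda>x. g' x v) S"
    using Suc.prems(2) by auto
  from f' g' show ?case unfolding Ck_on.simps
    by (intro exI[of _ "\<lambda>x v. f' x v + g' x v"]) (auto intro: Suc.IH has_derivative_add)
qed (auto intro: continuous_on_add)

lemma Ck_on_sum: "(\<And>i. i \<in> I \<Longrightarrow> Ck_on k (f i) S) \<Longrightarrow> Ck_on k (\<lambda>x. \<Sum>i\<in>I. f i x) S"
  by (induction I rule: infinite_finite_induct) (auto intro: Ck_on_const Ck_on_add)

lemma Ck_on_scaleR:
  "Ck_on k f S \<Longrightarrow> Ck_on k g S \<Longrightarrow> Ck_on k (\<lambda>x. f x *\<^sub>R g x) S"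
proof (induction k arbitrary: f g)
  case (Suc k)
  obtain f' where f': "\<And>x. x \<in> S \<Longrightarrow> (f has_derivative f' x) (at x)"
      "\<And>v. Ck_on k (\<lambda>x. f' x v) S"
    using Suc.prems(1) by auto
  obtain g' where g': "\<And>x. x \<in> S \<Longrightarrow> (g has_derivative g' x) (at x)" "\<And>v. Ck_on k (\<lambda>x. g' x v) S"
    using Suc.prems(2) by auto
  have "Ck_on k f S" "Ck_on k g S"
    using Suc.prems Ck_on_SucD by blast+
  with f' g' show ?case unfolding Ck_on.simps
    by (intro exI[of _ "\<lambda>x v. f x *\<^sub>R g' x v + f' x v *\<^sub>R g x"])
       (auto intro!: Ck_on_add Suc.IH has_derivative_scaleR)
qed (auto intro: continuous_on_scaleR)

lemma euclidean_expand: "linear L \<Longrightarrow> L v = (\<Sum>b\<in>Basis. (v \<bullet> b) *\<^sub>R L b)"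
  for v :: "'a::euclidean_space"
  by (subst (1) euclidean_representation[symmetric])
     (simp only: linear_sum linear_scale[of L])

text \<open>Expanding \<open>g x\<close> in \<open>Basis\<close> gives a finite sum of scalar
  functions times the functions \<open>L x b\<close> with \<open>b\<close> fixed. Regularity of a
  family of operators can thus be tested on constant vectors, without a norm on operators.\<close>

lemma Ck_on_family_apply:
  fixes g :: "'a::real_normed_vector \<Rightarrow> 'b::euclidean_space"
  assumes "open S" "\<And>x. x \<in> S \<Longrightarrow> linear (L x)" "\<And>v. Ck_on k (\<lambda>x. L x v) S" "Ck_on k g S"
  shows "Ck_on k (\<lambda>x. L x (g x)) S"
proof (rule Ck_on_cong[OF assms(1)])
  show "(\<Sum>b\<in>Basis. (g x \<bullet> b) *\<^sub>R L x b) = L x (g x)" if "x \<in> S" for x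
    by (rule euclidean_expand[OF assms(2)[OF that], symmetric])
  show "Ck_on k (\<lambda>x. \<Sum>b\<in>Basis. (g x \<bullet> b) *\<^sub>R L x b) S"
    by (intro Ck_on_sum Ck_on_scaleR Ck_on_linear_compose[OF bounded_linear_inner_left] assms)
qed

text \<open>By the chain rule the derivative is a family of linear maps applied to a moving vector;
  the induction hypothesis handles the family and \<open>Ck_on_family_apply\<close> the
  application.\<close>

lemma Ck_on_compose:
  fixes g :: "'a::real_normed_vector \<Rightarrow> 'b::euclidean_space"
  assumes "open S"
  shows "Ck_on k f T \<Longrightarrow> Ck_on k g S \<Longrightarrow> g ` S \<subseteq> T \<Longrightarrow> Ck_on k (\<lambda>x. f (g x)) S"
proof (induction k arbitrary: f g)
  case 0
  then show ?case using continuous_on_compose2 by fastforce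
next
  case (Suc k)
  obtain f' where f': "\<And>x. x \<in> T \<Longrightarrow> (f has_derivative f' x) (at x)"
      "\<And>v. Ck_on k (\<lambda>x. f' x v) T"
    using Suc.prems(1) by auto
  obtain g' where g': "\<And>x. x \<in> S \<Longrightarrow> (g has_derivative g' x) (at x)" "\<And>v. Ck_on k (\<lambda>x. g' x v) S"
    using Suc.prems(2) by auto
  have gk: "Ck_on k g S" using Suc.prems Ck_on_SucD by blast
  have "((\<lambda>x. f (g x)) has_derivative (\<lambda>v. f' (g x) (g' x v))) (at x)" if "x \<in> S" for x
    using has_derivative_compose[OF g'(1)[OF that], of f "f' (g x)"] f'(1) that Suc.prems(3) by auto
  moreover have "linear (f' (g x))" if "x \<in> S" for x
    using has_derivative_linear[OF f'(1)[of "g x"]] Suc.prems(3) that by blast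
  then have "Ck_on k (\<lambda>x. f' (g x) (g' x v)) S" for v
    by (rule Ck_on_family_apply[OF assms])
       (use g'(2) Suc.prems(3) Suc.IH[OF f'(2) gk] in auto)
  ultimately show ?case unfolding Ck_on.simps
    by (intro exI[of _ "\<lambda>x v. f' (g x) (g' x v)"]) auto
qed

lemma smooth_on_subset: "smooth_on f S \<Longrightarrow> T \<subseteq> S \<Longrightarrow> smooth_on f T"
  unfolding smooth_on_def using Ck_on_subset by blast

lemma smooth_on_const: "smooth_on (\<lambda>x. c) S"
  by (simp add: smooth_on_def Ck_on_const)

lemma smooth_on_linear_compose:
  "linear L \<Longrightarrow> smooth_on f S \<Longrightarrow> smooth_on (\<lambda>x. L (f x)) S"
  for f :: "_ \<Rightarrow> 'b::euclidean_space"
  by (simp add: smooth_on_def Ck_on_linear_compose linear_conv_bounded_linear)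

lemma smooth_on_linear: "linear L \<Longrightarrow> smooth_on L S"
  for L :: "'a::euclidean_space \<Rightarrow> _"
  by (simp add: smooth_on_def Ck_on_linear linear_conv_bounded_linear)

lemma smooth_on_add: "smooth_on f S \<Longrightarrow> smooth_on g S \<Longrightarrow> smooth_on (\<lambda>x. f x + g x) S"
  by (simp add: smooth_on_def Ck_on_add)

lemma smooth_on_scaleR: "smooth_on f S \<Longrightarrow> smooth_on g S \<Longrightarrow> smooth_on (\<lambda>x. f x *\<^sub>R g x) S"
  by (simp add: smooth_on_def Ck_on_scaleR)

lemma smooth_on_diff: "smooth_on f S \<Longrightarrow> smooth_on g S \<Longrightarrow> smooth_on (\<lambda>x. f x - g x) S"
  using smooth_on_add[of f S "\<lambda>x. (-1) *\<^sub>R g x"]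
  by (simp add: smooth_on_scaleR[OF smooth_on_const, of _ _ "-1", simplified])

lemma smooth_on_sum: "(\<And>i. i \<in> I \<Longrightarrow> smooth_on (f i) S) \<Longrightarrow> smooth_on (\<lambda>x. \<Sum>i\<in>I. f i x) S"
  by (simp add: smooth_on_def Ck_on_sum)

lemma smooth_on_compose:
  fixes g :: "'a::real_normed_vector \<Rightarrow> 'b::euclidean_space"
  shows "open S \<Longrightarrow> smooth_on f T \<Longrightarrow> smooth_on g S \<Longrightarrow> g ` S \<subseteq> T \<Longrightarrow> smooth_on (\<lambda>x. f (g x)) S"
  unfolding smooth_on_def using Ck_on_compose by blast

lemma smooth_on_family_apply:
  fixes g :: "'a::real_normed_vector \<Rightarrow> 'b::euclidean_space"
  assumes "open S" "\<And>x. x \<in> S \<Longrightarrow> linear (L x)" "\<And>v. smooth_on (\<lambda>x. L x v) S" "smooth_on g S"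
  shows "smooth_on (\<lambda>x. L x (g x)) S"
  using assms by (simp add: smooth_on_def Ck_on_family_apply)

lemma smooth_on_imp_continuous_on: "smooth_on f S \<Longrightarrow> continuous_on S f"
  using Ck_on_imp_continuous_on smooth_on_def by blast

text \<open>\<open>Ck_on\<close> yields a derivative separately for each order. Uniqueness
  identifies all of them with \<open>frechet_derivative\<close> on \<open>S\<close>, so that one
  family serves for every order.\<close>

lemma smooth_on_derivative:
  assumes "smooth_on f S" "open S"
  obtains f' where "\<And>x. x \<in> S \<Longrightarrow> (f has_derivative f' x) (at x)"
    "\<And>x. x \<in> S \<Longrightarrow> linear (f' x)" "\<And>v. smooth_on (\<lambda>x. f' x v) S"
proof
  let ?f' = "\<lambda>x. frechet_derivative f (at x)"
  have *: "\<exists>f'. (\<forall>x\<in>S. (f has_derivative f' x) (at x)) \<and> (\<forall>v. Ck_on k (\<lambda>x. f' x v) S)" for k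
    using assms(1)[unfolded smooth_on_def, rule_format, of "Suc k"] by simp
  show d: "(f has_derivative ?f' x) (at x)" if "x \<in> S" for x
    using *[of 0] that frechet_derivative_works differentiableI by blast
  show "linear (?f' x)" if "x \<in> S" for x
    using d[OF that] has_derivative_linear by blast
  show "smooth_on (\<lambda>x. ?f' x v) S" for v
    unfolding smooth_on_def
  proof
    fix k
    obtain f' where "\<forall>x\<in>S. (f has_derivative f' x) (at x)" "\<forall>v. Ck_on k (\<lambda>x. f' x v) S"
      using * by blast
    moreover from this have "f' x = ?f' x" if "x \<in> S" for x
      using frechet_derivative_at that by blast
    ultimately show "Ck_on k (\<lambda>x. ?f' x v) S"
      using Ck_on_cong[OF assms(2), of "\<lambda>x. f' x v"] by simp
  qed
qed

section \<open>Smooth families of linear maps\<close>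

text \<open>The inverse function theorem wants the derivative to be continuous in operator norm; in
  finite dimension this follows from continuity of each \<open>f' x v\<close> with \<open>v\<close>
  fixed.\<close>

lemma smooth_on_local_inverse:
  fixes f :: "'a::euclidean_space \<Rightarrow> 'a"
  assumes "smooth_on f U" "open U" "x0 \<in> U" "(f has_derivative (\<lambda>v. v)) (at x0)"
  obtains U' V g where "open U'" "U' \<subseteq> U" "x0 \<in> U'" "open V" "f x0 \<in> V"
    "homeomorphism U' V f g" "(g has_derivative (\<lambda>v. v)) (at (f x0))"
proof -
  obtain f' where f': "\<And>x. x \<in> U \<Longrightarrow> (f has_derivative f' x) (at x)"
    "\<And>x. x \<in> U \<Longrightarrow> linear (f' x)" "\<And>v. smooth_on (\<lambda>x. f' x v) U"
    using smooth_on_derivative[OF assms(1,2)] by blast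
  define F' where "F' = (\<lambda>x. Blinfun (f' x))"
  have F': "blinfun_apply (F' x) = f' x" if "x \<in> U" for x
    using f'(2)[OF that] by (simp add: F'_def linear_conv_bounded_linear bounded_linear_Blinfun_apply)
  have dF: "(f has_derivative blinfun_apply (F' x)) (at x)" if "x \<in> U" for x
    using f'(1)[OF that] F'[OF that] by simp
  have "continuous_on U F'"
  proof (rule continuous_on_blinfun_componentwise)
    show "continuous_on U (\<lambda>x. blinfun_apply (F' x) i)" for i
      using smooth_on_imp_continuous_on[OF f'(3)[of i]] F' by (simp cong: continuous_on_cong)
  qed
  moreover have f0: "f' x0 = (\<lambda>v. v)"
    using has_derivative_unique[OF f'(1)[OF assms(3)] assms(4)] .
  then have id: "id_blinfun o\<^sub>L F' x0 = id_blinfun"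
    by (intro blinfun_eqI) (simp add: F' assms(3))
  ultimately obtain U' V g g' where *: "open U'" "U' \<subseteq> U" "x0 \<in> U'" "open V" "f x0 \<in> V"
    "homeomorphism U' V f g" "\<And>y. y \<in> V \<Longrightarrow> (g has_derivative (g' y)) (at y)"
    "\<And>y. y \<in> V \<Longrightarrow> g' y = inv (blinfun_apply (F' (g y)))"
    using inverse_function_theorem[of U f F' x0 id_blinfun, OF assms(2) dF _ assms(3) id] by metis
  have "g (f x0) = x0"
    using *(3,6) by (simp add: homeomorphism_def)
  then have "g' (f x0) = (\<lambda>v. v)"
    using *(8)[OF *(5)] F'[OF assms(3)] f0 inv_id[unfolded id_def] by simp
  then show ?thesis
    using that[OF *(1-6)] *(7)[OF *(5)] by metis
qed

text \<open>A product rule in which \<open>m\<close> is merely continuous: since \<open>r\<close>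
  vanishes at \<open>x\<close>, the correction \<open>r y *\<^sub>R (m y - m x)\<close> is a term of
  order \<open>norm (y - x)\<close> times one that tends to 0.\<close>

lemma has_derivative_scaleR_vanishing:
  fixes m :: "'a::real_normed_vector \<Rightarrow> 'b::real_normed_vector"
  assumes r: "(r has_derivative r') (at x)" "r x = 0" and m: "isCont m x"
  shows "((\<lambda>y. r y *\<^sub>R m y) has_derivative (\<lambda>h. r' h *\<^sub>R m x)) (at x)"
proof -
  interpret r': bounded_linear r' using r(1) by (rule has_derivative_bounded_linear)
  have *: "((\<lambda>y. r y *\<^sub>R m x) has_derivative (\<lambda>h. r' h *\<^sub>R m x)) (at x)"
    using bounded_linear.has_derivative[OF bounded_linear_scaleR_left r(1)] .
  obtain K where K: "\<And>h. \<bar>r' h\<bar> \<le> norm h * K"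
    using r'.bounded by auto
  have q: "((\<lambda>y. (r y - r' (y - x)) / norm (y - x)) \<longlongrightarrow> 0) (at x)"
    by (rule tendsto_norm_zero_cancel) (use r in \<open>simp add: has_derivative_iff_norm\<close>)
  \<comment> \<open>In the bound below, \<open>K\<close> controls the linear part \<open>r'\<close>
    and 1 is the tolerance chosen for the remainder.\<close>
  have b: "Bfun (\<lambda>y. r y / norm (y - x)) (at x)"
  proof (rule BfunI)
    have "\<forall>\<^sub>F y in at x. dist ((r y - r' (y - x)) / norm (y - x)) 0 < 1"
      using q by (rule tendstoD) simp
    then show "\<forall>\<^sub>F y in at x. norm (r y / norm (y - x)) \<le> 1 + \<bar>K\<bar>"
    proof (rule eventually_mono[OF eventually_conj[OF eventually_neq_at_within[of x]]], safe)
      fix y assume y: "y \<noteq> x" "dist ((r y - r' (y - x)) / norm (y - x)) 0 < 1"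
      have "\<bar>r' (y - x)\<bar> \<le> norm (y - x) * \<bar>K\<bar>"
        using K[of "y - x"] by (meson abs_ge_self mult_left_mono norm_ge_zero order_trans)
      then have "\<bar>r' (y - x) / norm (y - x)\<bar> \<le> \<bar>K\<bar>"
        using y(1) by (simp add: field_simps)
      moreover have "\<bar>r y / norm (y - x) - r' (y - x) / norm (y - x)\<bar> < 1"
        using y(2) by (simp only: dist_real_def diff_divide_distrib diff_0_right)
      ultimately show "norm (r y / norm (y - x)) \<le> 1 + \<bar>K\<bar>"
        unfolding real_norm_def by linarith
    qed
  qed
  have "Zfun (\<lambda>y. m y - m x) (at x)"
    using m by (simp add: isCont_def tendsto_Zfun_iff)
  from bounded_bilinear.Bfun_prod_Zfun[OF bounded_bilinear_scaleR b this]
  have "((\<lambda>y. (r y / norm (y - x)) *\<^sub>R (m y - m x)) \<longlongrightarrow> 0) (at x)"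
    by (simp add: tendsto_Zfun_iff)
  then have "((\<lambda>y. r y *\<^sub>R (m y - m x)) has_derivative (\<lambda>h. 0)) (at x)"
    unfolding has_derivative_iff_norm by (auto dest: tendsto_norm_zero simp: r(2))
  from has_derivative_add[OF * this] show ?thesis
    by (simp add: scaleR_diff_right)
qed

text \<open>Serves to differentiate an inverse family at a stage where it is known only to be
  continuous.\<close>

lemma has_derivative_family_apply_vanishing:
  fixes \<rho> :: "'a::real_normed_vector \<Rightarrow> 'e::euclidean_space" and \<Psi> :: "'a \<Rightarrow> 'e \<Rightarrow> 'f::real_normed_vector"
  assumes \<rho>: "(\<rho> has_derivative \<rho>') (at y)" "\<rho> y = 0"
    and lin: "\<forall>\<^sub>F z in nhds y. linear (\<Psi> z)" and cont: "\<And>v. isCont (\<lambda>z. \<Psi> z v) y"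
  shows "((\<lambda>z. \<Psi> z (\<rho> z)) has_derivative (\<lambda>h. \<Psi> y (\<rho>' h))) (at y)"
proof -
  have "((\<lambda>z. (\<rho> z \<bullet> b) *\<^sub>R \<Psi> z b) has_derivative (\<lambda>h. (\<rho>' h \<bullet> b) *\<^sub>R \<Psi> y b)) (at y)" for b
    using \<rho> cont
    by (intro has_derivative_scaleR_vanishing)
       (auto intro: bounded_linear.has_derivative[OF bounded_linear_inner_left])
  then have *: "((\<lambda>z. \<Sum>b\<in>Basis. (\<rho> z \<bullet> b) *\<^sub>R \<Psi> z b) has_derivative
      (\<lambda>h. \<Sum>b\<in>Basis. (\<rho>' h \<bullet> b) *\<^sub>R \<Psi> y b)) (at y)"
    by (intro has_derivative_sum)
  obtain S where S: "open S" "y \<in> S" "\<And>z. z \<in> S \<Longrightarrow> linear (\<Psi> z)"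
    using lin unfolding eventually_nhds by blast
  have "(\<Sum>b\<in>Basis. (v \<bullet> b) *\<^sub>R \<Psi> z b) = \<Psi> z v" if "z \<in> S" for z v
    by (rule euclidean_expand[OF S(3)[OF that], symmetric])
  with has_derivative_transform_within_open[OF * S(1,2)] S(2) show ?thesis
    by simp
qed

text \<open>The uniform bound gives continuity through \<open>\<Psi> z v - \<Psi> y v = \<Psi> z (v
  - \<Phi> z (\<Psi> y v))\<close>. The same identity gives a derivative, which is expressed by
  \<Psi> itself and the derivative of \<Phi>, so each order of regularity of \<Psi> yields the
  next.\<close>

lemma smooth_on_inverse_family:
  fixes \<Phi> :: "'a::real_normed_vector \<Rightarrow> 'e::euclidean_space \<Rightarrow> 'e"
  assumes S: "open S" and \<Phi>: "\<And>y. y \<in> S \<Longrightarrow> linear (\<Phi> y)" "\<And>v. smooth_on (\<lambda>y. \<Phi> y v) S"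
    and \<Psi>: "\<And>y. y \<in> S \<Longrightarrow> linear (\<Psi> y)" "\<And>y v. y \<in> S \<Longrightarrow> \<Phi> y (\<Psi> y v) = v"
      "\<And>y v. y \<in> S \<Longrightarrow> \<Psi> y (\<Phi> y v) = v" "\<And>y v. y \<in> S \<Longrightarrow> norm (\<Psi> y v) \<le> 2 * norm v"
  shows "smooth_on (\<lambda>y. \<Psi> y v) S"
proof -
  have cont: "isCont (\<lambda>y. \<Psi> y v) y" if y: "y \<in> S" for v y
  proof -
    let ?x = "\<Psi> y v"
    have "isCont (\<lambda>z. \<Phi> z ?x) y"
      using smooth_on_imp_continuous_on[OF \<Phi>(2)] S y continuous_on_eq_continuous_at by blast
    then have "((\<lambda>z. 2 * norm (v - \<Phi> z ?x)) \<longlongrightarrow> 2 * norm (v - \<Phi> y ?x)) (at y)"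
      unfolding isCont_def by (intro tendsto_intros)
    then have lim: "((\<lambda>z. 2 * norm (v - \<Phi> z ?x)) \<longlongrightarrow> 0) (at y)"
      using \<Psi>(2)[OF y] by simp
    have "norm (\<Psi> z v - ?x) \<le> 2 * norm (v - \<Phi> z ?x)" if z: "z \<in> S" for z
      using \<Psi>(4)[OF z, of "v - \<Phi> z ?x"] \<Psi>(3)[OF z] by (simp add: linear_diff[OF \<Psi>(1)[OF z]])
    then have "\<forall>\<^sub>F z in at y. norm (\<Psi> z v - ?x) \<le> 2 * norm (v - \<Phi> z ?x)"
      using eventually_at_in_open'[OF S y] by (auto elim: eventually_mono)
    from Lim_null_comparison[OF this lim] show ?thesis
      unfolding isCont_def Lim_null[of _ ?x] .
  qed
  have exf: "\<exists>f'. (\<forall>y\<in>S. ((\<lambda>y. \<Phi> y u) has_derivative f' y) (at y)) \<and> (\<forall>h. smooth_on (\<lambda>y. f' y h) S)" for u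
    using smooth_on_derivative[OF \<Phi>(2)[of u] S] by metis
  then obtain \<Phi>' where \<Phi>': "\<And>u y. y \<in> S \<Longrightarrow> ((\<lambda>y. \<Phi> y u) has_derivative \<Phi>' u y) (at y)"
    "\<And>u h. smooth_on (\<lambda>y. \<Phi>' u y h) S"
    by metis
  \<comment> \<open>The formula for the derivative of an inverse, minus the inverse times the
    derivative of \<Phi> times the inverse. The expansion in \<open>Basis\<close> leaves only
    derivatives of \<Phi> on fixed vectors; on the vector \<open>\<Psi> y v\<close> they would
    depend on \<open>y\<close> twice.\<close>
  define D where "D v y h = - \<Psi> y (\<Sum>b\<in>Basis. (\<Psi> y v \<bullet> b) *\<^sub>R \<Phi>' b y h)" for v y h
  have der: "((\<lambda>y. \<Psi> y v) has_derivative D v y) (at y)" if y: "y \<in> S" for v y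
  proof -
    define x where "x = \<Psi> y v"
    \<comment> \<open>The residual of the solution at \<open>y\<close> once the parameter has moved
      to \<open>z\<close>. It vanishes at \<open>y\<close>, so continuity of \<Psi> suffices for the
      derivative.\<close>
    define \<rho> where "\<rho> = (\<lambda>z. v - (\<Sum>b\<in>Basis. (x \<bullet> b) *\<^sub>R \<Phi> z b))"
    have \<rho>_eq: "\<rho> z = v - \<Phi> z x" if "z \<in> S" for z
      unfolding \<rho>_def by (subst euclidean_expand[OF \<Phi>(1)[OF that], of x]) (rule refl)
    have "((\<lambda>z. (x \<bullet> b) *\<^sub>R \<Phi> z b) has_derivative (\<lambda>h. (x \<bullet> b) *\<^sub>R \<Phi>' b y h)) (at y)" for b
      using bounded_linear.has_derivative[OF bounded_linear_scaleR_right \<Phi>'(1)[OF y]] .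
    then have "(\<rho> has_derivative (\<lambda>h. 0 - (\<Sum>b\<in>Basis. (x \<bullet> b) *\<^sub>R \<Phi>' b y h))) (at y)"
      unfolding \<rho>_def by (intro has_derivative_diff has_derivative_const has_derivative_sum)
    moreover have "\<rho> y = 0"
      using \<rho>_eq[OF y] \<Psi>(2)[OF y] by (simp add: x_def)
    moreover have "\<forall>\<^sub>F z in nhds y. linear (\<Psi> z)"
      unfolding eventually_nhds using S y \<Psi>(1) by blast
    ultimately have "((\<lambda>z. \<Psi> z (\<rho> z)) has_derivative
        (\<lambda>h. \<Psi> y (0 - (\<Sum>b\<in>Basis. (x \<bullet> b) *\<^sub>R \<Phi>' b y h)))) (at y)"
      using cont[OF y] by (rule has_derivative_family_apply_vanishing)
    then have "((\<lambda>z. x + \<Psi> z (\<rho> z)) has_derivative D v y) (at y)"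
      by (auto intro!: derivative_eq_intros simp: D_def x_def linear_neg[OF \<Psi>(1)[OF y]])
    moreover have "x + \<Psi> z (\<rho> z) = \<Psi> z v" if z: "z \<in> S" for z
      using \<Psi>(3)[OF z] by (simp add: \<rho>_eq[OF z] linear_diff[OF \<Psi>(1)[OF z]])
    ultimately show ?thesis
      by (rule has_derivative_transform_within_open[OF _ S y])
  qed
  have "Ck_on k (\<lambda>y. \<Psi> y v) S" for k v
  proof (induction k arbitrary: v)
    case 0
    show ?case using cont by (simp add: continuous_at_imp_continuous_on)
  next
    case (Suc k)
    have "Ck_on k (\<lambda>y. \<Phi>' u y h) S" for u h
      using \<Phi>'(2) by (simp add: smooth_on_def)
    then have "Ck_on k (\<lambda>y. \<Sum>b\<in>Basis. (\<Psi> y v \<bullet> b) *\<^sub>R \<Phi>' b y h) S" for h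
      by (intro Ck_on_sum Ck_on_scaleR Ck_on_linear_compose[OF bounded_linear_inner_left] Suc.IH)
    from Ck_on_family_apply[OF S \<Psi>(1) Suc.IH this]
    have "Ck_on k (\<lambda>y. D v y h) S" for h
      unfolding D_def by (intro Ck_on_linear_compose[OF bounded_linear_minus[OF bounded_linear_ident]])
    with der show ?case unfolding Ck_on.simps by blast
  qed
  then show ?thesis by (simp add: smooth_on_def)
qed

text \<open>Where the distance to the identity is below 1/2,
  \<open>norm v \<le> 2 * norm (\<Phi> y v)\<close>. This gives injectivity, hence bijectivity in
  finite dimension, and the constant 2 in the bound for the inverse.\<close>

lemma smooth_family_near_identity:
  fixes \<Phi> :: "'a::real_normed_vector \<Rightarrow> 'e::euclidean_space \<Rightarrow> 'e"
  assumes S: "open S" "p \<in> S" and \<Phi>: "\<And>y. y \<in> S \<Longrightarrow> linear (\<Phi> y)" "\<And>v. smooth_on (\<lambda>y. \<Phi> y v) S"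
    and id: "\<And>v. \<Phi> p v = v"
  obtains S' \<Psi> where "open S'" "p \<in> S'" "S' \<subseteq> S" "\<And>y. y \<in> S' \<Longrightarrow> linear (\<Psi> y)"
    "\<And>y v. y \<in> S' \<Longrightarrow> \<Phi> y (\<Psi> y v) = v" "\<And>y v. y \<in> S' \<Longrightarrow> \<Psi> y (\<Phi> y v) = v"
    "\<And>v. smooth_on (\<lambda>y. \<Psi> y v) S'"
proof -
  \<comment> \<open>A continuous function of \<open>y\<close> that dominates the operator norm of
    \<open>\<Phi> y\<close> minus the identity.\<close>
  define d where "d y = (\<Sum>b\<in>Basis. norm (\<Phi> y b - b))" for y
  have "continuous_on S d"
    unfolding d_def by (intro continuous_intros smooth_on_imp_continuous_on[OF \<Phi>(2)])
  moreover have "d p = 0" by (simp add: d_def id)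
  ultimately obtain S' where S': "open S'" "p \<in> S'" "S' \<subseteq> S" "\<And>y. y \<in> S' \<Longrightarrow> d y < 1/2"
  proof -
    assume *: "\<And>S'. open S' \<Longrightarrow> p \<in> S' \<Longrightarrow> S' \<subseteq> S \<Longrightarrow> (\<And>y. y \<in> S' \<Longrightarrow> d y < 1 / 2) \<Longrightarrow> thesis"
      and c: "continuous_on S d" and "d p = 0"
    have "open (d -` {..<1/2} \<inter> S)"
      using continuous_open_preimage[OF c S(1), of "{..<1/2}"] by (simp add: Int_commute)
    then show thesis using *[of "d -` {..<1/2} \<inter> S"] S(2) \<open>d p = 0\<close> by auto
  qed
  have near: "norm (\<Phi> y v - v) \<le> norm v / 2" if y: "y \<in> S'" for y v
  proof -
    have lin: "linear (\<lambda>v. \<Phi> y v - v)"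
      using \<Phi>(1) S'(3) y linear_compose_sub[OF _ linear_id, of "\<Phi> y"] by (auto simp: id_def)
    have "norm (\<Phi> y v - v) \<le> (\<Sum>b\<in>Basis. norm ((v \<bullet> b) *\<^sub>R (\<Phi> y b - b)))"
      by (subst euclidean_expand[OF lin]) (rule norm_sum)
    also have "\<dots> \<le> (\<Sum>b\<in>Basis. norm v * norm (\<Phi> y b - b))"
      by (intro sum_mono) (simp add: Basis_le_norm mult_right_mono)
    also have "\<dots> = norm v * d y" by (simp add: d_def sum_distrib_left)
    also have "\<dots> \<le> norm v * (1/2)"
      using S'(4)[OF y] by (intro mult_left_mono) auto
    finally show ?thesis by simp
  qed
  have lower: "norm v \<le> 2 * norm (\<Phi> y v)" if "y \<in> S'" for y v
    using near[OF that, of v] norm_triangle_ineq2[of v "v - \<Phi> y v"] norm_minus_commute[of v "\<Phi> y v"]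
    by simp
  have bij: "bij (\<Phi> y)" if y: "y \<in> S'" for y
  proof -
    have lin: "linear (\<Phi> y)" using \<Phi>(1) S'(3) y by blast
    have "inj (\<Phi> y)"
      unfolding linear_injective_0[OF lin]
    proof safe
      show "v = 0" if "\<Phi> y v = 0" for v
        using lower[OF y, of v] that by simp
    qed
    then show ?thesis using linear_injective_imp_surjective[OF lin] by (simp add: bij_def)
  qed
  let ?\<Psi> = "\<lambda>y. inv (\<Phi> y)"
  have lin: "linear (?\<Psi> y)" if "y \<in> S'" for y
    using inj_linear_imp_inv_linear[of "\<Phi> y"] \<Phi>(1) S'(3) bij[OF that] that by (auto simp: bij_def)
  have inv: "\<Phi> y (?\<Psi> y v) = v" "?\<Psi> y (\<Phi> y v) = v" if "y \<in> S'" for y v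
    using bij[OF that] by (simp_all add: bij_inv_eq_iff surj_f_inv_f bij_is_surj inv_f_f bij_is_inj)
  have bound: "norm (?\<Psi> y v) \<le> 2 * norm v" if "y \<in> S'" for y v
    using lower[OF that, of "?\<Psi> y v"] inv(1)[OF that] by simp
  have "smooth_on (\<lambda>y. ?\<Psi> y v) S'" for v
    by (rule smooth_on_inverse_family[of S' \<Phi> ?\<Psi>, OF S'(1) _ smooth_on_subset[OF \<Phi>(2) S'(3)] lin inv bound])
       (use S'(3) \<Phi>(1) in auto)
  then show ?thesis using that[OF S'(1-3) lin inv] by blast
qed

section \<open>Regular equations and their tangent spaces\<close>

text \<open>The counterpart of \<open>tangent_space\<close> inside a single chart;
  \<open>tangent_space_chart\<close> relates the two.\<close>

definition velocities :: "'e::real_normed_vector set \<Rightarrow> 'e \<Rightarrow> 'e set" where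
  "velocities Z z = {v. \<exists>\<gamma>. \<gamma> 0 = z \<and> range \<gamma> \<subseteq> Z \<and> (\<gamma> has_vector_derivative v) (at 0)}"

lemma has_vector_derivative_eventually_in:
  assumes "(\<gamma> has_vector_derivative v) (at (0::real))" "open U" "\<gamma> 0 \<in> U"
  shows "\<forall>\<^sub>F t in at 0. \<gamma> t \<in> U"
  using has_vector_derivative_continuous[OF assms(1)] topological_tendstoD[OF _ assms(2,3)]
  by (simp add: isCont_def)

lemma velocitiesI:
  assumes "\<gamma> 0 = z" "z \<in> Z" "\<forall>\<^sub>F t in at 0. \<gamma> t \<in> Z" "(\<gamma> has_vector_derivative v) (at 0)"
  shows "v \<in> velocities Z z"
proof -
  \<comment> \<open>Membership in \<open>Z\<close> is demanded at all times, but only the germ at 0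
    matters; at bad times the curve is parked at \<open>z\<close>.\<close>
  define \<gamma>' where "\<gamma>' t = (if \<gamma> t \<in> Z then \<gamma> t else z)" for t
  have "(\<gamma>' has_vector_derivative v) (at 0)"
    unfolding has_vector_derivative_def
  proof (rule has_derivative_transform_eventually[OF assms(4)[unfolded has_vector_derivative_def]])
    show "\<forall>\<^sub>F t in at 0. \<gamma> t = \<gamma>' t"
      using assms(3) by eventually_elim (simp add: \<gamma>'_def)
  qed (use assms in \<open>auto simp: \<gamma>'_def\<close>)
  then show ?thesis
    using assms(1,2) unfolding velocities_def by (auto simp: \<gamma>'_def intro!: exI[of _ \<gamma>'])
qed

lemma velocities_mono: "Z \<subseteq> Z' \<Longrightarrow> velocities Z z \<subseteq> velocities Z' z"
  unfolding velocities_def by blast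

lemma has_derivative_linear_compose:
  fixes L :: "'e::euclidean_space \<Rightarrow> 'f::real_normed_vector"
  assumes "linear L" "(f has_derivative f') F"
  shows "((\<lambda>x. L (f x)) has_derivative (\<lambda>h. L (f' h))) F"
  using bounded_linear.has_derivative[OF _ assms(2)] assms(1) linear_conv_bounded_linear by blast

lemma linear_generalized_inverse:
  fixes D :: "'e::euclidean_space \<Rightarrow> 'f::euclidean_space"
  assumes "linear D"
  obtains B where "linear B" "\<And>y. y \<in> range D \<Longrightarrow> D (B y) = y"
  using linear_exists_right_inverse_on[OF assms subspace_UNIV] by blast

lemma has_vector_derivative_chain:
  assumes "(\<gamma> has_vector_derivative v) (at t)" "(f has_derivative D) (at (\<gamma> t))"
  shows "((\<lambda>t. f (\<gamma> t)) has_vector_derivative D v) (at t)"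
proof -
  have "((\<lambda>t. f (\<gamma> t)) has_derivative (\<lambda>h. D (h *\<^sub>R v))) (at t)"
    using has_derivative_compose[OF assms(1)[unfolded has_vector_derivative_def] assms(2)] .
  then show ?thesis
    unfolding has_vector_derivative_def
    by (simp add: linear_scale[OF has_derivative_linear[OF assms(2)]])
qed

text \<open>Near \<open>x0\<close> the map \<open>x \<mapsto> B (\<Theta> x) + (x - x0) - B (D (x - x0))\<close>, with \<open>B\<close> a generalised inverse
  of \<open>D\<close>, is a local diffeomorphism with derivative the identity; the curve is the preimage of
  the line through \<open>v\<close>.\<close>

lemma level_set_curve:
  fixes \<Theta> :: "'e::euclidean_space \<Rightarrow> 'f::euclidean_space"
  assumes sm: "smooth_on \<Theta> U" and U: "open U" "x0 \<in> U" and D: "(\<Theta> has_derivative D) (at x0)"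
    and range: "\<And>x. x \<in> U \<Longrightarrow> \<Theta> x \<in> range D" and z: "\<Theta> x0 = 0" and v: "D v = 0"
  shows "\<exists>\<gamma>. \<gamma> 0 = x0 \<and> (\<gamma> has_vector_derivative v) (at 0) \<and> (\<forall>t. \<gamma> t \<in> U \<and> \<Theta> (\<gamma> t) = 0)"
proof -
  have lD: "linear D" using D has_derivative_linear by blast
  obtain B where B: "linear B" "\<And>y. y \<in> range D \<Longrightarrow> D (B y) = y"
    using linear_generalized_inverse[OF lD] by blast
  define F where "F x = B (\<Theta> x) + ((x - x0) - B (D (x - x0)))" for x
  have lin: "linear (\<lambda>x. B (D x))"
    using linear_compose[OF lD B(1)] by (simp add: o_def)
  have "smooth_on F U"
    unfolding F_def
    by (intro smooth_on_add smooth_on_diff smooth_on_linear_compose[OF B(1)] sm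
        smooth_on_linear_compose[OF lin] smooth_on_linear[OF linear_ident] smooth_on_const)
  moreover have "(F has_derivative (\<lambda>h. B (D h) + ((h - 0) - B (D (h - 0))))) (at x0)"
    unfolding F_def
    by (intro has_derivative_add has_derivative_diff has_derivative_ident has_derivative_const
        has_derivative_linear_compose[OF B(1)] D
        has_derivative_linear_compose[OF lin])
  then have "(F has_derivative (\<lambda>h. h)) (at x0)" by simp
  ultimately obtain U' V g where U': "open U'" "U' \<subseteq> U" "x0 \<in> U'" "open V" "F x0 \<in> V"
    "homeomorphism U' V F g" and g: "(g has_derivative (\<lambda>v. v)) (at (F x0))"
    using smooth_on_local_inverse[OF _ U] by metis
  have F0: "F x0 = 0" by (simp add: F_def z linear_0[OF B(1)] linear_0[OF lD])
  have g0: "g 0 = x0" using U'(3,6) F0 by (metis homeomorphism_apply1)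
  \<comment> \<open>The default \<open>x0\<close> is itself a point of the level set, so the curve
    stays there at all times.\<close>
  define \<gamma> where "\<gamma> t = (if t *\<^sub>R v \<in> V then g (t *\<^sub>R v) else x0)" for t
  have line: "((\<lambda>t. t *\<^sub>R v) has_vector_derivative v) (at 0)"
    by (auto intro!: derivative_eq_intros)
  have "((\<lambda>t. g (t *\<^sub>R v)) has_vector_derivative v) (at 0)"
    using has_vector_derivative_chain[OF line, of g "\<lambda>v. v"] g F0 by simp
  then have "(\<gamma> has_vector_derivative v) (at 0)"
    unfolding has_vector_derivative_def
  proof (rule has_derivative_transform_eventually)
    show "\<forall>\<^sub>F t in at 0. g (t *\<^sub>R v) = \<gamma> t"
      using has_vector_derivative_eventually_in[OF line U'(4)] U'(5) F0
      by (auto simp: \<gamma>_def elim!: eventually_mono)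
  qed (use U'(5) F0 in \<open>auto simp: \<gamma>_def\<close>)
  moreover have "\<gamma> t \<in> U \<and> \<Theta> (\<gamma> t) = 0" for t
  proof (cases "t *\<^sub>R v \<in> V")
    case True
    then have in_U: "\<gamma> t \<in> U" and F: "F (\<gamma> t) = t *\<^sub>R v"
      using U'(2,6) by (auto simp: \<gamma>_def homeomorphism_def)
    \<comment> \<open>Since \<open>D (B y) = y\<close> on the range of \<open>D\<close>, the two
      correction terms of \<open>F\<close> cancel under \<open>D\<close>. As \<open>F\<close>
      follows the line through \<open>v\<close> and \<open>D v = 0\<close>, the left side is
      0.\<close>
    have "D (F (\<gamma> t)) = \<Theta> (\<gamma> t)"
      unfolding F_def using B(2)[OF range[OF in_U]] B(2)[of "D _"]
      by (simp add: linear_add[OF lD] linear_diff[OF lD, of "\<gamma> t - x0" "B _"])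
    then show ?thesis using in_U F v by (simp add: linear_scale[OF lD])
  qed (simp add: \<gamma>_def U z)
  ultimately show ?thesis using g0 U'(5) F0 by (intro exI[of _ \<gamma>]) (simp add: \<gamma>_def)
qed

text \<open>Composing an equation of maximal rank with a right inverse of its derivative brings it to this
  form; with values in the ambient space no index type for the number of equations is needed.\<close>

definition regular_equation_at ::
  "'e::euclidean_space set \<Rightarrow> 'e \<Rightarrow> 'e set \<Rightarrow> ('e \<Rightarrow> 'e) \<Rightarrow> ('e \<Rightarrow> 'e) \<Rightarrow> bool" where
  "regular_equation_at Z p U H D \<longleftrightarrow> open U \<and> p \<in> U \<and> p \<in> Z \<and> smooth_on H U \<and>
     (H has_derivative D) (at p) \<and> (\<forall>v. D (D v) = D v) \<and> (\<forall>x\<in>U. D (H x) = H x) \<and>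
     Z \<inter> U = {x \<in> U. H x = 0}"

lemma regular_equation_atD:
  assumes "regular_equation_at Z p U H D"
  shows "open U" "p \<in> U" "p \<in> Z" "smooth_on H U" "(H has_derivative D) (at p)" "linear D"
    "D (D v) = D v" "x \<in> U \<Longrightarrow> D (H x) = H x" "x \<in> U \<Longrightarrow> x \<in> Z \<longleftrightarrow> H x = 0"
  using assms has_derivative_linear unfolding regular_equation_at_def by auto

lemma regular_equation_at_subset:
  "regular_equation_at Z p U H D \<Longrightarrow> open U' \<Longrightarrow> p \<in> U' \<Longrightarrow> U' \<subseteq> U \<Longrightarrow> regular_equation_at Z p U' H D"
  unfolding regular_equation_at_def using smooth_on_subset by blast

lemma regular_equation_at_local:
  "regular_equation_at Z p U H D \<Longrightarrow> open U' \<Longrightarrow> p \<in> U' \<Longrightarrow> Z \<inter> U' = Z' \<inter> U' \<Longrightarrow>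
    regular_equation_at Z' p (U \<inter> U') H D"
  unfolding regular_equation_at_def using smooth_on_subset[of H U "U \<inter> U'"] by blast

text \<open>One inclusion is the chain rule. For the other, \<open>D (H x) = H x\<close> keeps the
  values of \<open>H\<close> in the range of \<open>D\<close>, which is what
  \<open>level_set_curve\<close> asks for.\<close>

lemma velocities_regular_equation:
  assumes "regular_equation_at Z p U H D"
  shows "velocities Z p = {v. D v = 0}"
proof (intro equalityI subsetI CollectI)
  note R = regular_equation_atD[OF assms]
  fix v assume "v \<in> velocities Z p"
  then obtain \<gamma> where \<gamma>: "\<gamma> 0 = p" "\<And>t. \<gamma> t \<in> Z" "(\<gamma> has_vector_derivative v) (at 0)"
    unfolding velocities_def by auto
  have "((\<lambda>t. H (\<gamma> t)) has_vector_derivative D v) (at 0)"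
    using has_vector_derivative_chain[OF \<gamma>(3), of H D] R(5) \<gamma>(1) by simp
  moreover have "((\<lambda>t. H (\<gamma> t)) has_vector_derivative 0) (at 0)"
    unfolding has_vector_derivative_def
  proof (rule has_derivative_transform_eventually[of "\<lambda>t. 0"])
    show "\<forall>\<^sub>F t in at 0. 0 = H (\<gamma> t)"
      using has_vector_derivative_eventually_in[OF \<gamma>(3) R(1)] R(2) \<gamma>(1,2) R(9)
      by (auto elim!: eventually_mono)
    show "0 = H (\<gamma> 0)" using R(2,3,9) \<gamma>(1) by simp
  qed simp_all
  ultimately show "D v = 0" by (rule vector_derivative_unique_at)
next
  note R = regular_equation_atD[OF assms]
  fix v assume "v \<in> {v. D v = 0}"
  moreover have "H x \<in> range D" if "x \<in> U" for x
    using R(8)[OF that] by (metis rangeI)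
  ultimately obtain \<gamma> where \<gamma>: "\<gamma> 0 = p" "(\<gamma> has_vector_derivative v) (at 0)"
    "\<And>t. \<gamma> t \<in> U \<and> H (\<gamma> t) = 0"
    using level_set_curve[OF R(4,1,2,5)] R(2,3,9) by blast
  then show "v \<in> velocities Z p"
    using R(9) unfolding velocities_def by blast
qed

text \<open>The second condition on \<open>y\<close> says that the range of \<open>D\<close> is transverse to the tangent space of
  \<open>Z\<close> at \<open>y\<close>.\<close>

definition tangent_projections ::
  "'e::euclidean_space set \<Rightarrow> ('e \<Rightarrow> 'e) \<Rightarrow> 'e set \<Rightarrow> ('e \<Rightarrow> 'e \<Rightarrow> 'e) \<Rightarrow> bool" where
  "tangent_projections Z D U Q \<longleftrightarrow> open U \<and> (\<forall>y\<in>U. linear (Q y)) \<and> (\<forall>v. smooth_on (\<lambda>y. Q y v) U) \<and>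
     (\<forall>y\<in>Z \<inter> U. velocities Z y = range (Q y) \<and> (\<forall>e. D e \<in> velocities Z y \<longrightarrow> D e = 0))"

lemma tangent_projectionsD:
  assumes "tangent_projections Z D U Q"
  shows "open U" "y \<in> U \<Longrightarrow> linear (Q y)" "smooth_on (\<lambda>y. Q y v) U"
    "y \<in> Z \<inter> U \<Longrightarrow> velocities Z y = range (Q y)"
    "y \<in> Z \<inter> U \<Longrightarrow> D e \<in> velocities Z y \<Longrightarrow> D e = 0"
  using assms unfolding tangent_projections_def by blast+

text \<open>The operators \<open>N y = H' y \<circ> D + (id - D)\<close> are invertible for \<open>y\<close> near \<open>p\<close>, and
  composing \<open>H\<close> with \<open>(N y)\<^sup>-\<^sup>1\<close> normalises the equation at \<open>y\<close>.\<close>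

lemma regular_equation_nearby:
  fixes Z :: "'e::euclidean_space set"
  assumes "regular_equation_at Z p U H D"
  obtains U' Q where "p \<in> U'" "tangent_projections Z D U' Q"
proof -
  note R = regular_equation_atD[OF assms]
  obtain H' where H': "\<And>x. x \<in> U \<Longrightarrow> (H has_derivative H' x) (at x)"
    "\<And>x. x \<in> U \<Longrightarrow> linear (H' x)" "\<And>v. smooth_on (\<lambda>x. H' x v) U"
    using smooth_on_derivative[OF R(4,1)] by blast
  have H'p: "H' p = D" using has_derivative_unique[OF H'(1)[OF R(2)] R(5)] .
  \<comment> \<open>Differentiate the identity between \<open>D (H x)\<close> and
    \<open>H x\<close>, valid on all of \<open>U\<close>.\<close>
  have DH': "D (H' x v) = H' x v" if x: "x \<in> U" for x v
  proof -
    have "((\<lambda>x. D (H x)) has_derivative (\<lambda>v. D (H' x v))) (at x)"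
      using has_derivative_linear_compose[OF R(6) H'(1)[OF x]] .
    then have "(H has_derivative (\<lambda>v. D (H' x v))) (at x)"
      by (rule has_derivative_transform_within_open[OF _ R(1) x]) (rule R(8))
    then have "(\<lambda>v. D (H' x v)) = H' x" using H'(1)[OF x] by (rule has_derivative_unique)
    then show ?thesis by metis
  qed
  define N where "N y v = H' y (D v) + (v - D v)" for y v
  have lN: "linear (N y)" if "y \<in> U" for y
    unfolding N_def using H'(2)[OF that] R(6)
    by (intro linear_compose_add linear_compose_sub linear_ident R(6)
        linear_compose[OF R(6) H'(2)[OF that], unfolded o_def])
  have sN: "smooth_on (\<lambda>y. N y v) U" for v
    unfolding N_def by (intro smooth_on_add H'(3) smooth_on_const)
  have Np: "N p v = v" for v by (simp add: N_def H'p R(7))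
  obtain U' M where U': "open U'" "p \<in> U'" "U' \<subseteq> U"
    and M: "\<And>y. y \<in> U' \<Longrightarrow> linear (M y)" "\<And>y v. y \<in> U' \<Longrightarrow> N y (M y v) = v"
      "\<And>y v. y \<in> U' \<Longrightarrow> M y (N y v) = v" "\<And>v. smooth_on (\<lambda>y. M y v) U'"
    using smooth_family_near_identity[OF R(1,2) lN sN Np] by metis
  \<comment> \<open>For \<open>y\<close> in \<open>Z\<close> this is a projection onto the kernel of
    \<open>H' y\<close>, because \<open>M y\<close> inverts \<open>H' y\<close> from the right on
    its range.\<close>
  define Q where "Q y v = v - M y (H' y v)" for y v
  have DN: "D (N y v) = H' y (D v)" if "y \<in> U" for y v
    by (simp add: N_def linear_add[OF R(6)] linear_diff[OF R(6)] R(7) DH'[OF that])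
  \<comment> \<open>Applying \<open>D\<close> to \<open>N y (M y e) = e\<close> gives
    \<open>H' y (D (M y e)) = e\<close>; comparison with the definition of \<open>N\<close> then
    forces \<open>D (M y e) = M y e\<close>.\<close>
  have H'M: "H' y (M y e) = e" if y: "y \<in> U'" and e: "D e = e" for y e
  proof -
    have yU: "y \<in> U" using y U' by blast
    have "H' y (D (M y e)) = e" using DN[OF yU, of "M y e"] M(2)[OF y] e by simp
    moreover from this have "D (M y e) = M y e"
      using M(2)[OF y, of e] unfolding N_def by simp
    ultimately show ?thesis by simp
  qed
  have eq: "regular_equation_at Z y U (\<lambda>x. M y (H x)) (\<lambda>v. M y (H' y v))" if y: "y \<in> Z \<inter> U'" for y
  proof -
    have y': "y \<in> U'" "y \<in> U" using y U' by auto
    have "H x = 0" if "M y (H x) = 0" for x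
      using M(2)[OF y'(1), of "H x"] that linear_0[OF lN[OF y'(2)]] by simp
    moreover have "M y 0 = 0" by (rule linear_0[OF M(1)[OF y'(1)]])
    ultimately have "Z \<inter> U = {x \<in> U. M y (H x) = 0}"
      using R(9) by auto
    moreover have "smooth_on (\<lambda>x. M y (H x)) U"
      by (rule smooth_on_linear_compose[OF M(1)[OF y'(1)] R(4)])
    moreover have "((\<lambda>x. M y (H x)) has_derivative (\<lambda>v. M y (H' y v))) (at y)"
      by (rule has_derivative_linear_compose[OF M(1)[OF y'(1)] H'(1)[OF y'(2)]])
    ultimately show ?thesis
      unfolding regular_equation_at_def
      using R(1) y y' H'M[OF y'(1) R(8)] H'M[OF y'(1) DH'[OF y'(2)]] by simp
  qed
  have vel: "velocities Z y = {v. H' y v = 0}" if y: "y \<in> Z \<inter> U'" for y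
  proof -
    have y': "y \<in> U'" "y \<in> U" using y U' by auto
    have "M y (H' y v) = 0 \<longleftrightarrow> H' y v = 0" for v
      using H'M[OF y'(1) DH'[OF y'(2)], of v] linear_0[OF M(1)[OF y'(1)]] linear_0[OF H'(2)[OF y'(2)]] by metis
    then show ?thesis using velocities_regular_equation[OF eq[OF y]] by simp
  qed
  have "tangent_projections Z D U' Q"
    unfolding tangent_projections_def
  proof (intro conjI ballI allI impI)
    show "open U'" by (rule U'(1))
    show "linear (Q y)" if "y \<in> U'" for y
    proof -
      have "y \<in> U" using U' that by blast
      then show ?thesis
        unfolding Q_def
        by (rule linear_compose_sub[OF linear_ident linear_compose[OF H'(2) M(1)[OF that], unfolded o_def]])
    qed
    show "smooth_on (\<lambda>y. Q y v) U'" for v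
      unfolding Q_def
      by (rule smooth_on_diff[OF smooth_on_const
            smooth_on_family_apply[OF U'(1) M(1,4) smooth_on_subset[OF H'(3) U'(3)]]])
  next
    fix y assume y: "y \<in> Z \<inter> U'"
    then have y': "y \<in> U'" "y \<in> U" using U' by auto
    have "H' y (Q y v) = 0" for v
      by (simp add: Q_def linear_diff[OF H'(2)[OF y'(2)]] H'M[OF y'(1) DH'[OF y'(2)]])
    moreover have "Q y v = v" if "v \<in> velocities Z y" for v
      using that linear_0[OF M(1)[OF y'(1)]] by (simp add: vel[OF y] Q_def)
    ultimately show "velocities Z y = range (Q y)"
      using vel[OF y] by (metis (mono_tags, lifting) image_subset_iff mem_Collect_eq rangeI subsetI subset_antisym)
    \<comment> \<open>On the range of \<open>D\<close> the operator \<open>N y\<close> agrees with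
      \<open>H' y\<close>, and \<open>N y\<close> is injective.\<close>
    show "D e = 0" if "D e \<in> velocities Z y" for e
    proof -
      have "N y (D e) = 0" using that by (simp add: vel[OF y] N_def R(7))
      then show ?thesis using M(3)[OF y'(1), of "D e"] linear_0[OF M(1)[OF y'(1)]] by simp
    qed
  qed
  with U'(2) show thesis by (rule that)
qed

section \<open>Transverse intersections and fixed points of involutions\<close>

lemma smooth_on_Pair:
  fixes f :: "'a::real_normed_vector \<Rightarrow> 'b::euclidean_space" and g :: "'a \<Rightarrow> 'c::euclidean_space"
  assumes "smooth_on f S" "smooth_on g S"
  shows "smooth_on (\<lambda>x. (f x, g x)) S"
proof -
  have "linear (\<lambda>a::'b. (a, 0::'c))" "linear (\<lambda>b::'c. (0::'b, b))"
    by (auto intro!: linearI)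
  from smooth_on_add[OF smooth_on_linear_compose[OF this(1) assms(1)]
      smooth_on_linear_compose[OF this(2) assms(2)]]
  show ?thesis by simp
qed

lemma smooth_on_locally_injective:
  fixes f :: "'a::euclidean_space \<Rightarrow> 'a"
  assumes "smooth_on f U" "open U" "p \<in> U" "(f has_derivative (\<lambda>v. v)) (at p)"
  obtains U' where "open U'" "p \<in> U'" "U' \<subseteq> U" "inj_on f U'"
proof -
  obtain U' V g where U': "open U'" "U' \<subseteq> U" "p \<in> U'" "homeomorphism U' V f g"
    using smooth_on_local_inverse[OF assms] by metis
  show thesis
    using that[OF U'(1,3,2)] inj_on_inverseI[of U' g f] homeomorphism_apply1[OF U'(4)] by blast
qed

text \<open>The derivative at \<open>p\<close> is \<open>D\<close> plus the complementary
  projection, hence the identity. Consequently points of \<open>Z\<close> near \<open>p\<close>,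
  where \<open>H\<close> vanishes, are determined by their tangential part.\<close>

lemma regular_equation_coordinates:
  assumes "regular_equation_at Z p U H D"
  obtains U' where "open U'" "p \<in> U'" "U' \<subseteq> U" "inj_on (\<lambda>x. H x + ((x - p) - D (x - p))) U'"
proof -
  note R = regular_equation_atD[OF assms]
  let ?F = "\<lambda>x. H x + ((x - p) - D (x - p))"
  have "smooth_on ?F U"
    by (intro smooth_on_add smooth_on_diff R(4) smooth_on_linear[OF linear_ident] smooth_on_const
        smooth_on_linear_compose[OF R(6)])
  moreover have "(?F has_derivative (\<lambda>h. D h + ((h - 0) - D (h - 0)))) (at p)"
    by (intro has_derivative_add has_derivative_diff has_derivative_ident has_derivative_const R(5)
        has_derivative_linear_compose[OF R(6)])
  then have "(?F has_derivative (\<lambda>h. h)) (at p)" by simp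
  ultimately show thesis
    by (rule smooth_on_locally_injective[OF _ R(1,2)]) (rule that)
qed

text \<open>A point of the intersection is a pair \<open>(x1, x2) \<in> Z1 \<times> Z2\<close> whose two entries have the same
  projection to the tangent space of \<open>Z0\<close>. Transversality makes this system of equations regular.\<close>

lemma velocities_transverse_Int:
  assumes R0: "regular_equation_at Z0 p U0 H0 D0" and R1: "regular_equation_at Z1 p U1 H1 D1"
    and R2: "regular_equation_at Z2 p U2 H2 D2" and sub: "Z1 \<subseteq> Z0" "Z2 \<subseteq> Z0"
    and trans: "velocities Z0 p \<subseteq> velocities Z1 p + velocities Z2 p"
  shows "velocities (Z1 \<inter> Z2) p = velocities Z1 p \<inter> velocities Z2 p"
proof (intro equalityI subsetI)
  fix v assume "v \<in> velocities (Z1 \<inter> Z2) p"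
  then show "v \<in> velocities Z1 p \<inter> velocities Z2 p"
    using velocities_mono[of "Z1 \<inter> Z2"] by blast
next
  note R0' = regular_equation_atD[OF R0]
  note R1' = regular_equation_atD[OF R1]
  note R2' = regular_equation_atD[OF R2]
  fix v assume "v \<in> velocities Z1 p \<inter> velocities Z2 p"
  then have v: "D1 v = 0" "D2 v = 0"
    using velocities_regular_equation[OF R1] velocities_regular_equation[OF R2] by auto
  obtain U' where U': "open U'" "p \<in> U'" "U' \<subseteq> U0"
    and inj: "inj_on (\<lambda>x. H0 x + ((x - p) - D0 (x - p))) U'"
    using regular_equation_coordinates[OF R0] by blast
  define Q where "Q x = x - D0 x" for x
  have lQ: "linear Q"
    unfolding Q_def by (rule linear_compose_sub[OF linear_ident R0'(6)])
  have DQ: "D0 (Q x) = 0" for x by (simp add: Q_def linear_diff[OF R0'(6)] R0'(7))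
  define U where "U = (U1 \<inter> U') \<times> (U2 \<inter> U')"
  \<comment> \<open>The pair of \<open>H1\<close> and \<open>H2\<close> on a single point would have
    a derivative onto the product of both ranges only if the two kernels spanned the whole ambient
    space. Doubling the point and comparing only the components along \<open>Q\<close> asks for no
    more than the span inside \<open>Z0\<close>.\<close>
  define \<Theta> where "\<Theta> z = (H1 (fst z), H2 (snd z), Q (fst z - snd z))" for z
  define D where "D z = (D1 (fst z), D2 (snd z), Q (fst z - snd z))" for z
  have U: "open U" "(p, p) \<in> U"
    using R1' R2' U' by (auto simp: U_def intro!: open_Times)
  have lin: "linear (\<lambda>z. Q (fst z - snd z))"
    using linear_compose[OF linear_compose_sub[OF linear_fst linear_snd] lQ] by (simp add: o_def)
  have s1: "smooth_on (\<lambda>z. H1 (fst z)) U"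
    by (rule smooth_on_compose[OF U(1) R1'(4) smooth_on_linear[OF linear_fst]]) (auto simp: U_def)
  have s2: "smooth_on (\<lambda>z. H2 (snd z)) U"
    by (rule smooth_on_compose[OF U(1) R2'(4) smooth_on_linear[OF linear_snd]]) (auto simp: U_def)
  have sm: "smooth_on \<Theta> U"
    unfolding \<Theta>_def by (rule smooth_on_Pair[OF s1 smooth_on_Pair[OF s2 smooth_on_linear[OF lin]]])
  have "((\<lambda>z. H1 (fst z)) has_derivative (\<lambda>h. D1 (fst h))) (at (p, p))"
    using has_derivative_compose[OF bounded_linear_imp_has_derivative[OF bounded_linear_fst], of H1 D1 "(p, p)"]
      R1'(5) by simp
  moreover have "((\<lambda>z. H2 (snd z)) has_derivative (\<lambda>h. D2 (snd h))) (at (p, p))"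
    using has_derivative_compose[OF bounded_linear_imp_has_derivative[OF bounded_linear_snd], of H2 D2 "(p, p)"]
      R2'(5) by simp
  moreover have "((\<lambda>z. Q (fst z - snd z)) has_derivative (\<lambda>h. Q (fst h - snd h))) (at (p, p))"
    using linear_imp_has_derivative[OF lin] .
  ultimately have der: "(\<Theta> has_derivative D) (at (p, p))"
    unfolding \<Theta>_def D_def by (intro has_derivative_Pair)
  have range: "\<Theta> z \<in> range D" if "z \<in> U" for z
  proof -
    obtain x y where z: "z = (x, y)" "x \<in> U1" "y \<in> U2"
      using \<open>z \<in> U\<close> unfolding U_def by auto
    \<comment> \<open>What the third component still lacks after \<open>H1 x\<close> and
      \<open>H2 y\<close> settle the first two. Being tangent to \<open>Z0\<close>, it splits into
      vectors tangent to \<open>Z1\<close> and \<open>Z2\<close>, which leave those two components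
      unchanged.\<close>
    define w where "w = Q (x - y) - Q (H1 x - H2 y)"
    have "D0 w = 0" by (simp add: w_def linear_diff[OF R0'(6)] DQ)
    then have "w \<in> velocities Z1 p + velocities Z2 p"
      using trans velocities_regular_equation[OF R0] by blast
    then obtain a b where ab: "w = a + b" "D1 a = 0" "D2 b = 0"
      using velocities_regular_equation[OF R1] velocities_regular_equation[OF R2]
      by (auto simp: set_plus_def)
    have "Q w = w" using \<open>D0 w = 0\<close> by (simp add: Q_def)
    moreover have "Q ((H1 x + a) - (H2 y - b)) = Q (H1 x - H2 y) + Q w"
      by (simp add: ab(1) algebra_simps flip: linear_add[OF lQ])
    ultimately have "Q ((H1 x + a) - (H2 y - b)) = Q (x - y)" by (simp add: w_def)
    then have "D (H1 x + a, H2 y - b) = \<Theta> z"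
      using z ab R1'(8) R2'(8) by (simp add: D_def \<Theta>_def linear_add[OF R1'(6)] linear_diff[OF R2'(6)])
    then show ?thesis by (metis rangeI)
  qed
  have "\<Theta> (p, p) = 0" "D (v, v) = 0"
    using R1'(2,3,9) R2'(2,3,9) v by (auto simp: \<Theta>_def D_def linear_0[OF lQ] zero_prod_def)
  then obtain \<gamma> where \<gamma>: "\<gamma> 0 = (p, p)" "(\<gamma> has_vector_derivative (v, v)) (at 0)"
    "\<And>t. \<gamma> t \<in> U" "\<And>t. \<Theta> (\<gamma> t) = 0"
    using level_set_curve[OF sm U der range] by blast
  have "fst (\<gamma> t) \<in> Z1 \<inter> Z2" for t
  proof -
    obtain x y where xy: "\<gamma> t = (x, y)" by fastforce
    have *: "x \<in> Z1" "y \<in> Z2" "x \<in> U'" "y \<in> U'" "Q (x - y) = 0"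
      using \<gamma>(3,4)[of t] R1'(9) R2'(9) by (auto simp: xy U_def \<Theta>_def zero_prod_def)
    \<comment> \<open>Both entries lie in \<open>Z0\<close>, so equal tangential parts make them
      equal.\<close>
    have "Q (x - p) = Q (y - p)"
      using *(5) linear_diff[OF lQ, of "x - p" "y - p"] by simp
    moreover have "H0 x = 0" "H0 y = 0"
      using *(1-4) sub U'(3) R0'(9) by blast+
    ultimately have "x = y"
      using inj_onD[OF inj _ *(3,4)] by (simp add: Q_def)
    then show ?thesis using xy * by simp
  qed
  moreover have "((\<lambda>t. fst (\<gamma> t)) has_vector_derivative v) (at 0)"
    using has_vector_derivative_chain[OF \<gamma>(2) bounded_linear_imp_has_derivative[OF bounded_linear_fst]]
    by simp
  ultimately show "v \<in> velocities (Z1 \<inter> Z2) p"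
    using \<gamma>(1) unfolding velocities_def by (auto intro!: exI[of _ "\<lambda>t. fst (\<gamma> t)"])
qed

text \<open>Cartan's linearisation: \<open>\<psi>\<close> intertwines the involution \<open>s\<close> with its derivative \<open>A\<close>, so the
  fixed points are cut out by the \<open>(-1)\<close>-eigenprojection \<open>(id - A) / 2\<close> applied to \<open>\<psi>\<close>.\<close>

lemma regular_equation_fixed_points:
  assumes reg: "regular_equation_at Z p U H D" and s: "smooth_on s U" "s p = p"
    "\<And>x. x \<in> Z \<Longrightarrow> x \<in> U \<Longrightarrow> s x \<in> Z"
    "\<And>x. x \<in> Z \<Longrightarrow> x \<in> U \<Longrightarrow> s x \<in> U \<Longrightarrow> s (s x) = x"
  shows "\<exists>U' H' D'. regular_equation_at {x \<in> Z \<inter> U. s x = x} p U' H' D'"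
proof -
  note R = regular_equation_atD[OF reg]
  obtain S where S: "(s has_derivative S) (at p)"
    by (rule smooth_on_derivative[OF s(1) R(1)]) (use R(2) that in blast)
  have lS: "linear S" using S has_derivative_linear by blast
  define Q where "Q x = x - D x" for x
  \<comment> \<open>Off \<open>Z\<close> the map \<open>s\<close> is an arbitrary extension, so
    \<open>S\<close> is an involution only on the kernel of \<open>D\<close>; \<open>Q\<close> first
    projects to that kernel.\<close>
  define A where "A x = S (Q x)" for x
  have lQ: "linear Q" unfolding Q_def by (rule linear_compose_sub[OF linear_ident R(6)])
  have lA: "linear A" unfolding A_def using linear_compose[OF lQ lS] by (simp add: o_def)
  have DQ: "D (Q x) = 0" and QD: "Q (D x) = 0" for x
    by (simp_all add: Q_def linear_diff[OF R(6)] R(7))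
  \<comment> \<open>Obtained by following a curve in \<open>Z\<close> with velocity
    \<open>v\<close>: its image stays in \<open>Z\<close>, and applying \<open>s\<close> twice gives
    the curve back near time 0.\<close>
  have S_tangent: "D (S v) = 0 \<and> S (S v) = v" if "D v = 0" for v
  proof -
    have "v \<in> velocities Z p" using that velocities_regular_equation[OF reg] by blast
    then obtain \<gamma> where \<gamma>: "\<gamma> 0 = p" "\<And>t. \<gamma> t \<in> Z" "(\<gamma> has_vector_derivative v) (at 0)"
      unfolding velocities_def by auto
    have d1: "((\<lambda>t. s (\<gamma> t)) has_vector_derivative S v) (at 0)"
      using has_vector_derivative_chain[OF \<gamma>(3), of s S] S \<gamma>(1) by simp
    have ev: "\<forall>\<^sub>F t in at 0. \<gamma> t \<in> U"
      using has_vector_derivative_eventually_in[OF \<gamma>(3) R(1)] \<gamma>(1) R(2) by simp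
    have "S v \<in> velocities Z p"
      using ev s(3)[OF \<gamma>(2)] by (intro velocitiesI[OF _ _ _ d1]) (auto simp: \<gamma>(1) s(2) R(3) elim: eventually_mono)
    then have "D (S v) = 0" using velocities_regular_equation[OF reg] by blast
    have d2: "((\<lambda>t. s (s (\<gamma> t))) has_vector_derivative S (S v)) (at 0)"
      using has_vector_derivative_chain[OF d1, of s S] S \<gamma>(1) s(2) by simp
    have ev2: "\<forall>\<^sub>F t in at 0. s (\<gamma> t) \<in> U"
      using has_vector_derivative_eventually_in[OF d1 R(1)] \<gamma>(1) s(2) R(2) by simp
    have "(\<gamma> has_vector_derivative S (S v)) (at 0)"
      unfolding has_vector_derivative_def
    proof (rule has_derivative_transform_eventually[OF d2[unfolded has_vector_derivative_def]])
      show "\<forall>\<^sub>F t in at 0. s (s (\<gamma> t)) = \<gamma> t"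
        using ev ev2 by eventually_elim (rule s(4)[OF \<gamma>(2)])
    qed (auto simp: \<gamma>(1) s(2))
    then have "S (S v) = v" using \<gamma>(3) by (rule vector_derivative_unique_at)
    with \<open>D (S v) = 0\<close> show ?thesis by simp
  qed
  have DA: "D (A x) = 0" and AD: "A (D x) = 0" for x
    using S_tangent[OF DQ] by (simp_all add: A_def QD linear_0[OF lS])
  have QQ: "Q (Q x) = Q x" and QA: "Q (A x) = A x" and AQ: "A (Q x) = A x" and AA: "A (A x) = Q x" for x
    using S_tangent[OF DQ] by (simp_all add: A_def Q_def[of "Q x"] Q_def[of "S (Q x)"] DQ)
  \<comment> \<open>The correction vanishes on \<open>Z\<close>, where \<open>H\<close> is 0, and
    changes the derivative at \<open>p\<close> from \<open>S\<close> to \<open>A\<close>.\<close>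
  define s2 where "s2 x = s x - S (H x)" for x
  have s2_eq: "s2 x = s x" if "x \<in> Z" "x \<in> U" for x
    using that R(9) by (simp add: s2_def linear_0[OF lS])
  have sm2: "smooth_on s2 U"
    unfolding s2_def by (intro smooth_on_diff s smooth_on_linear_compose[OF lS] R(4))
  have "(s2 has_derivative (\<lambda>h. S h - S (D h))) (at p)"
    unfolding s2_def by (intro has_derivative_diff S has_derivative_linear_compose[OF lS] R(5))
  then have d_s2: "(s2 has_derivative A) (at p)"
    by (simp add: A_def[abs_def] Q_def linear_diff[OF lS])
  \<comment> \<open>The average over the group of order two generated by the involution; the
    derivative at \<open>p\<close> is \<open>Q\<close> because both summands contribute
    \<open>Q\<close>.\<close>
  define \<psi> where "\<psi> x = (1/2) *\<^sub>R (Q (x - p) + A (s2 x - p))" for x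
  have sm_\<psi>: "smooth_on \<psi> U"
    unfolding \<psi>_def
    by (intro smooth_on_scaleR smooth_on_const smooth_on_add smooth_on_linear_compose[OF lQ]
        smooth_on_linear_compose[OF lA] smooth_on_diff sm2 smooth_on_linear[OF linear_ident])
  have "(\<psi> has_derivative (\<lambda>h. (1/2) *\<^sub>R (Q (h - 0) + A (A h - 0)))) (at p)"
    unfolding \<psi>_def
    by (intro has_derivative_scaleR_right has_derivative_add has_derivative_diff has_derivative_ident
        has_derivative_const has_derivative_linear_compose[OF lQ] has_derivative_linear_compose[OF lA] d_s2)
  then have d_\<psi>: "(\<psi> has_derivative Q) (at p)"
    by (simp add: AA flip: scaleR_2)
  have Q\<psi>: "Q (\<psi> x) = \<psi> x" and D\<psi>: "D (\<psi> x) = 0" for x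
    by (simp_all add: \<psi>_def linear_scale[OF lQ] linear_scale[OF R(6)] linear_add[OF lQ]
        linear_add[OF R(6)] QQ QA DQ DA)
  \<comment> \<open>The summands take values in the complementary spaces given by the range and the
    kernel of \<open>D\<close>, so the sum vanishes exactly when both do.\<close>
  define \<Theta> where "\<Theta> x = H x + (1/2) *\<^sub>R (\<psi> x - A (\<psi> x))" for x
  define E where "E v = D v + (1/2) *\<^sub>R (Q v - A v)" for v
  have sm_\<Theta>: "smooth_on \<Theta> U"
    unfolding \<Theta>_def
    by (intro smooth_on_add smooth_on_scaleR smooth_on_const smooth_on_diff R(4) sm_\<psi>
        smooth_on_linear_compose[OF lA])
  have "(\<Theta> has_derivative (\<lambda>h. D h + (1/2) *\<^sub>R (Q h - A (Q h)))) (at p)"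
    unfolding \<Theta>_def
    by (intro has_derivative_add has_derivative_scaleR_right has_derivative_diff R(5) d_\<psi>
        has_derivative_linear_compose[OF lA])
  then have d_\<Theta>: "(\<Theta> has_derivative E) (at p)"
    by (simp add: E_def[abs_def] AQ)
  have E_general: "E (a + (1/2) *\<^sub>R (b - A b)) = a + (1/2) *\<^sub>R (b - A b)" if "D a = a" "Q b = b" for a b
  proof -
    have a: "Q a = 0" "A a = 0" using QD[of a] AD[of a] that by simp_all
    have b: "D b = 0" using DQ[of b] that by simp
    have AAb: "A (A b) = b" using AA[of b] that by simp
    have "E a = a" by (simp add: E_def that a)
    moreover have "E (b - A b) = b - A b"
      by (simp add: E_def that linear_diff[OF R(6)] linear_diff[OF lQ] linear_diff[OF lA] b DA QA AAb
          flip: scaleR_2) (simp add: algebra_simps flip: scaleR_2)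
    moreover have lE: "linear E"
      using d_\<Theta> has_derivative_linear by blast
    ultimately show ?thesis
      by (simp add: linear_add[OF lE] linear_scale[OF lE])
  qed
  have "smooth_on (\<lambda>x. H x + \<psi> x) U" by (intro smooth_on_add R(4) sm_\<psi>)
  moreover have "((\<lambda>x. H x + \<psi> x) has_derivative (\<lambda>h. D h + Q h)) (at p)"
    by (intro has_derivative_add R(5) d_\<psi>)
  then have "((\<lambda>x. H x + \<psi> x) has_derivative (\<lambda>h. h)) (at p)" by (simp add: Q_def)
  ultimately obtain U1 where U1: "open U1" "p \<in> U1" "U1 \<subseteq> U" and inj: "inj_on (\<lambda>x. H x + \<psi> x) U1"
    by (rule smooth_on_locally_injective[OF _ R(1,2)])
  \<comment> \<open>Both \<open>x\<close> and \<open>s x\<close> have to lie where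
    \<open>H x + \<psi> x\<close> is injective.\<close>
  define U' where "U' = U1 \<inter> s -` U1"
  have "open (U1 \<inter> s -` U1)"
    using continuous_open_preimage[OF smooth_on_imp_continuous_on[OF smooth_on_subset[OF s(1) U1(3)]] U1(1) U1(1)] .
  then have U': "open U'" "p \<in> U'" "U' \<subseteq> U" "U' \<subseteq> U1"
    using U1 s(2) by (auto simp: U'_def)
  have zero: "x \<in> Z \<and> s x = x \<longleftrightarrow> \<Theta> x = 0" if x: "x \<in> U'" for x
  proof
    assume "x \<in> Z \<and> s x = x"
    then have xZ: "x \<in> Z" "s x = x" and H: "H x = 0" using R(9) x U'(3) by auto
    have "s2 x = x" using s2_eq xZ x U'(3) by auto
    then have "A (\<psi> x) = \<psi> x"
      by (simp add: \<psi>_def linear_scale[OF lA] linear_add[OF lA] AQ AA add.commute)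
    then show "\<Theta> x = 0" by (simp add: \<Theta>_def H)
  next
    assume 0: "\<Theta> x = 0"
    have xU: "x \<in> U" "s x \<in> U" "x \<in> U1" "s x \<in> U1" using x U' U1(3) by (auto simp: U'_def)
    have "D (\<Theta> x) = H x"
      by (simp add: \<Theta>_def linear_add[OF R(6)] linear_scale[OF R(6)] linear_diff[OF R(6)] D\<psi> DA R(8)[OF xU(1)])
    then have H: "H x = 0" using 0 linear_0[OF R(6)] by simp
    then have A\<psi>: "A (\<psi> x) = \<psi> x" using 0 by (simp add: \<Theta>_def)
    have xZ: "x \<in> Z" using H R(9) xU by blast
    have sZ: "s x \<in> Z" using s(3) xZ xU by blast
    have ss: "s (s x) = x" using s(4) xZ xU by blast
    \<comment> \<open>On \<open>Z\<close> the involution exchanges the two terms of the average.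
      With \<open>A (\<psi> x) = \<psi> x\<close> the points \<open>x\<close> and \<open>s x\<close>
      have the same coordinates and therefore coincide.\<close>
    have "\<psi> (s x) = A (\<psi> x)"
      by (simp add: \<psi>_def s2_eq[OF xZ xU(1)] s2_eq[OF sZ xU(2)] ss linear_scale[OF lA]
          linear_add[OF lA] AQ AA add.commute)
    then have "H (s x) + \<psi> (s x) = H x + \<psi> x"
      using H R(9)[OF xU(2)] sZ A\<psi> by simp
    then have "s x = x" using inj_onD[OF inj _ xU(4,3)] by blast
    with xZ show "x \<in> Z \<and> s x = x" by simp
  qed
  have "regular_equation_at {x \<in> Z \<inter> U. s x = x} p U' \<Theta> E"
    unfolding regular_equation_at_def
  proof (intro conjI ballI allI)
    show "E (E v) = E v" for v
      using E_general[OF R(7)[of v] QQ[of v]] by (simp add: E_def AQ)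
    show "E (\<Theta> x) = \<Theta> x" if "x \<in> U'" for x
      using E_general[OF R(8) Q\<psi>, of x x] that U'(3) by (auto simp: \<Theta>_def)
    show "{x \<in> Z \<inter> U. s x = x} \<inter> U' = {x \<in> U'. \<Theta> x = 0}"
      using zero U'(3) by blast
  qed (use U' R(2,3) s(2) d_\<Theta> smooth_on_subset[OF sm_\<Theta> U'(3)] in auto)
  then show ?thesis by blast
qed

section \<open>Holomorphic maps and nonsingular points\<close>

lemma linear_vector_smult_left: "linear (\<lambda>c::complex. c *s (v :: complex ^ 'n))"
  by (auto intro!: linearI simp: vec_eq_iff algebra_simps)

lemma linear_vector_smult_right: "linear (\<lambda>v :: complex ^ 'n. c *s v)"
  by (auto intro!: linearI simp: vec_eq_iff algebra_simps)

lemma norm_vector_smult: "norm (c *s v) = norm c * norm v" for v :: "complex ^ 'n"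
  by (simp add: norm_vec_def L2_set_right_distrib norm_mult)

section \<open>Smoothness of complex differentiable functions of several variables\<close>

definition complex_differentiable_on :: "(complex ^ 'n \<Rightarrow> complex) \<Rightarrow> (complex ^ 'n) set \<Rightarrow> bool" where
  "complex_differentiable_on f U \<longleftrightarrow>
    (\<forall>z\<in>U. \<exists>f'. (f has_derivative f') (at z) \<and> (\<forall>c v. f' (c *s v) = c * f' v))"

lemma complex_differentiable_onE:
  assumes "complex_differentiable_on f U"
  obtains f' where "\<forall>z\<in>U. (f has_derivative f' z) (at z) \<and> (\<forall>c v. f' z (c *s v) = c * f' z v)"
  using bchoice[OF assms[unfolded complex_differentiable_on_def]] by blast

text \<open>Cauchy's formula for the derivative on the complex line through \<open>x\<close> in
  direction \<open>v\<close>. Circle and kernel do not depend on \<open>x\<close> near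
  \<open>x0\<close>, so the regularity of \<open>f\<close> in \<open>x\<close> passes through the
  integral.\<close>

lemma partial_derivative_integral:
  fixes f :: "complex ^ 'n \<Rightarrow> complex"
  assumes U: "open U" "x0 \<in> U" and f': "\<And>z. z \<in> U \<Longrightarrow> (f has_derivative f' z) (at z)"
    "\<And>z c v. z \<in> U \<Longrightarrow> f' z (c *s v) = c * f' z v"
  shows "\<exists>\<delta> c K. \<delta> > 0 \<and> continuous_on {0..1::real} c \<and> continuous_on {0..1} K \<and>
    (\<forall>x\<in>ball x0 \<delta>. \<forall>t\<in>{0..1}. x + c t *s v \<in> U) \<and>
    (\<forall>x\<in>ball x0 \<delta>. f' x v = integral {0..1} (\<lambda>t. K t * f (x + c t *s v)))"
proof -
  obtain e where e: "e > 0" "cball x0 e \<subseteq> U" using U open_contains_cball by blast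
  \<comment> \<open>Chosen so that circles of radius \<open>r\<close> along \<open>v\<close> around
    points of \<open>ball x0 (e/2)\<close> stay in \<open>cball x0 e\<close>; the added 1 covers
    \<open>v = 0\<close>.\<close>
  define r where "r = e / (2 * (norm v + 1))"
  have r: "r > 0" using e by (simp add: r_def add_nonneg_pos)
  have rv: "r * norm v \<le> e / 2"
  proof -
    have "r * norm v \<le> r * (norm v + 1)" using r by simp
    also have "\<dots> = e / 2"
      using add_nonneg_pos[OF norm_ge_zero zero_less_one, of v] by (simp add: r_def field_simps)
    finally show ?thesis .
  qed
  define c where "c = circlepath 0 r"
  \<comment> \<open>The velocity of the circle over its squared parameter, with the factor of
    Cauchy's formula absorbed; the value is \<open>1 / c t\<close>.\<close>
  define K where "K t = r * exp (2 * of_real pi * \<i> * t) / (c t)\<^sup>2" for t :: real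
  have c_eq: "c t = r * exp (2 * of_real pi * \<i> * t)" for t
    by (simp add: c_def circlepath)
  have c0: "c t \<noteq> 0" "norm (c t) = r" for t
    using r by (auto simp: c_eq norm_mult)
  have inU: "x + \<zeta> *s v \<in> U" if "x \<in> ball x0 (e/2)" "norm \<zeta> \<le> r" for x \<zeta>
  proof -
    have "norm (\<zeta> *s v) \<le> r * norm v"
      using that by (simp add: norm_vector_smult mult_right_mono)
    then have "norm (x0 - (x + \<zeta> *s v)) \<le> e"
      using that rv norm_triangle_ineq4[of "x0 - x" "\<zeta> *s v"] by (simp add: dist_norm algebra_simps)
    then show ?thesis using e by (auto simp: dist_norm)
  qed
  have "f' x v = integral {0..1} (\<lambda>t. K t * f (x + c t *s v))" if x: "x \<in> ball x0 (e/2)" for x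
  proof -
    define g where "g \<zeta> = f (x + \<zeta> *s v)" for \<zeta>
    have dg: "(g has_field_derivative f' (x + \<zeta> *s v) v) (at \<zeta>)" if "norm \<zeta> \<le> r" for \<zeta>
    proof -
      have "((\<lambda>\<zeta>. x + \<zeta> *s v) has_derivative (\<lambda>h. 0 + h *s v)) (at \<zeta>)"
        by (intro has_derivative_add has_derivative_const linear_imp_has_derivative linear_vector_smult_left)
      then have "((\<lambda>\<zeta>. x + \<zeta> *s v) has_derivative (\<lambda>h. h *s v)) (at \<zeta>)" by simp
      from has_derivative_compose[OF this f'(1)[OF inU[OF x that]]]
      show ?thesis
        unfolding g_def has_field_derivative_def
        by (simp add: f'(2)[OF inU[OF x that]] mult.commute[of _ "f' (x + \<zeta> *s v) v"])
    qed
    have cont: "continuous_on (cball 0 r) g"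
      by (intro continuous_at_imp_continuous_on ballI DERIV_isCont[OF dg]) simp
    have hol: "g holomorphic_on ball 0 r"
      unfolding holomorphic_on_open[OF open_ball] using dg by (meson less_imp_le mem_ball_0)
    have "(g has_field_derivative (1 / (2 * of_real pi * \<i>) *
        contour_integral (circlepath 0 r) (\<lambda>u. g u / (u - 0)^2))) (at 0)"
      using Cauchy_derivative_integral_circlepath(2)[OF cont hol, of 0] r by simp
    with dg[of 0] r have "f' x v = 1 / (2 * of_real pi * \<i>) *
        contour_integral (circlepath 0 r) (\<lambda>u. g u / (u - 0)^2)"
      using DERIV_unique by fastforce
    also have "\<dots> = 1 / (2 * of_real pi * \<i>) * integral {0..1} (\<lambda>t. g (c t) / (c t)\<^sup>2 *
        (2 * pi * \<i> * r * exp (2 * of_real pi * \<i> * t)))"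
      unfolding contour_integral_integral c_def
      by (simp only: vector_derivative_circlepath diff_0_right)
    also have "\<dots> = integral {0..1} (\<lambda>t. 1 / (2 * of_real pi * \<i>) * (g (c t) / (c t)\<^sup>2 *
        (2 * pi * \<i> * r * exp (2 * of_real pi * \<i> * t))))"
      by (rule integral_mult_right[symmetric])
    also have "\<dots> = integral {0..1} (\<lambda>t. K t * f (x + c t *s v))"
    proof (rule arg_cong[of _ _ "integral {0..1}"], rule ext)
      have "1 / (2 * of_real pi * \<i>) * (a / b * (2 * pi * \<i> * r * e)) = r * e / b * a"
        if "b \<noteq> 0" for a b e :: complex
        using that by (simp add: field_simps)
      then show "1 / (2 * of_real pi * \<i>) * (g (c t) / (c t)\<^sup>2 *
          (2 * pi * \<i> * r * exp (2 * of_real pi * \<i> * t))) = K t * f (x + c t *s v)" for t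
        using c0(1)[of t] by (simp only: K_def g_def) simp
    qed
    finally show ?thesis .
  qed
  moreover have "continuous_on {0..1} c" "continuous_on {0..1} K"
    unfolding K_def c_eq[abs_def] using r by (auto intro!: continuous_intros)
  ultimately show ?thesis
    using inU e c0(2) by (intro exI[of _ "e/2"] exI[of _ c] exI[of _ K]) auto
qed

lemma continuous_on_integrand:
  fixes f :: "complex ^ 'n \<Rightarrow> complex"
  assumes "continuous_on U f" "continuous_on {0..1::real} c" "continuous_on {0..1} K"
    "\<And>x t. x \<in> B \<Longrightarrow> t \<in> {0..1} \<Longrightarrow> x + c t *s v \<in> U"
  shows "continuous_on (B \<times> cbox 0 1) (\<lambda>(x, t). K t * f (x + c t *s v))"
proof -
  have c: "continuous_on (B \<times> cbox 0 1) (\<lambda>z. c (snd z))"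
    by (rule continuous_on_compose2[OF assms(2) continuous_on_snd[OF continuous_on_id]]) auto
  have K: "continuous_on (B \<times> cbox 0 1) (\<lambda>z. K (snd z))"
    by (rule continuous_on_compose2[OF assms(3) continuous_on_snd[OF continuous_on_id]]) auto
  have "bounded_linear (\<lambda>c. c *s v)"
    using linear_vector_smult_left linear_conv_bounded_linear by blast
  from bounded_linear.continuous_on[OF this c]
  have cv: "continuous_on (B \<times> cbox 0 1) (\<lambda>z. fst z + c (snd z) *s v)"
    by (intro continuous_on_add continuous_on_fst continuous_on_id)
  have "continuous_on (B \<times> cbox 0 1) (\<lambda>z. f (fst z + c (snd z) *s v))"
    by (rule continuous_on_compose2[OF assms(1) cv]) (use assms(4) in auto)
  from continuous_on_mult[OF K this] show ?thesis by (simp add: case_prod_unfold)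
qed

text \<open>Differentiation under the integral sign in Cauchy's formula.\<close>

lemma complex_differentiable_on_partial_derivative:
  fixes f :: "complex ^ 'n \<Rightarrow> complex"
  assumes U: "open U" and f': "\<And>z. z \<in> U \<Longrightarrow> (f has_derivative f' z) (at z)"
    "\<And>z c v. z \<in> U \<Longrightarrow> f' z (c *s v) = c * f' z v"
  shows "complex_differentiable_on (\<lambda>x. f' x v) U"
proof -
  have contf: "continuous_on U f"
    using f'(1) by (meson continuous_at_imp_continuous_on has_derivative_continuous)
  \<comment> \<open>The Leibniz rule needs a continuous derivative of the integrand, which is not
    part of complex differentiability; a first use of the integral formula derives it from
    continuity of \<open>f\<close>.\<close>
  have contf': "continuous_on U (\<lambda>x. f' x u)" for u
  proof (rule continuous_at_imp_continuous_on, rule ballI)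
    fix x0 assume "x0 \<in> U"
    from partial_derivative_integral[OF U this f', of u]
    obtain \<delta> c K where *: "\<delta> > 0" "continuous_on {0..1::real} c" "continuous_on {0..1} K"
      "\<And>x t. x \<in> ball x0 \<delta> \<Longrightarrow> t \<in> {0..1} \<Longrightarrow> x + c t *s u \<in> U"
      "\<And>x. x \<in> ball x0 \<delta> \<Longrightarrow> f' x u = integral {0..1} (\<lambda>t. K t * f (x + c t *s u))"
      by blast
    have "continuous_on (ball x0 \<delta>) (\<lambda>x. integral (cbox 0 1) (\<lambda>t. K t * f (x + c t *s u)))"
      by (rule integral_continuous_on_param[OF continuous_on_integrand[OF contf *(2-4)]])
    then have "continuous_on (ball x0 \<delta>) (\<lambda>x. f' x u)"
      by (rule continuous_on_eq) (simp add: *(5))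
    then show "isCont (\<lambda>x. f' x u) x0"
      using *(1) by (simp add: continuous_on_eq_continuous_at)
  qed
  show ?thesis
    unfolding complex_differentiable_on_def
  proof
    fix x0 assume "x0 \<in> U"
    from partial_derivative_integral[OF U this f', of v]
    obtain \<delta> c K where *: "\<delta> > 0" "continuous_on {0..1::real} c" "continuous_on {0..1} K"
      "\<And>x t. x \<in> ball x0 \<delta> \<Longrightarrow> t \<in> {0..1} \<Longrightarrow> x + c t *s v \<in> U"
      "\<And>x. x \<in> ball x0 \<delta> \<Longrightarrow> f' x v = integral {0..1} (\<lambda>t. K t * f (x + c t *s v))"
      by blast
    define F where "F x t = K t * f (x + c t *s v)" for x t
    define F' where "F' x t = Blinfun (\<lambda>h. K t * f' (x + c t *s v) h)" for x t
    have F': "blinfun_apply (F' x t) = (\<lambda>h. K t * f' (x + c t *s v) h)"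
      if "x \<in> ball x0 \<delta>" "t \<in> {0..1}" for x t
      unfolding F'_def
      by (intro bounded_linear_Blinfun_apply bounded_linear_compose[OF bounded_linear_mult_right]
          has_derivative_bounded_linear[OF f'(1)[OF *(4)[OF that]]])
    have dF: "((\<lambda>x. F x t) has_derivative blinfun_apply (F' x t)) (at x within ball x0 \<delta>)"
      if "x \<in> ball x0 \<delta>" "t \<in> cbox 0 1" for x t
    proof -
      have t: "t \<in> {0..1}" using that by simp
      have "((\<lambda>x. x + c t *s v) has_derivative (\<lambda>h. h)) (at x)"
        by (auto intro!: derivative_eq_intros)
      from has_derivative_compose[OF this f'(1)[OF *(4)[OF that(1) t]]]
      have "((\<lambda>x. F x t) has_derivative blinfun_apply (F' x t)) (at x)"
        unfolding F_def F'[OF that(1) t] by (rule has_derivative_mult_right)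
      then show ?thesis by (rule has_derivative_at_withinI)
    qed
    have contF': "continuous_on (ball x0 \<delta> \<times> cbox 0 1) (\<lambda>(x, t). F' x t)"
      unfolding case_prod_unfold
    proof (rule continuous_on_blinfun_componentwise)
      fix i
      have "continuous_on (ball x0 \<delta> \<times> cbox 0 1) (\<lambda>(x, t). K t * f' (x + c t *s v) i)"
        by (rule continuous_on_integrand[OF contf' *(2-4)])
      then show "continuous_on (ball x0 \<delta> \<times> cbox 0 1) (\<lambda>z. blinfun_apply (F' (fst z) (snd z)) i)"
        using F' by (subst continuous_on_cong[OF refl, where g = "\<lambda>(x, t). K t * f' (x + c t *s v) i"]) auto
    qed
    have contF: "continuous_on (ball x0 \<delta> \<times> cbox 0 1) (\<lambda>(x, t). F x t)"
      unfolding F_def by (rule continuous_on_integrand[OF contf *(2-4)])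
    have int: "F x integrable_on cbox 0 1" if "x \<in> ball x0 \<delta>" for x
    proof (rule integrable_continuous)
      have "continuous_on (cbox 0 1) (\<lambda>t::real. (x, t))"
        by (intro continuous_on_Pair continuous_on_const continuous_on_id)
      moreover have "(\<lambda>t. (x, t)) ` cbox 0 1 \<subseteq> ball x0 \<delta> \<times> cbox 0 1" using that by blast
      ultimately show "continuous_on (cbox 0 1) (F x)"
        using continuous_on_compose2[OF contF] by fastforce
    qed
    have x0: "x0 \<in> ball x0 \<delta>" using *(1) by simp
    have int': "F' x0 integrable_on cbox 0 1"
    proof (rule integrable_continuous)
      have "continuous_on (cbox 0 1) (\<lambda>t::real. (x0, t))"
        by (intro continuous_on_Pair continuous_on_const continuous_on_id)
      moreover have "(\<lambda>t. (x0, t)) ` cbox 0 1 \<subseteq> ball x0 \<delta> \<times> cbox 0 1" using x0 by blast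
      ultimately show "continuous_on (cbox 0 1) (F' x0)"
        using continuous_on_compose2[OF contF'] by fastforce
    qed
    let ?D = "integral (cbox 0 1) (F' x0)"
    have "((\<lambda>x. integral (cbox 0 1) (F x)) has_derivative ?D) (at x0 within ball x0 \<delta>)"
      by (rule leibniz_rule[OF dF int contF' x0 convex_ball])
    then have "((\<lambda>x. integral (cbox 0 1) (F x)) has_derivative ?D) (at x0)"
      using x0 by (simp add: at_within_open[OF x0 open_ball])
    then have "((\<lambda>x. f' x v) has_derivative ?D) (at x0)"
      by (rule has_derivative_transform_within_open[OF _ open_ball x0]) (simp add: *(5) F_def[abs_def])
    \<comment> \<open>The defect of complex linearity is a bounded real linear functional of the
      operator, so it commutes with the integral, and it vanishes on the integrand.\<close>
    moreover have "?D (a *s h) = a * ?D h" for a h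
    proof -
      have bl: "bounded_linear (\<lambda>B. blinfun_apply B (a *s h) - a * blinfun_apply B h)"
        by (intro bounded_linear_sub bounded_linear_compose[OF bounded_linear_mult_right]
            blinfun.bounded_linear_left)
      have "?D (a *s h) - a * ?D h
          = integral (cbox 0 1) (\<lambda>t. F' x0 t (a *s h) - a * F' x0 t h)"
        using integral_linear[OF int' bl] by (simp add: o_def)
      also have "\<dots> = integral (cbox 0 (1::real)) (\<lambda>t. 0)"
        by (rule Henstock_Kurzweil_Integration.integral_cong) (use x0 *(4) in \<open>simp add: F' f'(2)\<close>)
      finally show ?thesis by simp
    qed
    ultimately show "\<exists>g'. ((\<lambda>x. f' x v) has_derivative g') (at x0) \<and> (\<forall>c v. g' (c *s v) = c * g' v)"
      by blast
  qed
qed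

lemma complex_differentiable_on_imp_smooth_on:
  assumes "open U" "complex_differentiable_on f U"
  shows "smooth_on f U"
proof -
  have "complex_differentiable_on f U \<Longrightarrow> Ck_on k f U" for k
  proof (induction k arbitrary: f)
    case 0
    then show ?case
      unfolding complex_differentiable_on_def Ck_on.simps
      by (meson continuous_at_imp_continuous_on has_derivative_continuous)
  next
    case (Suc k)
    from Suc.prems obtain f' where "\<forall>z\<in>U. (f has_derivative f' z) (at z) \<and> (\<forall>c v. f' z (c *s v) = c * f' z v)"
      by (rule complex_differentiable_onE)
    note f' = this[rule_format, THEN conjunct1] this[rule_format, THEN conjunct2, rule_format]
    have "Ck_on k (\<lambda>x. f' x v) U" for v
      by (rule Suc.IH[OF complex_differentiable_on_partial_derivative[OF assms(1) f']])
    with f'(1) show ?case unfolding Ck_on.simps by blast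
  qed
  with assms show ?thesis unfolding smooth_on_def by blast
qed

lemma linear_axis: "linear (axis k :: complex \<Rightarrow> complex ^ 'n)"
  by (auto intro!: linearI simp: vec_eq_iff axis_def)

lemma smooth_on_componentwise:
  fixes F :: "'a::real_normed_vector \<Rightarrow> complex ^ 'm"
  assumes "\<And>k. smooth_on (\<lambda>z. F z $ k) S"
  shows "smooth_on F S"
proof -
  have "smooth_on (\<lambda>z. \<Sum>k\<in>UNIV. axis k (F z $ k)) S"
    by (intro smooth_on_sum smooth_on_linear_compose[OF linear_axis] assms)
  moreover have "(\<Sum>k\<in>UNIV. axis k (F z $ k)) = F z" for z
    by (simp add: vec_eq_iff axis_def)
  ultimately show ?thesis by simp
qed

lemma holomorphic_map_on_imp_smooth_on:
  assumes "open S" "holomorphic_map_on F S"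
  shows "smooth_on F S"
proof (rule smooth_on_componentwise, rule complex_differentiable_on_imp_smooth_on[OF assms(1)])
  fix k
  show "complex_differentiable_on (\<lambda>z. F z $ k) S"
    unfolding complex_differentiable_on_def
  proof
    fix z assume "z \<in> S"
    then obtain F' where F': "(F has_derivative F') (at z)" "\<forall>c v. F' (c *s v) = c *s F' v"
      using assms(2) unfolding holomorphic_map_on_def by blast
    from bounded_linear.has_derivative[OF bounded_linear_vec_nth F'(1)] F'(2)
    show "\<exists>f'. ((\<lambda>z. F z $ k) has_derivative f') (at z) \<and> (\<forall>c v. f' (c *s v) = c * f' v)"
      by (intro exI[of _ "\<lambda>v. F' v $ k"]) simp
  qed
qed

lemma holomorphic_map_on_componentwise:
  assumes "\<And>k. complex_differentiable_on (\<lambda>z. F z $ k) S"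
  shows "holomorphic_map_on F S"
  unfolding holomorphic_map_on_def
proof
  fix z assume "z \<in> S"
  then have "\<exists>f'. ((\<lambda>z. F z $ k) has_derivative f') (at z) \<and> (\<forall>c v. f' (c *s v) = c * f' v)" for k
    using assms unfolding complex_differentiable_on_def by blast
  then obtain f' where f': "\<And>k. ((\<lambda>z. F z $ k) has_derivative f' k) (at z)"
    "\<And>k c v. f' k (c *s v) = c * f' k v"
    by metis
  have "(F has_derivative (\<lambda>v. \<chi> k. f' k v)) (at z)"
  proof -
    have "((\<lambda>z. \<Sum>k\<in>UNIV. axis k (F z $ k)) has_derivative (\<lambda>v. \<Sum>k\<in>UNIV. axis k (f' k v))) (at z)"
      by (intro has_derivative_sum has_derivative_linear_compose[OF linear_axis] f'(1))
    moreover have "(\<Sum>k\<in>UNIV. axis k (F z $ k)) = F z" for z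
      by (simp add: vec_eq_iff axis_def)
    moreover have "(\<Sum>k\<in>UNIV. axis k (f' k v)) = (\<chi> k. f' k v)" for v
      by (simp add: vec_eq_iff axis_def)
    ultimately show ?thesis by simp
  qed
  then show "\<exists>F'. (F has_derivative F') (at z) \<and> (\<forall>c v. F' (c *s v) = c *s F' v)"
    by (intro exI[of _ "\<lambda>v. \<chi> k. f' k v"]) (simp add: vec_eq_iff f'(2))
qed

section \<open>Polynomials, Zariski closed sets and nonsingular points\<close>

lemma complex_polynomial_fun_differentiable:
  "complex_polynomial_fun f \<Longrightarrow> complex_differentiable_on f U"
proof (induction rule: complex_polynomial_fun.induct)
  case (1 c)
  show ?case unfolding complex_differentiable_on_def
    by (intro ballI exI[of _ "\<lambda>v. 0"]) auto
next
  case (2 k)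
  show ?case unfolding complex_differentiable_on_def
    by (intro ballI exI[of _ "\<lambda>v. v $ k"])
       (auto intro!: bounded_linear_imp_has_derivative bounded_linear_vec_nth)
next
  case (3 f g)
  obtain f' where "\<forall>z\<in>U. (f has_derivative f' z) (at z) \<and> (\<forall>c v. f' z (c *s v) = c * f' z v)"
    using 3(3) by (rule complex_differentiable_onE)
    note f' = this[rule_format, THEN conjunct1] this[rule_format, THEN conjunct2, rule_format]
  obtain g' where "\<forall>z\<in>U. (g has_derivative g' z) (at z) \<and> (\<forall>c v. g' z (c *s v) = c * g' z v)"
    using 3(4) by (rule complex_differentiable_onE)
    note g' = this[rule_format, THEN conjunct1] this[rule_format, THEN conjunct2, rule_format]
  show ?case unfolding complex_differentiable_on_def
  proof
    fix z assume z: "z \<in> U"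
    from has_derivative_add[OF f'(1)[OF z] g'(1)[OF z]]
    show "\<exists>h. ((\<lambda>z. f z + g z) has_derivative h) (at z) \<and> (\<forall>c v. h (c *s v) = c * h v)"
      by (intro exI conjI) (auto simp: f'(2)[OF z] g'(2)[OF z] algebra_simps)
  qed
next
  case (4 f g)
  obtain f' where "\<forall>z\<in>U. (f has_derivative f' z) (at z) \<and> (\<forall>c v. f' z (c *s v) = c * f' z v)"
    using 4(3) by (rule complex_differentiable_onE)
    note f' = this[rule_format, THEN conjunct1] this[rule_format, THEN conjunct2, rule_format]
  obtain g' where "\<forall>z\<in>U. (g has_derivative g' z) (at z) \<and> (\<forall>c v. g' z (c *s v) = c * g' z v)"
    using 4(4) by (rule complex_differentiable_onE)
    note g' = this[rule_format, THEN conjunct1] this[rule_format, THEN conjunct2, rule_format]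
  show ?case unfolding complex_differentiable_on_def
  proof
    fix z assume z: "z \<in> U"
    from has_derivative_mult[OF f'(1)[OF z] g'(1)[OF z]]
    show "\<exists>h. ((\<lambda>z. f z * g z) has_derivative h) (at z) \<and> (\<forall>c v. h (c *s v) = c * h v)"
      by (intro exI conjI) (auto simp: f'(2)[OF z] g'(2)[OF z] algebra_simps)
  qed
qed

lemma complex_polynomial_fun_continuous_on: "complex_polynomial_fun f \<Longrightarrow> continuous_on U f"
  using complex_polynomial_fun_differentiable[of f U] unfolding complex_differentiable_on_def
  by (meson continuous_at_imp_continuous_on has_derivative_continuous)

lemma zariski_closed_imp_closed: "zariski_closed Z \<Longrightarrow> closed Z"
proof -
  assume "zariski_closed Z"
  then obtain P where P: "\<And>f. f \<in> P \<Longrightarrow> complex_polynomial_fun f" "Z = {z. \<forall>f\<in>P. f z = 0}"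
    unfolding zariski_closed_def by blast
  have "closed {z. f z = 0}" if "f \<in> P" for f
    using closed_Collect_eq[OF complex_polynomial_fun_continuous_on[OF P(1)[OF that]] continuous_on_const] .
  moreover have "Z = (\<Inter>f\<in>P. {z. f z = 0})" using P(2) by auto
  ultimately show "closed Z" by auto
qed

text \<open>A dual system built by elimination, one functional at a time. It provides the right
  inverse that turns independent equations into a map with values in the ambient space.\<close>

lemma dual_vectors:
  fixes \<phi> :: "'j \<Rightarrow> complex ^ 'n \<Rightarrow> complex"
  assumes "finite G" "\<And>f. f \<in> G \<Longrightarrow> linear (\<phi> f)" "\<And>f c v. f \<in> G \<Longrightarrow> \<phi> f (c *s v) = c * \<phi> f v"
    "\<And>c. (\<forall>v. (\<Sum>f\<in>G. c f * \<phi> f v) = 0) \<Longrightarrow> \<forall>f\<in>G. c f = 0"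
  shows "\<exists>r. \<forall>f\<in>G. \<forall>g\<in>G. \<phi> f (r g) = (if f = g then 1 else 0)"
  using assms
proof (induction G rule: finite_induct)
  case (insert a G)
  have indep: "\<forall>f\<in>G. c f = 0" if "\<forall>v. (\<Sum>f\<in>G. c f * \<phi> f v) = 0" for c
  proof -
    have "(\<Sum>f\<in>G. (if f = a then 0 else c f) * \<phi> f v) = (\<Sum>f\<in>G. c f * \<phi> f v)" for v
      using insert.hyps by (intro sum.cong) auto
    then have "\<forall>f\<in>insert a G. (if f = a then 0 else c f) = 0"
      using insert.hyps that by (intro insert.prems(3)) auto
    then show ?thesis using insert.hyps(2) by (metis insertI2)
  qed
  obtain r where r: "\<And>f g. f \<in> G \<Longrightarrow> g \<in> G \<Longrightarrow> \<phi> f (r g) = (if f = g then 1 else 0)"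
    using insert.IH[OF insert.prems(1,2) indep] by blast
  note lin = insert.prems(1)
  \<comment> \<open>If there were no such vector, \<phi> of \<open>a\<close> would be a combination
    of the other functionals, against independence.\<close>
  obtain v where v: "\<phi> a v - (\<Sum>g\<in>G. \<phi> a (r g) * \<phi> g v) \<noteq> 0"
  proof (rule ccontr)
    assume "\<not> thesis"
    then have *: "\<phi> a v - (\<Sum>g\<in>G. \<phi> a (r g) * \<phi> g v) = 0" for v using that by blast
    define c where "c f = (if f = a then 1 else - \<phi> a (r f))" for f
    have "(\<Sum>f\<in>insert a G. c f * \<phi> f v) = 0" for v
    proof -
      have "(\<Sum>f\<in>G. c f * \<phi> f v) = (\<Sum>f\<in>G. - (\<phi> a (r f) * \<phi> f v))"
        using insert.hyps by (intro sum.cong) (auto simp: c_def)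
      then show ?thesis using insert.hyps *[of v] by (simp add: c_def sum_negf)
    qed
    then have "c a = 0" using insert.prems(3)[of c] by blast
    then show False by (simp add: c_def)
  qed
  \<comment> \<open>Subtracting the components along the old dual vectors makes all functionals of
    \<open>G\<close> vanish, while that of \<open>a\<close> does not.\<close>
  define u where "u = v - (\<Sum>g\<in>G. \<phi> g v *s r g)"
  have \<phi>u: "\<phi> f u = \<phi> f v - (\<Sum>g\<in>G. \<phi> g v * \<phi> f (r g))" if "f \<in> insert a G" for f
    using insert.prems(2)[OF that]
    by (simp add: u_def linear_diff[OF lin[OF that]] linear_sum[OF lin[OF that]])
  have u0: "\<phi> f u = 0" if "f \<in> G" for f
  proof -
    have "(\<Sum>g\<in>G. \<phi> g v * \<phi> f (r g)) = (\<Sum>g\<in>G. if f = g then \<phi> g v else 0)"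
      using that r by (intro sum.cong) auto
    then show ?thesis using \<phi>u[of f] that insert.hyps(1) by simp
  qed
  have ua: "\<phi> a u \<noteq> 0"
    using v \<phi>u[of a] by (simp add: mult.commute)
  define ra where "ra = (1 / \<phi> a u) *s u"
  have ra: "\<phi> f ra = (if f = a then 1 else 0)" if "f \<in> insert a G" for f
    using insert.prems(2)[OF that] u0 that ua by (auto simp: ra_def)
  \<comment> \<open>The old vectors are corrected along \<open>ra\<close>, which the old functionals
    do not see.\<close>
  define r' where "r' g = (if g = a then ra else r g - \<phi> a (r g) *s ra)" for g
  have "\<phi> f (r' g) = (if f = g then 1 else 0)" if fg: "f \<in> insert a G" "g \<in> insert a G" for f g
    using r[of f g] fg ra[OF fg(1)] insert.hyps(2) insert.prems(2)[OF fg(1)]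
      linear_diff[OF lin[OF fg(1)], of "r g" "\<phi> a (r g) *s ra"]
    by (auto simp: r'_def)
  then show ?case by blast
qed auto

text \<open>The equations are used as coefficients on vectors dual to their differentials. The
  functionals recover the coefficients, so \<open>H\<close> has the same zeros, and \<open>D\<close>
  fixes the span of the dual vectors. Complex linearity of \<open>D\<close> is kept because it makes
  the tangent space a complex subspace.\<close>

lemma nonsingular_point_regular_equation:
  assumes "nonsingular_point Z z"
  obtains U H D where "regular_equation_at Z z U H D" "\<And>c v. D (c *s v) = c *s D v"
proof -
  obtain W G where "z \<in> Z" "zariski_closed (- W)" "z \<in> W" "finite G"
      "\<forall>f\<in>G. complex_polynomial_fun f" "Z \<inter> W = {w \<in> W. \<forall>f\<in>G. f w = 0}"
      "\<forall>c. (\<forall>v. (\<Sum>f\<in>G. c f * frechet_derivative f (at z) v) = 0) \<longrightarrow> (\<forall>f\<in>G. c f = 0)"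
    using assms unfolding nonsingular_point_def by (elim conjE exE) (rule that)
  note WG = this(1-4) bspec[OF this(5)] this(6) this(7)[THEN spec, THEN mp]
  have "open W" using zariski_closed_imp_closed[OF WG(2)] by (simp add: closed_def)
  define \<phi> where "\<phi> f = frechet_derivative f (at z)" for f :: "complex ^ 'a \<Rightarrow> complex"
  have d: "(f has_derivative \<phi> f) (at z) \<and> (\<forall>c v. \<phi> f (c *s v) = c * \<phi> f v)" if fG: "f \<in> G" for f
  proof -
    obtain f' where f': "(f has_derivative f') (at z)" "\<forall>c v. f' (c *s v) = c * f' v"
      using complex_polynomial_fun_differentiable[OF WG(5)[OF fG], of UNIV]
      unfolding complex_differentiable_on_def by blast
    then show ?thesis using frechet_derivative_at[OF f'(1)] by (simp add: \<phi>_def)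
  qed
  have lin: "linear (\<phi> f)" if "f \<in> G" for f
    using d[OF that] has_derivative_linear by blast
  obtain r where r: "\<And>f g. f \<in> G \<Longrightarrow> g \<in> G \<Longrightarrow> \<phi> f (r g) = (if f = g then 1 else 0)"
  proof -
    have "\<exists>r. \<forall>f\<in>G. \<forall>g\<in>G. \<phi> f (r g) = (if f = g then 1 else 0)"
      by (rule dual_vectors[OF WG(4) lin]) (use d WG(7) in \<open>auto simp: \<phi>_def\<close>)
    then show thesis using that by blast
  qed
  define H where "H x = (\<Sum>f\<in>G. f x *s r f)" for x
  define D where "D v = (\<Sum>f\<in>G. \<phi> f v *s r f)" for v
  have \<phi>_sum: "\<phi> f (\<Sum>g\<in>G. a g *s r g) = a f" if "f \<in> G" for f a
  proof -
    have "\<phi> f (\<Sum>g\<in>G. a g *s r g) = (\<Sum>g\<in>G. a g * \<phi> f (r g))"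
      using d[OF that] by (simp add: linear_sum[OF lin[OF that]])
    also have "\<dots> = (\<Sum>g\<in>G. if f = g then a g else 0)"
      using r that by (intro sum.cong) auto
    finally show ?thesis using that WG(4) by simp
  qed
  have D_sum: "D (\<Sum>g\<in>G. a g *s r g) = (\<Sum>g\<in>G. a g *s r g)" for a
    by (simp add: D_def \<phi>_sum)
  have "H x = 0 \<longleftrightarrow> (\<forall>f\<in>G. f x = 0)" for x
  proof
    assume H: "H x = 0"
    show "\<forall>f\<in>G. f x = 0"
    proof
      fix f assume "f \<in> G"
      then have "\<phi> f (H x) = f x" unfolding H_def by (rule \<phi>_sum)
      then show "f x = 0" using H linear_0[OF lin[OF \<open>f \<in> G\<close>]] by simp
    qed
  qed (simp add: H_def vec_eq_iff sum.neutral)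
  then have "Z \<inter> W = {x \<in> W. H x = 0}" using WG(6) by simp
  moreover have "smooth_on H W"
    unfolding H_def
    by (intro smooth_on_sum smooth_on_linear_compose[OF linear_vector_smult_left]
        complex_differentiable_on_imp_smooth_on[OF \<open>open W\<close>] complex_polynomial_fun_differentiable WG(5))
  moreover have "(H has_derivative D) (at z)"
    unfolding H_def D_def using d
    by (intro has_derivative_sum has_derivative_linear_compose[OF linear_vector_smult_left]) blast
  ultimately have "regular_equation_at Z z W H D"
    unfolding regular_equation_at_def
    using WG(1,3) \<open>open W\<close> D_sum by (simp add: D_def[of "_"] H_def)
  moreover have "D (c *s v) = c *s D v" for c v
    using d by (simp add: D_def vec_eq_iff sum_distrib_left mult.assoc)
  ultimately show thesis by (rule that)
qed

section \<open>Linear algebra of transverse subspaces\<close>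

lemma subspace_add_self: "subspace W \<Longrightarrow> W + W = W"
  unfolding set_plus_def by (auto intro: subspace_add) (metis add_0 subspace_0)

lemma subspace_add_absorb: "subspace W \<Longrightarrow> A \<subseteq> W \<Longrightarrow> 0 \<in> A \<Longrightarrow> A + W = W"
  unfolding set_plus_def by (auto intro: subspace_add) (metis add_0)

lemma elt_set_plus_image: "x +o W = (\<lambda>w. x + w) ` W"
  by (auto simp: elt_set_plus_def)

lemma coset_eq_iff: "subspace W \<Longrightarrow> x +o W = y +o W \<longleftrightarrow> x - y \<in> W"
proof
  assume W: "subspace W" and "x +o W = y +o W"
  moreover have "x \<in> x +o W" using subspace_0[OF W] by (auto simp: elt_set_plus_def)
  ultimately show "x - y \<in> W" by (auto simp: elt_set_plus_def)
next
  assume W: "subspace W" and xy: "x - y \<in> W"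
  show "x +o W = y +o W"
  proof (intro equalityI subsetI)
    fix a assume "a \<in> x +o W"
    then obtain w where "w \<in> W" "a = x + w" by (auto simp: elt_set_plus_def)
    then have "a = y + ((x - y) + w)" "(x - y) + w \<in> W" using xy W by (auto intro: subspace_add)
    then show "a \<in> y +o W" unfolding elt_set_plus_def by blast
  next
    fix a assume "a \<in> y +o W"
    then obtain w where "w \<in> W" "a = y + w" by (auto simp: elt_set_plus_def)
    then have "a = x + (w - (x - y))" "w - (x - y) \<in> W" using xy W by (auto intro: subspace_diff)
    then show "a \<in> x +o W" unfolding elt_set_plus_def by blast
  qed
qed

lemma coset_add: "subspace W \<Longrightarrow> (x +o W) + (y +o W) = (x + y) +o W"
  by (simp add: set_plus_rearrange subspace_add_self)

lemma quot_scaleR_coset: "subspace W \<Longrightarrow> quot_scaleR W r (x +o W) = (r *\<^sub>R x) +o W"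
proof -
  assume W: "subspace W"
  have "(\<lambda>x. r *\<^sub>R x) ` (x +o W) = (r *\<^sub>R x) +o ((\<lambda>x. r *\<^sub>R x) ` W)"
    by (simp add: elt_set_plus_image image_image scaleR_add_right)
  moreover have "((\<lambda>x. r *\<^sub>R x) ` W) + W = W"
    by (rule subspace_add_absorb[OF W]) (auto intro: subspace_scale[OF W] subspace_0[OF W] image_eqI[of _ _ 0])
  ultimately show ?thesis by (simp add: quot_scaleR_def set_plus_rearrange3)
qed

section \<open>Complex scalars on tangent vectors and on cosets\<close>

lemma linear_cscale: "linear (cscale c)"
  by (auto intro!: linearI simp: cscale_def vec_eq_iff algebra_simps)

lemma cscale_ii_ii: "cscale \<i> (cscale \<i> \<xi>) = - \<xi>"
  by (simp add: cscale_def vec_eq_iff flip: mult.assoc)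

lemma cscale_eq: "cscale c \<xi> = Re c *\<^sub>R \<xi> + Im c *\<^sub>R cscale \<i> \<xi>"
  by (auto simp: cscale_def vec_eq_iff complex_eq_iff)

lemma quot_scaleC_coset:
  assumes W: "subspace W" "\<And>\<xi>. \<xi> \<in> W \<Longrightarrow> cscale c \<xi> \<in> W"
  shows "quot_scaleC W c (x +o W) = cscale c x +o W"
proof -
  have "cscale c ` (x +o W) = cscale c x +o (cscale c ` W)"
    by (simp add: elt_set_plus_image image_image linear_add[OF linear_cscale])
  moreover have "0 \<in> cscale c ` W"
    using image_eqI[of 0 "cscale c" 0 W] subspace_0[OF W(1)] linear_0[OF linear_cscale] by metis
  then have "(cscale c ` W) + W = W"
    using W(2) by (intro subspace_add_absorb[OF W(1)]) auto
  ultimately show ?thesis by (simp add: quot_scaleC_def set_plus_rearrange3)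
qed

text \<open>The situation at one point: the four spaces stand for the tangent spaces of CX, V, RX
  and RY. Closure under complex scalars is assumed for the first two, \<open>TR\<close> being only
  real.\<close>

locale transverse_subspaces =
  fixes TX TV TR TY :: "(complex ^ 'n ^ 'i) set"
  assumes sX: "subspace TX" and sV: "subspace TV" and sR: "subspace TR"
    and cX: "\<And>c \<xi>. \<xi> \<in> TX \<Longrightarrow> cscale c \<xi> \<in> TX" and cV: "\<And>c \<xi>. \<xi> \<in> TV \<Longrightarrow> cscale c \<xi> \<in> TV"
    and TY: "TY = TV \<inter> TR" and TX: "TV + TR = TX"
begin

text \<open>Collecting all admissible vectors at once avoids a choice of lift;
  \<open>J_coset\<close> shows that they form one coset.\<close>

definition J :: "(complex ^ 'n ^ 'i) set \<Rightarrow> (complex ^ 'n ^ 'i) set" where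
  "J C = {t \<in> TR. \<exists>x\<in>C. t - cscale \<i> x \<in> TV}"

lemma sY: "subspace TY"
  unfolding TY by (rule subspace_inter[OF sV sR])

lemma R_subset: "TR \<subseteq> TX"
  unfolding TX[symmetric] set_plus_def using subspace_0[OF sV] by force

text \<open>Two candidates differ by a vector of \<open>TR\<close>, and also by one of
  \<open>TV\<close>, because multiplication by \<i> keeps a change of representative inside the
  complex space \<open>TV\<close>. Hence they differ by a vector of \<open>TY\<close>.\<close>

lemma J_coset:
  assumes x: "x \<in> TR" and t: "t \<in> TR" "t - cscale \<i> x \<in> TV"
  shows "J (x +o TY) = t +o TY"
proof (intro equalityI subsetI)
  fix t' assume "t' \<in> J (x +o TY)"
  then obtain w where w: "t' \<in> TR" "w \<in> TY" "t' - cscale \<i> (x + w) \<in> TV"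
    by (auto simp: J_def elt_set_plus_def)
  have "t' - t = (t' - cscale \<i> (x + w)) - (t - cscale \<i> x) + cscale \<i> w"
    by (simp add: linear_add[OF linear_cscale])
  moreover have "cscale \<i> w \<in> TV" using w(2) cV TY by blast
  then have "(t' - cscale \<i> (x + w)) - (t - cscale \<i> x) + cscale \<i> w \<in> TV"
    by (intro subspace_add[OF sV] subspace_diff[OF sV] w(3) t(2))
  ultimately have "t' - t \<in> TV" by (simp only:)
  moreover have "t' - t \<in> TR" using w(1) t(1) by (rule subspace_diff[OF sR])
  ultimately have "t' - t \<in> TY" by (simp add: TY)
  then show "t' \<in> t +o TY"
    unfolding elt_set_plus_def by (auto intro!: bexI[of _ "t' - t"])
next
  fix t' assume "t' \<in> t +o TY"
  then obtain w where w: "w \<in> TV" "w \<in> TR" "t' = t + w" by (auto simp: elt_set_plus_def TY)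
  have "t' - cscale \<i> x = (t - cscale \<i> x) + w" by (simp add: w(3))
  then have "t' - cscale \<i> x \<in> TV" by (simp only: subspace_add[OF sV t(2) w(1)])
  moreover have "x \<in> x +o TY" using subspace_0[OF sY] by (auto simp: elt_set_plus_def)
  ultimately show "t' \<in> J (x +o TY)" using w t by (auto simp: J_def intro: subspace_add[OF sR])
qed

lemma J_lift: "x \<in> TR \<Longrightarrow> \<exists>t\<in>TR. t - cscale \<i> x \<in> TV"
proof -
  assume "x \<in> TR"
  then have "cscale \<i> x \<in> TV + TR" using R_subset cX TX by blast
  then obtain v t where "v \<in> TV" "t \<in> TR" "cscale \<i> x = v + t" by (auto simp: set_plus_def)
  then show ?thesis using subspace_neg[OF sV, of v] by (intro bexI[of _ t]) simp_all
qed

lemma quotientE: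
  assumes "C \<in> quotient_space TR TY"
  obtains x t where "x \<in> TR" "C = x +o TY" "t \<in> TR" "t - cscale \<i> x \<in> TV" "J C = t +o TY"
  using assms J_lift J_coset unfolding quotient_space_def by blast

lemma quotientI: "x \<in> TR \<Longrightarrow> x +o TY \<in> quotient_space TR TY"
  unfolding quotient_space_def by blast

lemma J_closed: "C \<in> quotient_space TR TY \<Longrightarrow> J C \<in> quotient_space TR TY"
  by (metis quotientE quotientI)

lemma J_add:
  assumes "C \<in> quotient_space TR TY" "D \<in> quotient_space TR TY"
  shows "J (C + D) = J C + J D"
proof -
  from assms(1) obtain x t where x: "x \<in> TR" "C = x +o TY" "t \<in> TR" "t - cscale \<i> x \<in> TV" "J C = t +o TY"
    by (rule quotientE)
  from assms(2) obtain y u where y: "y \<in> TR" "D = y +o TY" "u \<in> TR" "u - cscale \<i> y \<in> TV" "J D = u +o TY"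
    by (rule quotientE)
  have "(t + u) - cscale \<i> (x + y) = (t - cscale \<i> x) + (u - cscale \<i> y)"
    by (simp add: linear_add[OF linear_cscale])
  then have "(t + u) - cscale \<i> (x + y) \<in> TV"
    by (simp only: subspace_add[OF sV x(4) y(4)])
  then have "J ((x + y) +o TY) = (t + u) +o TY"
    using x y by (intro J_coset subspace_add[OF sR]) auto
  then show ?thesis
    unfolding x(5) y(5) unfolding x(2) y(2) by (simp add: coset_add[OF sY])
qed

lemma J_scaleR:
  assumes "C \<in> quotient_space TR TY"
  shows "J (quot_scaleR TY r C) = quot_scaleR TY r (J C)"
proof -
  from assms obtain x t where x: "x \<in> TR" "C = x +o TY" "t \<in> TR" "t - cscale \<i> x \<in> TV" "J C = t +o TY"
    by (rule quotientE)
  have "r *\<^sub>R t - cscale \<i> (r *\<^sub>R x) = r *\<^sub>R (t - cscale \<i> x)"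
    by (simp add: linear_scale[OF linear_cscale] scaleR_diff_right)
  then have "r *\<^sub>R t - cscale \<i> (r *\<^sub>R x) \<in> TV"
    by (simp only: subspace_scale[OF sV x(4)])
  then have "J ((r *\<^sub>R x) +o TY) = (r *\<^sub>R t) +o TY"
    using x by (intro J_coset subspace_scale[OF sR]) auto
  then show ?thesis
    unfolding x(5) unfolding x(2) by (simp add: quot_scaleR_coset[OF sY])
qed

lemma J_J:
  assumes "C \<in> quotient_space TR TY"
  shows "J (J C) = quot_scaleR TY (- 1) C"
proof -
  from assms obtain x t where x: "x \<in> TR" "C = x +o TY" "t \<in> TR" "t - cscale \<i> x \<in> TV" "J C = t +o TY"
    by (rule quotientE)
  \<comment> \<open>Multiplying the congruence of \<open>t\<close> and \<open>cscale \<i> x\<close>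
    modulo \<open>TV\<close> by \<i> turns \<open>t\<close> into a lift whose image is
    \<open>- x\<close>.\<close>
  have "- x - cscale \<i> t = - cscale \<i> (t - cscale \<i> x)"
    by (simp add: linear_diff[OF linear_cscale] cscale_ii_ii)
  then have "- x - cscale \<i> t \<in> TV"
    by (simp only: subspace_neg[OF sV cV[OF x(4)]])
  then have "J (t +o TY) = (- x) +o TY"
    using x by (intro J_coset subspace_neg[OF sR]) auto
  then show ?thesis
    unfolding x(5) unfolding x(2) by (simp add: quot_scaleR_coset[OF sY])
qed

lemma coset_plus_V: "(x +o TY) + TV = x +o TV"
  using subspace_add_absorb[OF sV, of TY] subspace_0[OF sY] TY by (simp add: set_plus_rearrange3)

lemma bij_quotients: "bij_betw (\<lambda>C. C + TV) (quotient_space TR TY) (quotient_space TX TV)"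
proof (rule bij_betwI')
  fix C D assume "C \<in> quotient_space TR TY" "D \<in> quotient_space TR TY"
  then obtain x y where xy: "x \<in> TR" "y \<in> TR" "C = x +o TY" "D = y +o TY"
    unfolding quotient_space_def by blast
  then have "x - y \<in> TR" using subspace_diff[OF sR] by blast
  then show "(C + TV = D + TV) = (C = D)"
    unfolding xy(3,4) coset_plus_V coset_eq_iff[OF sV] coset_eq_iff[OF sY] by (simp add: TY)
next
  fix C assume "C \<in> quotient_space TR TY"
  then show "C + TV \<in> quotient_space TX TV"
    using R_subset by (auto simp: quotient_space_def coset_plus_V)
next
  fix D assume "D \<in> quotient_space TX TV"
  then obtain y where y: "y \<in> TX" "D = y +o TV" unfolding quotient_space_def by blast
  then obtain v x where x: "v \<in> TV" "x \<in> TR" "y = v + x" using TX by (auto simp: set_plus_def)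
  then have "D = (x +o TY) + TV" using y by (simp add: coset_plus_V coset_eq_iff[OF sV])
  then show "\<exists>C\<in>quotient_space TR TY. D = C + TV" using quotientI[OF x(2)] by blast
qed

lemma quotient_map_add:
  assumes "C \<in> quotient_space TR TY" "D \<in> quotient_space TR TY"
  shows "(C + D) + TV = (C + TV) + (D + TV)"
proof -
  obtain x y where xy: "C = x +o TY" "D = y +o TY"
    using assms unfolding quotient_space_def by blast
  show ?thesis by (simp only: xy coset_add[OF sY] coset_plus_V coset_add[OF sV])
qed

lemma quotient_map_J_scale:
  assumes "C \<in> quotient_space TR TY"
  shows "J_scale TY J c C + TV = quot_scaleC TV c (C + TV)"
proof -
  from assms obtain x t where x: "x \<in> TR" "C = x +o TY" "t \<in> TR" "t - cscale \<i> x \<in> TV" "J C = t +o TY"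
    by (rule quotientE)
  have "(Re c *\<^sub>R x + Im c *\<^sub>R t) - cscale c x = Im c *\<^sub>R (t - cscale \<i> x)"
    by (subst cscale_eq) (simp add: scaleR_diff_right)
  then have "(Re c *\<^sub>R x + Im c *\<^sub>R t) - cscale c x \<in> TV"
    using x by (simp add: subspace_scale[OF sV])
  then have "(Re c *\<^sub>R x + Im c *\<^sub>R t) +o TV = cscale c x +o TV"
    by (simp add: coset_eq_iff[OF sV])
  then show ?thesis
    unfolding J_scale_def x(5) unfolding x(2)
    by (simp only: quot_scaleR_coset[OF sY] coset_add[OF sY] coset_plus_V quot_scaleC_coset[OF sV cV])
qed

text \<open>The scalar \<i> alone decides: its real part contributes only the zero coset, so
  \<open>J_scale\<close> returns the value of the structure, and the map to the quotient by
  \<open>TV\<close> is injective.\<close>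

lemma J_unique:
  assumes C: "C \<in> quotient_space TR TY" and J': "J' C \<in> quotient_space TR TY"
    "J_scale TY J' \<i> C + TV = quot_scaleC TV \<i> (C + TV)"
  shows "J' C = J C"
proof -
  have *: "J_scale TY F \<i> C = F C" if FC: "F C \<in> quotient_space TR TY" for F
  proof -
    obtain x y where "C = x +o TY" "F C = y +o TY"
      using C FC unfolding quotient_space_def by blast
    then show ?thesis
      by (simp add: J_scale_def quot_scaleR_coset[OF sY] set_plus_rearrange4 subspace_add_self[OF sY])
  qed
  have "J' C + TV = J C + TV"
    using J'(2) quotient_map_J_scale[OF C, of \<i>] *[of J', OF J'(1)] *[of J, OF J_closed[OF C]] by simp
  then show ?thesis
    using bij_quotients J'(1) J_closed[OF C] by (auto simp: bij_betw_def dest: inj_onD)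
qed

end

section \<open>Tangent vectors in charts\<close>

lemma complex_algebraic_varietyD:
  assumes "complex_algebraic_variety X"
  shows "inj_on (coord X i) (patch X i)"
    "\<exists>Z. zariski_closed Z \<and> coord X i ` (patch X i \<inter> patch X j) = coord X i ` patch X i - Z"
    "regular_map_on (coord X i ` (patch X i \<inter> patch X j)) (coord X j \<circ> inv_into (patch X i) (coord X i))"
  using assms unfolding complex_algebraic_variety_def by simp_all

text \<open>A change of charts extended to an open set of the ambient space, where it can be
  differentiated.\<close>

definition transition ::
  "('a, 'i::finite, 'n::finite) atlas \<Rightarrow> 'i \<Rightarrow> 'i \<Rightarrow> (complex ^ 'n) set \<Rightarrow> (complex ^ 'n \<Rightarrow> complex ^ 'n) \<Rightarrow> bool" where
  "transition X i j U T \<longleftrightarrow> open U \<and> holomorphic_map_on T U \<and>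
    (\<forall>x\<in>patch X i. coord X i x \<in> U \<longrightarrow> x \<in> patch X j \<and> coord X j x = T (coord X i x))"

text \<open>The overlap is the complement of a Zariski closed set, and near \<open>p\<close> each
  coordinate is a quotient of polynomials. Removing that set and the zeros of all denominators
  leaves a classically open neighbourhood.\<close>

lemma transition_exists:
  fixes X :: "('a, 'i::finite, 'n::finite) atlas"
  assumes var: "complex_algebraic_variety X" and p: "p \<in> patch X i" "p \<in> patch X j"
  obtains U T where "transition X i j U T" "coord X i p \<in> U"
proof -
  note inj = complex_algebraic_varietyD(1)[OF var, of i]
  obtain Z where Z: "zariski_closed Z"
      "coord X i ` (patch X i \<inter> patch X j) = coord X i ` patch X i - Z"
    using complex_algebraic_varietyD(2)[OF var, of i j] by blast
  define f where "f = coord X j \<circ> inv_into (patch X i) (coord X i)"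
  have "regular_map_on (coord X i ` (patch X i \<inter> patch X j)) f"
    unfolding f_def by (rule complex_algebraic_varietyD(3)[OF var])
  then have "\<exists>P Q. complex_polynomial_fun P \<and> complex_polynomial_fun Q \<and> Q (coord X i p) \<noteq> 0 \<and>
       (\<forall>w\<in>coord X i ` (patch X i \<inter> patch X j). Q w \<noteq> 0 \<longrightarrow> f w $ k = P w / Q w)" for k
    using p unfolding regular_map_on_def by blast
  then obtain P Q where PQ: "\<And>k. complex_polynomial_fun (P k)" "\<And>k. complex_polynomial_fun (Q k)"
      "\<And>k. Q k (coord X i p) \<noteq> 0"
      "\<And>k w. w \<in> coord X i ` (patch X i \<inter> patch X j) \<Longrightarrow> Q k w \<noteq> 0 \<Longrightarrow> f w $ k = P k w / Q k w"
    by metis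
  define T where "T w = (\<chi> k. P k w / Q k w)" for w
  define U where "U = - Z \<inter> (\<Inter>k. {w. Q k w \<noteq> 0})"
  have oQ: "open {w. Q k w \<noteq> 0}" for k
    by (rule open_Collect_neq[OF complex_polynomial_fun_continuous_on[OF PQ(2)] continuous_on_const])
  have "open U"
    unfolding U_def using zariski_closed_imp_closed[OF Z(1)] oQ by (intro open_Int open_INT) auto
  moreover have "holomorphic_map_on T U"
  proof (rule holomorphic_map_on_componentwise)
    fix k
    obtain P' where "\<forall>z\<in>U. (P k has_derivative P' z) (at z) \<and> (\<forall>c v. P' z (c *s v) = c * P' z v)"
      using complex_polynomial_fun_differentiable[OF PQ(1)] by (rule complex_differentiable_onE)
    note P' = this[rule_format, THEN conjunct1] this[rule_format, THEN conjunct2, rule_format]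
    obtain Q' where "\<forall>z\<in>U. (Q k has_derivative Q' z) (at z) \<and> (\<forall>c v. Q' z (c *s v) = c * Q' z v)"
      using complex_polynomial_fun_differentiable[OF PQ(2)] by (rule complex_differentiable_onE)
    note Q' = this[rule_format, THEN conjunct1] this[rule_format, THEN conjunct2, rule_format]
    show "complex_differentiable_on (\<lambda>z. T z $ k) U"
      unfolding complex_differentiable_on_def
    proof
      fix z assume z: "z \<in> U"
      then have "Q k z \<noteq> 0" by (simp add: U_def)
      from has_derivative_divide'[OF P'(1)[OF z] Q'(1)[OF z] this]
      show "\<exists>f'. ((\<lambda>z. T z $ k) has_derivative f') (at z) \<and> (\<forall>c v. f' (c *s v) = c * f' v)"
        by (intro exI conjI) (auto simp: T_def P'(2)[OF z] Q'(2)[OF z] algebra_simps diff_divide_distrib)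
    qed
  qed
  moreover have "x \<in> patch X j \<and> coord X j x = T (coord X i x)"
    if x: "x \<in> patch X i" "coord X i x \<in> U" for x
  proof -
    have D: "coord X i x \<in> coord X i ` (patch X i \<inter> patch X j)"
      using x Z(2) by (auto simp: U_def)
    then have xj: "x \<in> patch X j" using inj_onD[OF inj _ x(1)] by auto
    have "f (coord X i x) = coord X j x"
      using x(1) inj by (simp add: f_def)
    moreover have "f (coord X i x) $ k = T (coord X i x) $ k" for k
      using PQ(4)[OF D] x(2) by (simp add: T_def U_def)
    ultimately show ?thesis using xj by (simp add: vec_eq_iff)
  qed
  ultimately have "transition X i j U T" unfolding transition_def by blast
  moreover have "coord X i p \<notin> Z" using Z(2) p by blast
  then have "coord X i p \<in> U" using PQ(3) by (simp add: U_def)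
  ultimately show thesis by (rule that)
qed

text \<open>By the chain rule along the curve, one component of the redundantly stored vector
  determines the others.\<close>

lemma tangent_space_transition:
  fixes X :: "('a, 'i::finite, 'n::finite) atlas"
  assumes T: "transition X i j U T" "coord X i p \<in> U" "(T has_derivative T') (at (coord X i p))"
    and p: "p \<in> patch X i" and \<xi>: "\<xi> \<in> tangent_space X S p"
  shows "\<xi> $ j = T' (\<xi> $ i)"
proof -
  obtain \<gamma> where \<gamma>: "\<gamma> 0 = p" "has_velocity X \<gamma> \<xi>"
    using \<xi> unfolding tangent_space_def by blast
  have pj: "p \<in> patch X j" using T p unfolding transition_def by blast
  have i: "\<forall>\<^sub>F t in at 0. \<gamma> t \<in> patch X i" "((\<lambda>t. coord X i (\<gamma> t)) has_vector_derivative \<xi> $ i) (at 0)"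
    using \<gamma> p unfolding has_velocity_def by (auto dest: spec[of _ i])
  have j: "((\<lambda>t. coord X j (\<gamma> t)) has_vector_derivative \<xi> $ j) (at 0)"
    using \<gamma> pj unfolding has_velocity_def by (auto dest: spec[of _ j])
  have "\<forall>\<^sub>F t in at 0. coord X i (\<gamma> t) \<in> U"
    using has_vector_derivative_eventually_in[OF i(2)] T(1,2) \<gamma>(1) unfolding transition_def by simp
  with i(1) have ev: "\<forall>\<^sub>F t in at 0. T (coord X i (\<gamma> t)) = coord X j (\<gamma> t)"
    by eventually_elim (use T(1) in \<open>simp add: transition_def\<close>)
  have "((\<lambda>t. T (coord X i (\<gamma> t))) has_vector_derivative T' (\<xi> $ i)) (at 0)"
    using has_vector_derivative_chain[OF i(2), of T T'] T(3) \<gamma>(1) by simp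
  then have "((\<lambda>t. coord X j (\<gamma> t)) has_vector_derivative T' (\<xi> $ i)) (at 0)"
    unfolding has_vector_derivative_def
    by (rule has_derivative_transform_eventually[OF _ ev])
       (use T(1,2) p \<gamma>(1) in \<open>auto simp: transition_def\<close>)
  with j show ?thesis by (rule vector_derivative_unique_at)
qed

text \<open>One \<Lambda> serves for all \<open>S\<close>, so sums and intersections of tangent
  spaces at \<open>p\<close> can be computed in a single chart. It respects complex scalars because
  transitions are holomorphic.\<close>

lemma tangent_space_chart:
  fixes X :: "('a, 'i::finite, 'n::finite) atlas"
  assumes var: "complex_algebraic_variety X" and p: "p \<in> patch X i"
  obtains \<Lambda> where "linear \<Lambda>" "\<And>c v. \<Lambda> (c *s v) = cscale c (\<Lambda> v)" "\<And>v. \<Lambda> v $ i = v"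
    "\<And>S. tangent_space X S p = \<Lambda> ` velocities (coord X i ` (S \<inter> patch X i)) (coord X i p)"
proof -
  let ?z = "coord X i p"
  note inj = complex_algebraic_varietyD(1)[OF var, of i]
  have "\<exists>U T T'. p \<in> patch X j \<longrightarrow> transition X i j U T \<and> ?z \<in> U \<and> (T has_derivative T') (at ?z) \<and>
      (\<forall>c v. T' (c *s v) = c *s T' v)" for j
  proof (cases "p \<in> patch X j")
    case True
    obtain U T where "transition X i j U T" "?z \<in> U"
      using transition_exists[OF var p True] by blast
    moreover from this obtain T' where "(T has_derivative T') (at ?z)" "\<forall>c v. T' (c *s v) = c *s T' v"
      unfolding transition_def holomorphic_map_on_def by blast
    ultimately show ?thesis by blast
  qed simp
  then obtain U T T' where T: "\<And>j. p \<in> patch X j \<Longrightarrow> transition X i j (U j) (T j)"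
      "\<And>j. p \<in> patch X j \<Longrightarrow> ?z \<in> U j" "\<And>j. p \<in> patch X j \<Longrightarrow> (T j has_derivative T' j) (at ?z)"
      "\<And>j c v. p \<in> patch X j \<Longrightarrow> T' j (c *s v) = c *s T' j v"
    by metis
  have lT': "linear (T' j)" if "p \<in> patch X j" for j
    using T(3)[OF that] has_derivative_linear by blast
  \<comment> \<open>The component \<open>i\<close> is set to \<open>v\<close> directly: a transition
    from chart \<open>i\<close> to itself is the identity only on the algebraic set, so its
    derivative may move vectors that are not tangent.\<close>
  define \<Lambda> where "\<Lambda> v = (\<chi> j. if j = i then v else if p \<in> patch X j then T' j v else 0)" for v
  have "linear \<Lambda>"
    by (rule linearI) (auto simp: \<Lambda>_def vec_eq_iff linear_add[OF lT'] linear_scale[OF lT'])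
  moreover have "\<Lambda> (c *s v) = cscale c (\<Lambda> v)" for c v
    by (auto simp: \<Lambda>_def cscale_def vec_eq_iff T(4))
  moreover have \<Lambda>i: "\<Lambda> v $ i = v" for v by (simp add: \<Lambda>_def)
  moreover have "tangent_space X S p = \<Lambda> ` velocities (coord X i ` (S \<inter> patch X i)) ?z" for S
  proof (intro equalityI subsetI)
    fix \<xi> assume \<xi>: "\<xi> \<in> tangent_space X S p"
    then obtain \<gamma> where \<gamma>: "\<gamma> 0 = p" "range \<gamma> \<subseteq> S" "has_velocity X \<gamma> \<xi>"
      unfolding tangent_space_def by blast
    have i: "\<forall>\<^sub>F t in at 0. \<gamma> t \<in> patch X i" "((\<lambda>t. coord X i (\<gamma> t)) has_vector_derivative \<xi> $ i) (at 0)"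
      using \<gamma> p unfolding has_velocity_def by (auto dest: spec[of _ i])
    have "p \<in> S" using \<gamma>(1,2) by auto
    have "\<xi> $ i \<in> velocities (coord X i ` (S \<inter> patch X i)) ?z"
    proof (rule velocitiesI[OF _ _ _ i(2)])
      show "\<forall>\<^sub>F t in at 0. coord X i (\<gamma> t) \<in> coord X i ` (S \<inter> patch X i)"
        using i(1) by eventually_elim (use \<gamma>(2) in auto)
    qed (use \<open>p \<in> S\<close> p \<gamma>(1) in auto)
    moreover have "\<xi> = \<Lambda> (\<xi> $ i)"
    proof (simp only: vec_eq_iff[of \<xi>], rule allI)
      fix j
      show "\<xi> $ j = \<Lambda> (\<xi> $ i) $ j"
      proof (cases "p \<in> patch X j")
        case True
        show ?thesis
        proof (cases "j = i")
          case False
          then show ?thesis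
            using tangent_space_transition[OF T(1)[OF True] T(2)[OF True] T(3)[OF True] p \<xi>] True
            by (simp add: \<Lambda>_def)
        qed (simp add: \<Lambda>i)
      next
        case False
        then have "\<xi> $ j = 0" using \<gamma>(1,3) unfolding has_velocity_def by (auto dest: spec[of _ j])
        then show ?thesis using False p by (auto simp: \<Lambda>_def)
      qed
    qed
    ultimately show "\<xi> \<in> \<Lambda> ` velocities (coord X i ` (S \<inter> patch X i)) ?z" by blast
  next
    fix \<xi> assume "\<xi> \<in> \<Lambda> ` velocities (coord X i ` (S \<inter> patch X i)) ?z"
    then obtain v where \<xi>: "\<xi> = \<Lambda> v" and v: "v \<in> velocities (coord X i ` (S \<inter> patch X i)) ?z"
      by blast
    then obtain \<delta> where "\<delta> 0 = ?z" "range \<delta> \<subseteq> coord X i ` (S \<inter> patch X i)"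
        "(\<delta> has_vector_derivative v) (at 0)"
      unfolding velocities_def by blast
    then have \<delta>: "\<delta> 0 = ?z" "\<And>t. \<delta> t \<in> coord X i ` (S \<inter> patch X i)"
        "(\<delta> has_vector_derivative v) (at 0)"
      by blast+
    define \<gamma> where "\<gamma> t = inv_into (patch X i) (coord X i) (\<delta> t)" for t
    have \<gamma>: "\<gamma> t \<in> S" "\<gamma> t \<in> patch X i" "coord X i (\<gamma> t) = \<delta> t" for t
      using \<delta>(2)[of t] inj by (auto simp: \<gamma>_def)
    have \<gamma>0: "\<gamma> 0 = p" using \<delta>(1) inj p by (simp add: \<gamma>_def)
    have "if \<gamma> 0 \<in> patch X j
         then eventually (\<lambda>t. \<gamma> t \<in> patch X j) (at 0) \<and>
              ((\<lambda>t. coord X j (\<gamma> t)) has_vector_derivative \<xi> $ j) (at 0)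
         else \<xi> $ j = 0" for j
    proof (cases "j = i")
      case True
      then show ?thesis using \<gamma> \<gamma>0 p \<delta>(3) by (simp add: \<xi> \<Lambda>i)
    next
      case False
      show ?thesis
      proof (cases "p \<in> patch X j")
        case True
        have ev: "\<forall>\<^sub>F t in at 0. \<delta> t \<in> U j"
          using has_vector_derivative_eventually_in[OF \<delta>(3)] T(1,2)[OF True] \<delta>(1)
          unfolding transition_def by simp
        have in_j: "\<gamma> t \<in> patch X j \<and> T j (\<delta> t) = coord X j (\<gamma> t)" if "\<delta> t \<in> U j" for t
          using T(1)[OF True] \<gamma> that unfolding transition_def by metis
        have "((\<lambda>t. T j (\<delta> t)) has_vector_derivative T' j v) (at 0)"
          using has_vector_derivative_chain[OF \<delta>(3), of "T j" "T' j"] T(3)[OF True] \<delta>(1) by simp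
        then have "((\<lambda>t. coord X j (\<gamma> t)) has_vector_derivative T' j v) (at 0)"
          unfolding has_vector_derivative_def
        proof (rule has_derivative_transform_eventually)
          show "\<forall>\<^sub>F t in at 0. T j (\<delta> t) = coord X j (\<gamma> t)"
            using ev by eventually_elim (simp add: in_j)
          show "T j (\<delta> 0) = coord X j (\<gamma> 0)"
            using in_j[of 0] T(2)[OF True] \<delta>(1) by simp
        qed simp
        moreover have "\<forall>\<^sub>F t in at 0. \<gamma> t \<in> patch X j"
          using ev by eventually_elim (simp add: in_j)
        ultimately show ?thesis using True False \<gamma>0 by (simp add: \<xi> \<Lambda>_def)
      next
        case False
        with \<open>j \<noteq> i\<close> show ?thesis using \<gamma>0 by (simp add: \<xi> \<Lambda>_def)
      qed
    qed
    then have "has_velocity X \<gamma> \<xi>" unfolding has_velocity_def by blast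
    then show "\<xi> \<in> tangent_space X S p"
      unfolding tangent_space_def using \<gamma>0 \<gamma>(1) by blast
  qed
  ultimately show thesis by (rule that)
qed

section \<open>The transverse bundle of a slice\<close>

text \<open>The family \<open>\<Phi>\<close> splits a vector tangent to \<open>Z0\<close> into a part tangent to \<open>Z1\<close>, a part tangent to \<open>Z2\<close>
  and an error in the range of \<open>D0\<close>; the error vanishes since that range is transverse to \<open>Z0\<close>.\<close>

lemma smooth_transverse_decomposition:
  fixes w :: "'e::euclidean_space \<Rightarrow> 'e"
  assumes R0: "regular_equation_at Z0 p U0 H0 D0" and R1: "regular_equation_at Z1 p U1 H1 D1"
    and R2: "regular_equation_at Z2 p U2 H2 D2" and sub: "Z1 \<subseteq> Z0" "Z2 \<subseteq> Z0"
    and trans: "velocities Z0 p \<subseteq> velocities Z1 p + velocities Z2 p"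
    and w: "open Uw" "p \<in> Uw" "smooth_on w Uw"
  shows "\<exists>U t. open U \<and> p \<in> U \<and> U \<subseteq> Uw \<and> smooth_on t U \<and>
    (\<forall>y \<in> Z1 \<inter> Z2 \<inter> U. w y \<in> velocities Z0 y \<longrightarrow>
      t y \<in> velocities Z1 y \<and> w y - t y \<in> velocities Z2 y)"
proof -
  obtain V0 Q0 where "p \<in> V0" "tangent_projections Z0 D0 V0 Q0"
    by (rule regular_equation_nearby[OF R0])
  note Q0 = this(1) tangent_projectionsD[OF this(2)]
  obtain V1 Q1 where "p \<in> V1" "tangent_projections Z1 D1 V1 Q1"
    by (rule regular_equation_nearby[OF R1])
  note Q1 = this(1) tangent_projectionsD[OF this(2)]
  obtain V2 Q2 where "p \<in> V2" "tangent_projections Z2 D2 V2 Q2"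
    by (rule regular_equation_nearby[OF R2])
  note Q2 = this(1) tangent_projectionsD[OF this(2)]
  note R0' = regular_equation_atD[OF R0]
  have pZ: "p \<in> Z1" "p \<in> Z2"
    using regular_equation_atD(3)[OF R1] regular_equation_atD(3)[OF R2] by auto
  define L where "L x = Q1 p (fst x) + (Q2 p (fst (snd x)) + D0 (snd (snd x)))" for x
  have linL: "linear L"
    unfolding L_def
    by (intro linear_compose_add linear_compose[OF linear_fst Q1(3)[OF Q1(1)], unfolded o_def]
        linear_compose[OF linear_compose[OF linear_snd linear_fst] Q2(3)[OF Q2(1)], unfolded o_def]
        linear_compose[OF linear_compose[OF linear_snd linear_snd] R0'(6), unfolded o_def])
  have surjL: "z \<in> range L" for z
  proof -
    \<comment> \<open>The remainder \<open>z - D0 z\<close> is tangent to \<open>Z0\<close> and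
      splits by transversality; the third slot supplies \<open>D0 z\<close>.\<close>
    have "D0 (z - D0 z) = 0" by (simp add: linear_diff[OF R0'(6)] R0'(7))
    then have "z - D0 z \<in> range (Q1 p) + range (Q2 p)"
      using trans velocities_regular_equation[OF R0] Q1(1,5) Q2(1,5) pZ by auto
    then obtain a b where "z - D0 z = Q1 p a + Q2 p b" by (auto simp: set_plus_def)
    then have "L (a, b, z) = z" by (simp add: L_def algebra_simps)
    then show ?thesis by (metis rangeI)
  qed
  obtain B where B: "linear B" "\<And>z. L (B z) = z"
    using linear_generalized_inverse[OF linL] surjL by metis
  define B1 B2 B3 where "B1 z = fst (B z)" and "B2 z = fst (snd (B z))" and "B3 z = snd (snd (B z))" for z
  have lB: "linear B1" "linear B2" "linear B3"
    unfolding B1_def B2_def B3_def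
    using linear_compose[OF B(1) linear_fst] linear_compose[OF B(1) linear_compose[OF linear_snd linear_fst]]
      linear_compose[OF B(1) linear_compose[OF linear_snd linear_snd]]
    by (simp_all add: o_def)
  define \<Phi> where "\<Phi> y z = Q1 y (B1 z) + (Q2 y (B2 z) + D0 (B3 z))" for y z
  define V where "V = V0 \<inter> (V1 \<inter> (V2 \<inter> Uw))"
  have V: "open V" "p \<in> V" "V \<subseteq> V0" "V \<subseteq> V1" "V \<subseteq> V2" "V \<subseteq> Uw"
    using Q0(2,1) Q1(2,1) Q2(2,1) w(1,2) by (auto simp: V_def)
  have "linear (\<Phi> y)" if y: "y \<in> V" for y
  proof -
    have "y \<in> V1" "y \<in> V2" using V y by auto
    then show ?thesis
      unfolding \<Phi>_def
      by (intro linear_compose_add linear_compose[OF lB(1) Q1(3), unfolded o_def]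
          linear_compose[OF lB(2) Q2(3), unfolded o_def] linear_compose[OF lB(3) R0'(6), unfolded o_def])
  qed
  moreover have "smooth_on (\<lambda>y. \<Phi> y z) V" for z
    unfolding \<Phi>_def
    by (intro smooth_on_add smooth_on_const smooth_on_subset[OF Q1(4) V(4)] smooth_on_subset[OF Q2(4) V(5)])
  moreover have "\<Phi> p z = z" for z
    using B(2)[of z] by (simp add: L_def \<Phi>_def B1_def B2_def B3_def)
  ultimately obtain U \<Psi> where U: "open U" "p \<in> U" "U \<subseteq> V" and \<Psi>: "\<And>y. y \<in> U \<Longrightarrow> linear (\<Psi> y)"
    "\<And>y v. y \<in> U \<Longrightarrow> \<Phi> y (\<Psi> y v) = v" "\<And>v. smooth_on (\<lambda>y. \<Psi> y v) U"
    using smooth_family_near_identity[OF V(1,2), of \<Phi>] by metis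
  define x where "x y = \<Psi> y (w y)" for y
  define t where "t y = Q1 y (B1 (x y))" for y
  have U': "U \<subseteq> V0" "U \<subseteq> V1" "U \<subseteq> V2" "U \<subseteq> Uw" using U V by auto
  have sx: "smooth_on x U"
    unfolding x_def by (rule smooth_on_family_apply[OF U(1) \<Psi>(1,3) smooth_on_subset[OF w(3) U'(4)]])
  have lQ1: "linear (Q1 y)" if "y \<in> U" for y using Q1(3) U'(2) that by blast
  have st: "smooth_on t U"
    unfolding t_def
    by (rule smooth_on_family_apply[OF U(1) lQ1 smooth_on_subset[OF Q1(4) U'(2)]
          smooth_on_linear_compose[OF lB(1) sx]])
  have "t y \<in> velocities Z1 y \<and> w y - t y \<in> velocities Z2 y"
    if y: "y \<in> Z1 \<inter> Z2 \<inter> U" and wy: "w y \<in> velocities Z0 y" for y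
  proof -
    have y0: "y \<in> Z0 \<inter> V0" and y1: "y \<in> Z1 \<inter> V1" and y2: "y \<in> Z2 \<inter> V2"
      using y sub U' by auto
    define v where "v = Q2 y (B2 (x y))"
    have t: "t y \<in> velocities Z1 y" and v: "v \<in> velocities Z2 y"
      using Q1(5)[OF y1] Q2(5)[OF y2] by (auto simp: t_def v_def)
    have sum: "t y + (v + D0 (B3 (x y))) = w y"
      using \<Psi>(2)[of y "w y"] y by (simp add: \<Phi>_def t_def v_def x_def)
    have sub0: "subspace (velocities Z0 y)"
      using Q0(3)[of y] Q0(5)[OF y0] y0 linear_subspace_image[OF _ subspace_UNIV] by auto
    have "t y \<in> velocities Z0 y" "v \<in> velocities Z0 y"
      using t v velocities_mono[OF sub(1)] velocities_mono[OF sub(2)] by auto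
    then have "w y - t y - v \<in> velocities Z0 y"
      using wy by (intro subspace_diff[OF sub0])
    moreover have "w y - t y - v = D0 (B3 (x y))" using sum by (simp add: algebra_simps)
    ultimately have "D0 (B3 (x y)) = 0" using Q0(6)[OF y0] by simp
    then have "w y - t y = v" using sum by (simp add: algebra_simps)
    then show ?thesis using t v by simp
  qed
  with U(1,2) U'(4) st show ?thesis by blast
qed

text \<open>As \<open>p\<close> is fixed, the involution maps a neighbourhood of \<open>p\<close> in
  chart \<open>i\<close> into the same chart. There it is the restriction of the smooth map
  \<open>s\<close>, to which the fixed point lemma applies.\<close>

lemma real_points_regular_equation:
  fixes X :: "('a, 'i::finite, 'n::finite) atlas"
  assumes real: "real_algebraic_variety X \<sigma>" and ns: "nonsingular X"
    and p: "p \<in> real_points X \<sigma>" "p \<in> patch X i"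
  shows "\<exists>U H D. regular_equation_at (coord X i ` (real_points X \<sigma> \<inter> patch X i)) (coord X i p) U H D"
proof -
  let ?z = "coord X i p" and ?Z = "coord X i ` (points X \<inter> patch X i)"
  have var: "complex_algebraic_variety X" and inv: "\<And>x. x \<in> points X \<Longrightarrow> \<sigma> x \<in> points X \<and> \<sigma> (\<sigma> x) = x"
    and anti: "antiholomorphic X \<sigma>"
    using real unfolding real_algebraic_variety_def by auto
  note inj = complex_algebraic_varietyD(1)[OF var, of i]
  have \<sigma>p: "\<sigma> p = p" "p \<in> points X" using p by (auto simp: real_points_def)
  obtain U0 F where F: "open U0" "?z \<in> U0" "holomorphic_map_on F U0"
    "\<And>x. x \<in> patch X i \<Longrightarrow> coord X i x \<in> U0 \<Longrightarrow>
       \<sigma> x \<in> patch X i \<and> coord X i (\<sigma> x) = cnj_vec (F (coord X i x))"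
    using anti p(2) \<sigma>p(1) unfolding antiholomorphic_def by metis
  obtain U1 H D where reg1: "regular_equation_at ?Z ?z U1 H D"
  proof -
    have "nonsingular_point ?Z ?z"
      using ns \<sigma>p(2) p(2) unfolding nonsingular_def nonsingular_at_def by blast
    then show thesis by (rule nonsingular_point_regular_equation) (rule that)
  qed
  have reg: "regular_equation_at ?Z ?z (U1 \<inter> U0) H D"
    using F(1,2) regular_equation_atD(1,2)[OF reg1]
    by (intro regular_equation_at_subset[OF reg1] open_Int) simp_all
  define U where "U = U1 \<inter> U0"
  define s where "s x = cnj_vec (F x)" for x
  have lin: "linear (cnj_vec :: complex ^ 'n \<Rightarrow> complex ^ 'n)"
    by (auto intro!: linearI simp: cnj_vec_def vec_eq_iff)
  have "smooth_on F U"
    by (rule smooth_on_subset[OF holomorphic_map_on_imp_smooth_on[OF F(1,3)]]) (simp add: U_def)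
  then have sm: "smooth_on s U"
    unfolding s_def by (rule smooth_on_linear_compose[OF lin])
  have s: "\<sigma> x \<in> patch X i \<and> s (coord X i x) = coord X i (\<sigma> x)" if "x \<in> patch X i" "coord X i x \<in> U" for x
    using F(4)[OF that(1)] that(2) by (simp add: U_def s_def)
  have zU: "?z \<in> U" "open U"
    using regular_equation_atD(1,2)[OF reg] by (auto simp: U_def)
  have "\<exists>U' H' D'. regular_equation_at {x \<in> ?Z \<inter> U. s x = x} ?z U' H' D'"
  proof (rule regular_equation_fixed_points[OF reg[folded U_def] sm])
    show "s ?z = ?z" using s[OF p(2) zU(1)] \<sigma>p by simp
    show "s x \<in> ?Z" if x: "x \<in> ?Z" "x \<in> U" for x
    proof -
      obtain a where a: "a \<in> points X" "a \<in> patch X i" "x = coord X i a" using x by blast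
      then show ?thesis using s[OF a(2)] x(2) inv by auto
    qed
    show "s (s x) = x" if x: "x \<in> ?Z" "x \<in> U" "s x \<in> U" for x
    proof -
      obtain a where a: "a \<in> points X" "a \<in> patch X i" "x = coord X i a" using x by blast
      have "\<sigma> a \<in> patch X i" "s x = coord X i (\<sigma> a)" using s[OF a(2)] x(2) a(3) by auto
      then show ?thesis using s[of "\<sigma> a"] x(3) inv[OF a(1)] a(3) by simp
    qed
  qed
  then obtain U' H' D' where reg': "regular_equation_at {x \<in> ?Z \<inter> U. s x = x} ?z U' H' D'" by blast
  \<comment> \<open>Injectivity of the chart turns a fixed coordinate vector of \<open>s\<close>
    into a fixed point of \<sigma>.\<close>
  have "{x \<in> ?Z \<inter> U. s x = x} \<inter> U = coord X i ` (real_points X \<sigma> \<inter> patch X i) \<inter> U"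
  proof (intro equalityI subsetI)
    fix x assume "x \<in> {x \<in> ?Z \<inter> U. s x = x} \<inter> U"
    then obtain a where a: "a \<in> points X" "a \<in> patch X i" "x = coord X i a" "x \<in> U" "s x = x" by blast
    then have "coord X i (\<sigma> a) = coord X i a" "\<sigma> a \<in> patch X i" using s[OF a(2)] by auto
    then have "\<sigma> a = a" using inj a(2) by (auto dest: inj_onD)
    with a show "x \<in> coord X i ` (real_points X \<sigma> \<inter> patch X i) \<inter> U" by (auto simp: real_points_def)
  next
    fix x assume "x \<in> coord X i ` (real_points X \<sigma> \<inter> patch X i) \<inter> U"
    then obtain a where "a \<in> points X" "\<sigma> a = a" "a \<in> patch X i" "x = coord X i a" "x \<in> U"
      by (auto simp: real_points_def)
    then show "x \<in> {x \<in> ?Z \<inter> U. s x = x} \<inter> U" using s[of a] by auto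
  qed
  then show ?thesis
    using regular_equation_at_local[OF reg' zU(2,1)] by blast
qed

section \<open>Tangent spaces and the complex structure along a slice\<close>

lemma image_coord_Int:
  assumes "inj_on (coord X i) (patch X i)"
  shows "coord X i ` ((S \<inter> T) \<inter> patch X i) = coord X i ` (S \<inter> patch X i) \<inter> coord X i ` (T \<inter> patch X i)"
  using inj_on_image_Int[OF assms, of "S \<inter> patch X i" "T \<inter> patch X i"]
  by (simp add: Int_ac)

lemma subspace_velocities_regular_equation:
  "regular_equation_at Z p U H D \<Longrightarrow> subspace (velocities Z p)"
  using velocities_regular_equation[of Z p U H D] regular_equation_atD(6)[of Z p U H D]
    linear_subspace_kernel by simp

locale transverse_slice =
  fixes X :: "('a, 'i::finite, 'n::finite) atlas" and \<sigma> :: "'a \<Rightarrow> 'a" and V RX RY :: "'a set"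
  assumes real: "real_algebraic_variety X \<sigma>" and ns: "nonsingular X"
    and V: "complex_subvariety X V" "transverse_to_real X \<sigma> V"
    and RX: "RX = real_points X \<sigma>" and RY: "RY = V \<inter> RX"
begin

lemma var: "complex_algebraic_variety X"
  using real unfolding real_algebraic_variety_def by blast

lemma sub: "RX \<subseteq> points X" "V \<subseteq> points X"
  using V(1) by (auto simp: RX real_points_def complex_subvariety_def)

lemma tangent_spaces_add:
  "p \<in> RY \<Longrightarrow> tangent_space X V p + tangent_space X RX p = tangent_space X (points X) p"
  using V(2) unfolding transverse_to_real_def RY RX by blast

lemma regular_equations:
  assumes "p \<in> RY" "p \<in> patch X i"
  shows "\<exists>U H D. regular_equation_at (coord X i ` (points X \<inter> patch X i)) (coord X i p) U H D \<and>
      (\<forall>c v. D (c *s v) = c *s D v)"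
    "\<exists>U H D. regular_equation_at (coord X i ` (V \<inter> patch X i)) (coord X i p) U H D \<and>
      (\<forall>c v. D (c *s v) = c *s D v)"
    "\<exists>U H D. regular_equation_at (coord X i ` (RX \<inter> patch X i)) (coord X i p) U H D"
proof -
  have p: "p \<in> V" "p \<in> RX" "p \<in> points X" using assms(1) sub by (auto simp: RY)
  have "nonsingular_point (coord X i ` (points X \<inter> patch X i)) (coord X i p)"
    using ns p assms(2) unfolding nonsingular_def nonsingular_at_def by blast
  then show "\<exists>U H D. regular_equation_at (coord X i ` (points X \<inter> patch X i)) (coord X i p) U H D \<and>
      (\<forall>c v. D (c *s v) = c *s D v)"
    by (rule nonsingular_point_regular_equation) blast
  have "nonsingular_point (coord X i ` (V \<inter> patch X i)) (coord X i p)"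
    using V(2) p assms(2) unfolding transverse_to_real_def nonsingular_at_def RX by blast
  then show "\<exists>U H D. regular_equation_at (coord X i ` (V \<inter> patch X i)) (coord X i p) U H D \<and>
      (\<forall>c v. D (c *s v) = c *s D v)"
    by (rule nonsingular_point_regular_equation) blast
  show "\<exists>U H D. regular_equation_at (coord X i ` (RX \<inter> patch X i)) (coord X i p) U H D"
    unfolding RX using real_points_regular_equation[OF real ns _ assms(2)] p(2) by (simp add: RX)
qed

text \<open>Transversality is given for vectors stored in all charts; reading off the component
  \<open>i\<close> carries it to one chart.\<close>

lemma velocities_add:
  assumes p: "p \<in> RY" "p \<in> patch X i"
  shows "velocities (coord X i ` (points X \<inter> patch X i)) (coord X i p) \<subseteq>
    velocities (coord X i ` (RX \<inter> patch X i)) (coord X i p) +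
    velocities (coord X i ` (V \<inter> patch X i)) (coord X i p)"
proof
  obtain \<Lambda> where \<Lambda>: "linear \<Lambda>" "\<And>v. \<Lambda> v $ i = v"
    "\<And>S. tangent_space X S p = \<Lambda> ` velocities (coord X i ` (S \<inter> patch X i)) (coord X i p)"
    using tangent_space_chart[OF var p(2)] by metis
  fix v assume "v \<in> velocities (coord X i ` (points X \<inter> patch X i)) (coord X i p)"
  then have "\<Lambda> v \<in> tangent_space X V p + tangent_space X RX p"
    using tangent_spaces_add[OF p(1)] \<Lambda>(3) by blast
  then obtain a b where ab: "a \<in> velocities (coord X i ` (V \<inter> patch X i)) (coord X i p)"
      "b \<in> velocities (coord X i ` (RX \<inter> patch X i)) (coord X i p)" "\<Lambda> v = \<Lambda> a + \<Lambda> b"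
    unfolding \<Lambda>(3) set_plus_def by blast
  have "v = \<Lambda> v $ i" by (simp add: \<Lambda>(2))
  also have "\<dots> = b + a" unfolding ab(3) by (simp add: \<Lambda>(2))
  finally show "v \<in> velocities (coord X i ` (RX \<inter> patch X i)) (coord X i p) +
      velocities (coord X i ` (V \<inter> patch X i)) (coord X i p)"
    using ab(1,2) by (auto simp: set_plus_def)
qed

text \<open>All four spaces are images of velocity spaces under one injective \<Lambda>, so the
  axioms can be checked in a chart, where the velocity spaces of CX, V and RX are kernels of
  differentials.\<close>

lemma transverse_subspaces:
  assumes p: "p \<in> RY"
  shows "transverse_subspaces (tangent_space X (points X) p) (tangent_space X V p)
    (tangent_space X RX p) (tangent_space X RY p)"
proof -
  obtain i where i: "p \<in> patch X i"
    using p sub by (auto simp: RY points_def)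
  let ?vel = "\<lambda>S. velocities (coord X i ` (S \<inter> patch X i)) (coord X i p)"
  obtain \<Lambda> where \<Lambda>: "linear \<Lambda>" "\<And>c v. \<Lambda> (c *s v) = cscale c (\<Lambda> v)" "\<And>v. \<Lambda> v $ i = v"
    "\<And>S. tangent_space X S p = \<Lambda> ` ?vel S"
    using tangent_space_chart[OF var i] by metis
  obtain U0 H0 D0 where R0: "regular_equation_at (coord X i ` (points X \<inter> patch X i)) (coord X i p) U0 H0 D0"
    and D0: "\<And>c v. D0 (c *s v) = c *s D0 v"
    using regular_equations(1)[OF p i] by blast
  obtain U1 H1 D1 where R1: "regular_equation_at (coord X i ` (V \<inter> patch X i)) (coord X i p) U1 H1 D1"
    and D1: "\<And>c v. D1 (c *s v) = c *s D1 v"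
    using regular_equations(2)[OF p i] by blast
  obtain U2 H2 D2 where R2: "regular_equation_at (coord X i ` (RX \<inter> patch X i)) (coord X i p) U2 H2 D2"
    using regular_equations(3)[OF p i] by blast
  have inj: "inj \<Lambda>" using \<Lambda>(3) by (metis injI)
  have "?vel RY = velocities (coord X i ` (V \<inter> patch X i) \<inter> coord X i ` (RX \<inter> patch X i)) (coord X i p)"
    unfolding RY image_coord_Int[OF complex_algebraic_varietyD(1)[OF var]] ..
  also have "\<dots> = ?vel V \<inter> ?vel RX"
    using velocities_add[OF p i] sub
    by (intro velocities_transverse_Int[OF R0 R1 R2]) (auto simp: add.commute)
  finally have velRY: "?vel RY = ?vel V \<inter> ?vel RX" .
  have "c *s v \<in> ?vel (points X)" if "v \<in> ?vel (points X)" for c v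
    using that D0 by (simp add: velocities_regular_equation[OF R0])
  moreover have "c *s v \<in> ?vel V" if "v \<in> ?vel V" for c v
    using that D1 by (simp add: velocities_regular_equation[OF R1])
  ultimately have c: "\<xi> \<in> tangent_space X (points X) p \<Longrightarrow> cscale c \<xi> \<in> tangent_space X (points X) p"
    and c': "\<xi> \<in> tangent_space X V p \<Longrightarrow> cscale c \<xi> \<in> tangent_space X V p" for c \<xi>
    unfolding \<Lambda>(4) by (auto simp flip: \<Lambda>(2))
  show ?thesis
  proof
    show "subspace (tangent_space X (points X) p)" "subspace (tangent_space X V p)"
      "subspace (tangent_space X RX p)"
      unfolding \<Lambda>(4)
      using subspace_velocities_regular_equation R0 R1 R2 linear_subspace_image[OF \<Lambda>(1)] by blast+
    show "tangent_space X RY p = tangent_space X V p \<inter> tangent_space X RX p"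
      unfolding \<Lambda>(4) velRY by (rule image_Int[OF inj])
  qed (use c c' tangent_spaces_add[OF p] in auto)
qed

text \<open>The dependence on V is genuine: over the origin of the real plane, the complex lines
  \<open>z2 = \<i> z1\<close> and \<open>z2 = - \<i> z1\<close> induce conjugate structures.\<close>

definition J :: "'a \<Rightarrow> (complex ^ 'n ^ 'i) set \<Rightarrow> (complex ^ 'n ^ 'i) set" where
  "J p C = transverse_subspaces.J (tangent_space X V p) (tangent_space X RX p) C"

lemma smooth_lift:
  assumes W: "openin (subtopology (classical_topology X) RY) W" and s: "smooth_tangent_section X RX W s"
    and p: "p \<in> W"
  shows "\<exists>W' t. openin (subtopology (classical_topology X) RY) W' \<and> p \<in> W' \<and> W' \<subseteq> W \<and>
      smooth_tangent_section X RX W' t \<and>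
      (\<forall>x\<in>W'. J x (s x +o tangent_space X RY x) = t x +o tangent_space X RY x)"
proof -
  have WRY: "W \<subseteq> RY" using W by (auto simp: openin_subtopology)
  then have pRY: "p \<in> RY" using p by blast
  obtain i where i: "p \<in> patch X i"
    using pRY sub by (auto simp: RY points_def)
  let ?C = "\<lambda>S. coord X i ` (S \<inter> patch X i)" and ?z = "coord X i p"
  obtain Ug g where g: "open Ug" "?z \<in> Ug" "smooth_on g Ug"
    "\<And>y. y \<in> W \<Longrightarrow> y \<in> patch X i \<Longrightarrow> coord X i y \<in> Ug \<Longrightarrow> s y $ i = g (coord X i y)"
    using s p i unfolding smooth_tangent_section_def by (metis IntI)
  obtain U0 H0 D0 where R0: "regular_equation_at (?C (points X)) ?z U0 H0 D0"
    using regular_equations(1)[OF pRY i] by blast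
  obtain U1 H1 D1 where R1: "regular_equation_at (?C V) ?z U1 H1 D1"
    using regular_equations(2)[OF pRY i] by blast
  obtain U2 H2 D2 where R2: "regular_equation_at (?C RX) ?z U2 H2 D2"
    using regular_equations(3)[OF pRY i] by blast
  have "?C RX \<subseteq> ?C (points X)" "?C V \<subseteq> ?C (points X)" using sub by auto
  moreover have "smooth_on (\<lambda>y. \<i> *s g y) Ug"
    by (rule smooth_on_linear_compose[OF linear_vector_smult_right g(3)])
  \<comment> \<open>With RX in the role of \<open>Z1\<close>, the part \<open>t\<close> is the one
    tangent to the real points. As \<open>g\<close> extends the section arbitrarily off RY, tangency
    of \<open>\<i> *s g y\<close> is a premise at each point.\<close>
  ultimately have "\<exists>U t. open U \<and> ?z \<in> U \<and> U \<subseteq> Ug \<and> smooth_on t U \<and>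
      (\<forall>y \<in> ?C RX \<inter> ?C V \<inter> U. \<i> *s g y \<in> velocities (?C (points X)) y \<longrightarrow>
        t y \<in> velocities (?C RX) y \<and> \<i> *s g y - t y \<in> velocities (?C V) y)"
    by (rule smooth_transverse_decomposition[OF R0 R2 R1 _ _ velocities_add[OF pRY i] g(1,2)])
  then obtain U t where U: "open U" "?z \<in> U" "U \<subseteq> Ug" and t: "smooth_on t U"
    "\<forall>y \<in> ?C RX \<inter> ?C V \<inter> U. \<i> *s g y \<in> velocities (?C (points X)) y \<longrightarrow>
        t y \<in> velocities (?C RX) y \<and> \<i> *s g y - t y \<in> velocities (?C V) y"
    by blast
  define W' where "W' = W \<inter> {x \<in> patch X i. coord X i x \<in> U}"
  have "openin (classical_topology X) {x \<in> patch X i. coord X i x \<in> U}"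
    unfolding classical_topology_def by (rule topology_generated_by_Basis) (use U(1) in blast)
  moreover obtain W0 where "openin (classical_topology X) W0" "W = W0 \<inter> RY"
    using W unfolding openin_subtopology by blast
  ultimately have W'_open: "openin (subtopology (classical_topology X) RY) W'"
    unfolding W'_def openin_subtopology
    by (intro exI[of _ "W0 \<inter> {x \<in> patch X i. coord X i x \<in> U}"] conjI openin_Int) auto
  have W': "p \<in> W'" "W' \<subseteq> W" using p i U(2) by (auto simp: W'_def)
  have "\<exists>\<xi>. \<xi> \<in> tangent_space X RX x \<and> \<xi> $ i = t (coord X i x) \<and> \<xi> - cscale \<i> (s x) \<in> tangent_space X V x"
    if x: "x \<in> W'" for x
  proof -
    have xi: "x \<in> patch X i" "coord X i x \<in> U" "x \<in> RY" "x \<in> W"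
      using x WRY by (auto simp: W'_def)
    interpret T: transverse_subspaces "tangent_space X (points X) x" "tangent_space X V x"
      "tangent_space X RX x" "tangent_space X RY x"
      by (rule transverse_subspaces[OF xi(3)])
    obtain \<Lambda> where \<Lambda>: "linear \<Lambda>" "\<And>c v. \<Lambda> (c *s v) = cscale c (\<Lambda> v)" "\<And>v. \<Lambda> v $ i = v"
      "\<And>S. tangent_space X S x = \<Lambda> ` velocities (?C S) (coord X i x)"
      using tangent_space_chart[OF var xi(1)] by metis
    have sx: "s x \<in> tangent_space X RX x" "s x $ i = g (coord X i x)"
      using s g(4) xi U(3) unfolding smooth_tangent_section_def by auto
    have "\<Lambda> (g (coord X i x)) = s x" using sx unfolding \<Lambda>(4) by (auto simp: \<Lambda>(3))
    then have ig: "cscale \<i> (s x) = \<Lambda> (\<i> *s g (coord X i x))" by (simp add: \<Lambda>(2))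
    have inj: "inj \<Lambda>" using \<Lambda>(3) by (metis injI)
    \<comment> \<open>At points of \<open>W'\<close> that premise holds, since the tangent space of
      CX is complex and contains that of RX.\<close>
    have "cscale \<i> (s x) \<in> tangent_space X (points X) x"
      using T.R_subset T.cX sx(1) by blast
    then have "\<i> *s g (coord X i x) \<in> velocities (?C (points X)) (coord X i x)"
      unfolding ig \<Lambda>(4) by (simp add: inj_image_mem_iff[OF inj])
    then have *: "t (coord X i x) \<in> velocities (?C RX) (coord X i x)"
      "\<i> *s g (coord X i x) - t (coord X i x) \<in> velocities (?C V) (coord X i x)"
      using t(2)[rule_format, of "coord X i x"] xi by (auto simp: RY)
    have "cscale \<i> (s x) - \<Lambda> (t (coord X i x)) \<in> tangent_space X V x"
      unfolding ig \<Lambda>(4) using *(2) by (simp add: inj_image_mem_iff[OF inj] flip: linear_diff[OF \<Lambda>(1)])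
    then have "\<Lambda> (t (coord X i x)) - cscale \<i> (s x) \<in> tangent_space X V x"
      using subspace_neg[OF T.sV] by fastforce
    then show ?thesis
      using *(1) \<Lambda>(3,4) by (intro exI[of _ "\<Lambda> (t (coord X i x))"]) auto
  qed
  then obtain \<tau> where \<tau>: "\<And>x. x \<in> W' \<Longrightarrow> \<tau> x \<in> tangent_space X RX x"
    "\<And>x. x \<in> W' \<Longrightarrow> \<tau> x $ i = t (coord X i x)"
    "\<And>x. x \<in> W' \<Longrightarrow> \<tau> x - cscale \<i> (s x) \<in> tangent_space X V x"
    by metis
  have "smooth_tangent_section X RX W' \<tau>"
    unfolding smooth_tangent_section_def
  proof (intro conjI ballI allI)
    \<comment> \<open>The function \<open>t\<close> describes \<tau> in chart \<open>i\<close> only;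
      in chart \<open>j\<close> the local extension is its push-forward under the derivative of the
      transition.\<close>
    fix j x assume x: "x \<in> W' \<inter> patch X j"
    have xi: "x \<in> patch X i" "coord X i x \<in> U" "x \<in> patch X j" using x by (auto simp: W'_def)
    obtain U3 T where T: "transition X i j U3 T" "coord X i x \<in> U3"
      using transition_exists[OF var xi(1,3)] by blast
    obtain U4 T2 where T2: "transition X j i U4 T2" "coord X j x \<in> U4"
      using transition_exists[OF var xi(3,1)] by blast
    have T': "open U3" "smooth_on T U3" "open U4" "smooth_on T2 U4"
      using T(1) T2(1) holomorphic_map_on_imp_smooth_on unfolding transition_def by blast+
    have T2_eq: "y \<in> patch X i \<and> coord X i y = T2 (coord X j y)" if "y \<in> patch X j" "coord X j y \<in> U4" for y
      using T2(1) that unfolding transition_def by blast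
    have "\<exists>T'. (\<forall>w\<in>U3. (T has_derivative T' w) (at w) \<and> linear (T' w)) \<and> (\<forall>v. smooth_on (\<lambda>w. T' w v) U3)"
      using smooth_on_derivative[OF T'(2,1)] by metis
    then obtain T' where dT: "\<And>w. w \<in> U3 \<Longrightarrow> (T has_derivative T' w) (at w)"
      "\<And>w. w \<in> U3 \<Longrightarrow> linear (T' w)" "\<And>v. smooth_on (\<lambda>w. T' w v) U3" by blast
    \<comment> \<open>The part of chart \<open>j\<close> that \<open>T2\<close> sends where both the
      derivative of \<open>T\<close> and the function \<open>t\<close> are smooth.\<close>
    define U5 where "U5 = U4 \<inter> T2 -` (U3 \<inter> U)"
    have U5: "open U5"
      unfolding U5_def using smooth_on_imp_continuous_on[OF T'(4)] T'(1,3) U(1)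
      by (intro continuous_open_preimage) auto
    have "coord X j x \<in> U5"
      using T2_eq[OF xi(3) T2(2)] T(2) T2(2) xi(2) by (simp add: U5_def)
    moreover have sT2: "smooth_on T2 U5" by (rule smooth_on_subset[OF T'(4)]) (auto simp: U5_def)
    have "smooth_on (\<lambda>w. T' (T2 w) (t (T2 w))) U5"
    proof (rule smooth_on_family_apply[OF U5, where L = "\<lambda>w. T' (T2 w)" and g = "\<lambda>w. t (T2 w)"])
      show "linear (T' (T2 w))" if "w \<in> U5" for w using that dT(2) by (simp add: U5_def)
      show "smooth_on (\<lambda>w. T' (T2 w) v) U5" for v
        by (rule smooth_on_compose[OF U5 dT(3) sT2]) (auto simp: U5_def)
      show "smooth_on (\<lambda>w. t (T2 w)) U5"
        by (rule smooth_on_compose[OF U5 t(1) sT2]) (auto simp: U5_def)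
    qed
    moreover have "\<tau> y $ j = T' (T2 (coord X j y)) (t (T2 (coord X j y)))"
      if y: "y \<in> W' \<inter> patch X j" "coord X j y \<in> U5" for y
    proof -
      have yi: "y \<in> patch X i" "coord X i y = T2 (coord X j y)" "coord X i y \<in> U3"
        using T2_eq[of y] y by (auto simp: U5_def)
      have "\<tau> y $ j = T' (coord X i y) (\<tau> y $ i)"
        using tangent_space_transition[OF T(1) yi(3) dT(1)[OF yi(3)] yi(1) \<tau>(1)] y by blast
      then show ?thesis using \<tau>(2) y yi(2) by simp
    qed
    ultimately show "\<exists>U g. open U \<and> coord X j x \<in> U \<and> smooth_on g U \<and>
       (\<forall>y \<in> W' \<inter> patch X j. coord X j y \<in> U \<longrightarrow> \<tau> y $ j = g (coord X j y))"
      using U5 by (intro exI[of _ U5] exI[of _ "\<lambda>w. T' (T2 w) (t (T2 w))"]) blast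
  qed (rule \<tau>(1))
  moreover have "J x (s x +o tangent_space X RY x) = \<tau> x +o tangent_space X RY x" if x: "x \<in> W'" for x
  proof -
    have xRY: "x \<in> RY" "x \<in> W" using x W' WRY by auto
    interpret T: transverse_subspaces "tangent_space X (points X) x" "tangent_space X V x"
      "tangent_space X RX x" "tangent_space X RY x"
      by (rule transverse_subspaces[OF xRY(1)])
    have "s x \<in> tangent_space X RX x"
      using s xRY unfolding smooth_tangent_section_def by blast
    then show ?thesis unfolding J_def by (rule T.J_coset[OF _ \<tau>(1,3)[OF x]])
  qed
  ultimately show ?thesis using W'_open W' by blast
qed

lemma bundle_complex_structure_J: "bundle_complex_structure X RX RY J"
  unfolding bundle_complex_structure_def
proof (intro conjI ballI allI impI)
  fix p C assume p: "p \<in> RY" and C: "C \<in> transverse_space X RX RY p"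
  interpret T: transverse_subspaces "tangent_space X (points X) p" "tangent_space X V p"
    "tangent_space X RX p" "tangent_space X RY p"
    by (rule transverse_subspaces[OF p])
  note C' = C[unfolded transverse_space_def]
  show "J p C \<in> transverse_space X RX RY p"
    unfolding J_def transverse_space_def by (rule T.J_closed[OF C'])
  show "J p (C + D) = J p C + J p D" if "D \<in> transverse_space X RX RY p" for D
    unfolding J_def by (rule T.J_add[OF C' that[unfolded transverse_space_def]])
  show "J p (quot_scaleR (tangent_space X RY p) r C) = quot_scaleR (tangent_space X RY p) r (J p C)" for r
    unfolding J_def by (rule T.J_scaleR[OF C'])
  show "J p (J p C) = quot_scaleR (tangent_space X RY p) (- 1) C"
    unfolding J_def by (rule T.J_J[OF C'])
next
  fix W s p
  assume "openin (subtopology (classical_topology X) RY) W \<and> smooth_tangent_section X RX W s" "p \<in> W"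
  then show "\<exists>W' t. openin (subtopology (classical_topology X) RY) W' \<and> p \<in> W' \<and> W' \<subseteq> W \<and>
          smooth_tangent_section X RX W' t \<and>
          (\<forall>x\<in>W'. J x (s x +o tangent_space X RY x) = t x +o tangent_space X RY x)"
    using smooth_lift by blast
qed

lemma complex_structure_defined_by_J: "complex_structure_defined_by X \<sigma> RY V J"
  unfolding complex_structure_defined_by_def Let_def RX[symmetric]
proof (intro conjI ballI allI)
  show "bundle_complex_structure X RX RY J" by (rule bundle_complex_structure_J)
  fix p assume p: "p \<in> RY"
  interpret T: transverse_subspaces "tangent_space X (points X) p" "tangent_space X V p"
    "tangent_space X RX p" "tangent_space X RY p"
    by (rule transverse_subspaces[OF p])
  have J: "J p = T.J" by (simp add: J_def fun_eq_iff)
  show "bij_betw (\<lambda>C. C + tangent_space X V p) (transverse_space X RX RY p) (transverse_space X (points X) V p)"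
    unfolding transverse_space_def by (rule T.bij_quotients)
  fix C assume C: "C \<in> transverse_space X RX RY p"
  show "C + D + tangent_space X V p = (C + tangent_space X V p) + (D + tangent_space X V p)"
    if "D \<in> transverse_space X RX RY p" for D
    using T.quotient_map_add C that unfolding transverse_space_def by blast
  show "J_scale (tangent_space X RY p) (J p) c C + tangent_space X V p =
      quot_scaleC (tangent_space X V p) c (C + tangent_space X V p)" for c
    unfolding J by (rule T.quotient_map_J_scale[OF C[unfolded transverse_space_def]])
qed

lemma complex_structure_defined_by_unique:
  assumes J': "complex_structure_defined_by X \<sigma> RY V J'" and p: "p \<in> RY"
    and C: "C \<in> transverse_space X RX RY p"
  shows "J' p C = J p C"
proof -
  interpret T: transverse_subspaces "tangent_space X (points X) p" "tangent_space X V p"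
    "tangent_space X RX p" "tangent_space X RY p"
    by (rule transverse_subspaces[OF p])
  have "J' p C \<in> transverse_space X RX RY p"
    using J' p C unfolding complex_structure_defined_by_def bundle_complex_structure_def RX[symmetric]
    by blast
  moreover have "J_scale (tangent_space X RY p) (J' p) \<i> C + tangent_space X V p =
      quot_scaleC (tangent_space X V p) \<i> (C + tangent_space X V p)"
    using J' p C unfolding complex_structure_defined_by_def Let_def RX[symmetric] by blast
  ultimately show ?thesis
    unfolding J_def using T.J_unique[of C "J' p"] C unfolding transverse_space_def by blast
qed

end

theorem theorem5:
  fixes X :: "('a, 'i::finite, 'n::finite) atlas" and \<sigma> :: "'a \<Rightarrow> 'a" and Y :: "'a set"
  assumes "real_algebraic_variety X \<sigma>"
    and "nonsingular X"
    and "slice X \<sigma> Y"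
  defines "RX \<equiv> real_points X \<sigma>"
  defines "RY \<equiv> Y \<inter> RX"
  shows "(\<exists>J. bundle_complex_structure X RX RY J) \<and>
    (\<forall>V. complex_subvariety X V \<and> transverse_to_real X \<sigma> V \<and> RY = V \<inter> RX \<longrightarrow>
       (\<exists>J. complex_structure_defined_by X \<sigma> RY V J \<and>
         (\<forall>J'. complex_structure_defined_by X \<sigma> RY V J' \<longrightarrow>
            (\<forall>p\<in>RY. \<forall>C \<in> transverse_space X RX RY p. J' p C = J p C))))"
proof (intro conjI allI impI)
  obtain V where "complex_subvariety X V" "transverse_to_real X \<sigma> V" "RY = V \<inter> RX"
    using assms(3) unfolding slice_def RX_def RY_def by blast
  then interpret transverse_slice X \<sigma> V RX RY
    using assms(1,2) by unfold_locales (auto simp: RX_def)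
  show "\<exists>J. bundle_complex_structure X RX RY J"
    using bundle_complex_structure_J by blast
next
  fix V assume "complex_subvariety X V \<and> transverse_to_real X \<sigma> V \<and> RY = V \<inter> RX"
  then interpret transverse_slice X \<sigma> V RX RY
    using assms(1,2) by unfold_locales (auto simp: RX_def)
  show "\<exists>J. complex_structure_defined_by X \<sigma> RY V J \<and>
         (\<forall>J'. complex_structure_defined_by X \<sigma> RY V J' \<longrightarrow>
            (\<forall>p\<in>RY. \<forall>C \<in> transverse_space X RX RY p. J' p C = J p C))"
    using complex_structure_defined_by_J complex_structure_defined_by_unique by blast
qed

end
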